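(* For every $b>0$ there exist $0<c,a,\alpha<\infty$ such that for every positive integer $n$ there is a probability space on which are defined a Brownian bridge $B$ and a family of processes $\{S^{(n,z)}:z\in L_n\}$ (each $S^{(n,z)}$ having the law of simple random walk conditioned on $S_n=z$) such that for every $z\in L_n$, $$\mathbb{E}\big[e^{a\Delta(n,z)}\big]\le c\,n^{\alpha}\,e^{b|z|^2/n}.$$
   Context: $S_n$ is simple random walk on $\mathbb{Z}$ started at $0$ (i.i.d. steps $\pm1$ with probability $1/2$), $L_n=\{z\in\mathbb{Z}:\mathbb{P}\{S_n=z\}>0\}$, and for $z\in L_n$, $(S^{(n,z)}_m)_{m=0}^n$ has the law of $(S_m)_{m=0}^n$ conditioned on $S_n=z$; it is extended to real times $0\le t\le n$ by linear interpolation. A (one-dimensional) Brownian bridge is $B_t=W_t-tW_1$, $0\le t\le1$, $W$ standard one-dimensional Brownian motion. Set $Y^{(n,z)}_t=\sqrt n\,B_{t/n}+\frac tn z$ for $0\le t\le n$, and $\Delta(n,z)=\sup_{0\le t\le n}|Y^{(n,z)}_t-S^{(n,z)}_t|$. *)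

theory Defs
  imports "HOL-Probability.Probability"
begin

text \<open>Simple random walk paths of length n: integer-valued functions on {0..n}
  (extended by 0 beyond n), starting at 0, with steps +-1.  Each has probability (1/2)^n
  under the simple random walk.\<close>
definition walk_paths :: "nat \<Rightarrow> (nat \<Rightarrow> int) set" where
  "walk_paths n = {p. p 0 = 0 \<and> (\<forall>m<n. \<bar>p (Suc m) - p m\<bar> = 1) \<and> (\<forall>m>n. p m = 0)}"

definition srw_prob_end :: "nat \<Rightarrow> int \<Rightarrow> real" where
  "srw_prob_end n z = real (card {p \<in> walk_paths n. p n = z}) * (1/2) ^ n"

definition L :: "nat \<Rightarrow> int set" where
  "L n = {z. srw_prob_end n z > 0}"

definition srw_cond_prob :: "nat \<Rightarrow> int \<Rightarrow> (nat \<Rightarrow> int) \<Rightarrow> real" where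
  "srw_cond_prob n z p = (if p n = z then (1/2) ^ n / srw_prob_end n z else 0)"

definition rw_bridge_process :: "'a measure \<Rightarrow> nat \<Rightarrow> int \<Rightarrow> (nat \<Rightarrow> 'a \<Rightarrow> int) \<Rightarrow> bool" where
  "rw_bridge_process M n z S \<longleftrightarrow>
     (\<forall>m. S m \<in> measurable M (count_space UNIV)) \<and>
     (\<forall>p \<in> walk_paths n.
        measure M {\<omega> \<in> space M. \<forall>m\<le>n. S m \<omega> = p m} = srw_cond_prob n z p)"

definition interp :: "(nat \<Rightarrow> int) \<Rightarrow> real \<Rightarrow> real" where
  "interp s t = (let k = nat \<lfloor>t\<rfloor> in
      real_of_int (s k) + (t - real k) * real_of_int (s (Suc k) - s k))"

text \<open>B is a (standard, one-dimensional) Brownian bridge on M: measurable coordinates,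
  continuous paths, and the finite-dimensional distributions are centred Gaussian with
  covariance min(s,t) - s t (the law of W_t - t W_1), expressed through characteristic functions.\<close>
definition brownian_bridge :: "'a measure \<Rightarrow> (real \<Rightarrow> 'a \<Rightarrow> real) \<Rightarrow> bool" where
  "brownian_bridge M B \<longleftrightarrow>
     (\<forall>t\<in>{0..1}. B t \<in> borel_measurable M) \<and>
     (\<forall>\<omega>\<in>space M. continuous_on {0..1} (\<lambda>t. B t \<omega>)) \<and>
     (\<forall>(k::nat) (ts::nat \<Rightarrow> real) (lam::nat \<Rightarrow> real). (\<forall>j<k. ts j \<in> {0..1}) \<longrightarrow>
        (\<integral>\<omega>. cis (\<Sum>j<k. lam j * B (ts j) \<omega>) \<partial>M) =
        complex_of_real (exp (- (\<Sum>i<k. \<Sum>j<k. lam i * lam j * (min (ts i) (ts j) - ts i * ts j)) / 2)))"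

definition Delta :: "nat \<Rightarrow> int \<Rightarrow> (real \<Rightarrow> 'a \<Rightarrow> real) \<Rightarrow> (nat \<Rightarrow> 'a \<Rightarrow> int) \<Rightarrow> 'a \<Rightarrow> real" where
  "Delta n z B S \<omega> = (SUP t\<in>{0..real n}.
      \<bar>sqrt (real n) * B (t / real n) \<omega> + t / real n * real_of_int z - interp (\<lambda>m. S m \<omega>) t\<bar>)"

end

(* The coupling is built by recursion on n, on product spaces. A Brownian bridge of length n = n1 + n2 consists of a
   normal variable g, which gives its value at time n1, and two independent shorter bridges. The position of the walk
   bridge at time n1 is taken to be a quantile transform of g, and the two remaining walk bridges are coupled
   recursively. For n1 = n2 = m the position is hypergeometric, symmetric about z/2, and differs from its normal
   counterpart by at most C * (1 + g^2 + z^2/m); for n1 = 1 the difference is trivially at most 2 + |g|. The claimed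
   bound, with exp (b * z^2 / n) on the right, reproduces itself under such a splitting up to a constant factor,
   because w^2/m <= (3/4) * z^2/(2 * m) + 3 * (w - z/2)^2/m leaves a positive fraction of b * z^2/(2 * m) to absorb the
   error. Since only log n splittings are needed, the constants multiply up to a power of n. *)
theory Submission
  imports Defs
begin

section \<open>Lattice paths\<close>

text \<open>One Brownian bridge has to serve all endpoints \<open>z\<close> at once, so the
  induction carries whole families: \<open>g\<close> does not depend on \<open>z\<close>, and each
  half is coupled for every possible endpoint before the random \<open>W z g\<close> selects one.
  The error on the whole interval is at most the error at the splitting time plus the larger of the
  errors on the parts; bounding the exponential of a maximum by a sum costs a factor 2 per
  splitting, which is affordable because a power of n is allowed. The quantile transform turns the
  estimate at the splitting time into a comparison of tail probabilities, obtained from ratios of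
  neighbouring weights alone, without Stirling's formula. The errors quadratic in \<open>g\<close>
  must be integrable against the normal density, which limits \<open>b\<close>; a smaller
  \<open>b\<close> only strengthens the claim, so \<open>b\<close> is lowered to at most 1/14 and
  \<open>a\<close> is 1/400 of it. At length 1 the walk is deterministic given its endpoint, and an
  actual Brownian bridge with exponentially integrable supremum is needed; it comes from Levy's
  series. Since a type cannot depend on n, every product space is mapped back injectively into the
  real sequences.\<close>

definition walk_count :: "nat \<Rightarrow> int \<Rightarrow> nat" where
  "walk_count n z = card {p \<in> walk_paths n. p n = z}"

lemma walk_paths_0: "walk_paths 0 = {\<lambda>_. 0}"
  by (auto simp: walk_paths_def fun_eq_iff) (metis gr0I)

lemma walk_paths_restrict:
  assumes "p \<in> walk_paths (Suc n)"
  shows "p(Suc n := 0) \<in> walk_paths n"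
  using assms unfolding walk_paths_def by (auto simp: less_Suc_eq)

lemma walk_paths_extend:
  assumes "q \<in> walk_paths n" "\<bar>z - q n\<bar> = 1"
  shows "q(Suc n := z) \<in> walk_paths (Suc n)"
  using assms unfolding walk_paths_def by (auto simp: less_Suc_eq)

text \<open>Paths are normalised to vanish beyond their length, so deleting the last step means
  resetting the entry at \<open>Suc n\<close> to 0, and the inverse map writes \<open>z\<close>
  there. This is the source of Pascal's rule below.\<close>

lemma walk_count_Suc_set:
  "bij_betw (\<lambda>p. p(Suc n := 0)) {p \<in> walk_paths (Suc n). p (Suc n) = z}
     ({q \<in> walk_paths n. q n = z - 1} \<union> {q \<in> walk_paths n. q n = z + 1})"
proof (rule bij_betw_byWitness[where f' = "\<lambda>q. q(Suc n := z)"])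
  show "\<forall>p\<in>{p \<in> walk_paths (Suc n). p (Suc n) = z}. (p(Suc n := 0))(Suc n := z) = p"
    by auto
  show "\<forall>q\<in>{q \<in> walk_paths n. q n = z - 1} \<union> {q \<in> walk_paths n. q n = z + 1}.
      (q(Suc n := z))(Suc n := 0) = q"
    by (auto simp: walk_paths_def)
  show "(\<lambda>p. p(Suc n := 0)) ` {p \<in> walk_paths (Suc n). p (Suc n) = z}
    \<subseteq> {q \<in> walk_paths n. q n = z - 1} \<union> {q \<in> walk_paths n. q n = z + 1}"
  proof
    fix q assume "q \<in> (\<lambda>p. p(Suc n := 0)) ` {p \<in> walk_paths (Suc n). p (Suc n) = z}"
    then obtain p where p: "p \<in> walk_paths (Suc n)" "p (Suc n) = z" "q = p(Suc n := 0)" by auto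
    have "\<bar>p (Suc n) - p n\<bar> = 1" using p(1) by (auto simp: walk_paths_def)
    then have "q n = z - 1 \<or> q n = z + 1" using p by auto
    then show "q \<in> {q \<in> walk_paths n. q n = z - 1} \<union> {q \<in> walk_paths n. q n = z + 1}"
      using walk_paths_restrict[OF p(1)] p(3) by auto
  qed
  show "(\<lambda>q. q(Suc n := z)) ` ({q \<in> walk_paths n. q n = z - 1} \<union> {q \<in> walk_paths n. q n = z + 1})
    \<subseteq> {p \<in> walk_paths (Suc n). p (Suc n) = z}"
    by (auto intro!: walk_paths_extend)
qed

lemma finite_walk_paths_end: "finite {p \<in> walk_paths n. p n = z}"
proof (induction n arbitrary: z)
  case 0 then show ?case by (simp add: walk_paths_0)
next
  case (Suc n)
  then show ?case using bij_betw_finite[OF walk_count_Suc_set[of n z]] by simp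
qed

lemma walk_count_Suc: "walk_count (Suc n) z = walk_count n (z - 1) + walk_count n (z + 1)"
  unfolding walk_count_def bij_betw_same_card[OF walk_count_Suc_set[of n z]]
  by (rule card_Un_disjoint) (auto intro: finite_walk_paths_end)

lemma walk_count_0: "walk_count 0 z = (if z = 0 then 1 else 0)"
proof -
  have "{p \<in> walk_paths 0. p 0 = z} = (if z = 0 then {\<lambda>_. 0} else {})"
    by (auto simp: walk_paths_0)
  then show ?thesis by (simp add: walk_count_def)
qed

lemma walk_count_binomial: "walk_count n (2 * int T - int n) = n choose T"
proof (induction n arbitrary: T)
  case 0 then show ?case by (cases T) (auto simp: walk_count_0)
next
  case (Suc n)
  have eq: "2 * int T - int (Suc n) + 1 = 2 * int T - int n" by simp
  show ?case
  proof (cases T)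
    case 0
    \<comment> \<open>At \<open>T = 0\<close> the lower neighbour lies below \<open>- int n\<close>,
      out of reach of any path. It is not of the form \<open>2 * int t - int n\<close>, so the
      induction hypothesis does not cover it.\<close>
    have neg: "walk_count k y = 0" if "y < - int k" for k y
      using that by (induction k arbitrary: y) (auto simp: walk_count_0 walk_count_Suc)
    show ?thesis using Suc[of T] 0 by (simp add: walk_count_Suc neg)
  next
    case (Suc t)
    have "2 * int T - int (Suc n) - 1 = 2 * int t - int n" using Suc by simp
    then have "walk_count (Suc n) (2 * int T - int (Suc n)) = (n choose t) + (n choose T)"
      unfolding walk_count_Suc eq by (simp only: Suc.IH)
    then show ?thesis using Suc by simp
  qed
qed

lemma walk_count_pos_iff: "walk_count n z > 0 \<longleftrightarrow> (\<exists>T\<le>n. z = 2 * int T - int n)"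
proof
  assume "\<exists>T\<le>n. z = 2 * int T - int n"
  then show "walk_count n z > 0" by (auto simp: walk_count_binomial)
next
  assume "walk_count n z > 0"
  then show "\<exists>T\<le>n. z = 2 * int T - int n"
  proof (induction n arbitrary: z)
    case 0 then show ?case by (auto simp: walk_count_0 split: if_splits)
  next
    case (Suc n)
    then consider "walk_count n (z - 1) > 0" | "walk_count n (z + 1) > 0"
      by (auto simp: walk_count_Suc)
    then show ?case
    proof cases
      case 1
      then obtain T where "T \<le> n" "z - 1 = 2 * int T - int n" using Suc.IH by blast
      then show ?thesis by (intro exI[of _ "Suc T"]) auto
    next
      case 2
      then obtain T where "T \<le> n" "z + 1 = 2 * int T - int n" using Suc.IH by blast
      then show ?thesis by (intro exI[of _ T]) auto
    qed
  qed
qed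

lemma srw_prob_end_eq: "srw_prob_end n z = real (walk_count n z) * (1/2) ^ n"
  by (simp add: srw_prob_end_def walk_count_def)

lemma L_eq: "L n = {z. \<exists>T\<le>n. z = 2 * int T - int n}"
  unfolding L_def srw_prob_end_eq
  by (auto simp: zero_less_mult_iff walk_count_pos_iff)

lemma L_iff_count: "z \<in> L n \<longleftrightarrow> walk_count n z > 0"
  by (simp add: L_eq walk_count_pos_iff)

lemma srw_cond_prob_eq: "srw_cond_prob n z p = (if p n = z then 1 / real (walk_count n z) else 0)"
  by (simp add: srw_cond_prob_def srw_prob_end_eq)

lemma walk_paths_end_in_L:
  assumes "p \<in> walk_paths n" shows "p n \<in> L n"
proof -
  have "card {q \<in> walk_paths n. q n = p n} > 0"
    using assms finite_walk_paths_end by (auto simp: card_gt_0_iff)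
  then show ?thesis by (simp add: L_iff_count walk_count_def)
qed

lemma walk_paths_take:
  assumes "p \<in> walk_paths (n1 + n2)"
  shows "(\<lambda>m. if m \<le> n1 then p m else 0) \<in> walk_paths n1"
  using assms unfolding walk_paths_def by auto

lemma walk_paths_drop:
  assumes "p \<in> walk_paths (n1 + n2)"
  shows "(\<lambda>m. if m \<le> n2 then p (n1 + m) - p n1 else 0) \<in> walk_paths n2"
  using assms unfolding walk_paths_def by auto

text \<open>Cutting a path at time \<open>n1\<close> is Vandermonde's identity. It normalises the
  law of the position at the splitting time.\<close>

lemma sum_walk_count_split:
  assumes "T \<le> n1 + n2"
  shows "(\<Sum>u\<le>T. walk_count n1 (2 * int u - int n1) *
            walk_count n2 (2 * int T - int (n1 + n2) - (2 * int u - int n1)))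
         = walk_count (n1 + n2) (2 * int T - int (n1 + n2))"
proof -
  have "2 * int T - int (n1 + n2) - (2 * int u - int n1) = 2 * int (T - u) - int n2" if "u \<le> T" for u
    using that by simp
  then have "(\<Sum>u\<le>T. walk_count n1 (2 * int u - int n1) *
            walk_count n2 (2 * int T - int (n1 + n2) - (2 * int u - int n1)))
     = (\<Sum>u\<le>T. (n1 choose u) * (n2 choose (T - u)))"
    by (intro sum.cong refl) (simp only: walk_count_binomial atMost_iff)
  then show ?thesis by (simp only: walk_count_binomial vandermonde)
qed

section \<open>The standard normal distribution and quantile couplings\<close>

abbreviation std_normal_cdf :: "real \<Rightarrow> real" where
  "std_normal_cdf \<equiv> cdf std_normal_distribution"

interpretation std_normal: real_distribution std_normal_distribution
  by (intro real_dist_normal_dist)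

lemma std_normal_measure:
  assumes "A \<in> sets borel"
  shows "measure std_normal_distribution A = (\<integral>x. std_normal_density x * indicator A x \<partial>lborel)"
proof -
  have "emeasure std_normal_distribution A = (\<integral>\<^sup>+x. ennreal (std_normal_density x * indicator A x) \<partial>lborel)"
    using assms by (subst emeasure_density) (auto intro!: nn_integral_cong simp: indicator_def)
  also have "\<dots> = ennreal (\<integral>x. std_normal_density x * indicator A x \<partial>lborel)"
    using assms by (intro nn_integral_eq_integral integrable_real_mult_indicator integrable_normal_density)
      (auto simp: indicator_def)
  finally show ?thesis
    by (simp add: measure_def enn2real_ennreal integral_nonneg_AE)
qed

lemma std_normal_cdf_diff:
  assumes "a \<le> v"
  shows "std_normal_cdf v = std_normal_cdf a + (LBINT y=a..v. std_normal_density y)"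
proof -
  have "{..v} = {..a} \<union> {a<..v}" using assms by auto
  then have "std_normal_cdf v = std_normal_cdf a + measure std_normal_distribution {a<..v}"
    unfolding cdf_def by (simp only:) (rule std_normal.finite_measure_Union, auto)
  also have "measure std_normal_distribution {a<..v} = (LBINT y=a..v. std_normal_density y)"
    using assms by (subst std_normal_measure)
      (auto simp: interval_integral_Ioc set_lebesgue_integral_def mult.commute)
  finally show ?thesis .
qed

lemma continuous_on_std_normal_density: "continuous_on A std_normal_density"
  unfolding normal_density_def by (intro continuous_intros) auto

text \<open>The cdf is an integral over an unbounded interval; written as a constant plus an
  integral from the base point \<open>v - 1\<close>, it falls under the fundamental theorem of
  calculus near \<open>v\<close>.\<close>

lemma std_normal_cdf_deriv: "(std_normal_cdf has_real_derivative std_normal_density v) (at v)"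
proof -
  have "((\<lambda>u. LBINT y=(v-1)..u. std_normal_density y) has_vector_derivative std_normal_density v)
      (at v within {v-1..v+1})"
    by (rule interval_integral_FTC2[OF _ _ continuous_on_std_normal_density]) simp_all
  then have "((\<lambda>u. LBINT y=(v-1)..u. std_normal_density y) has_real_derivative std_normal_density v)
      (at v within {v-1<..<v+1})"
    unfolding has_real_derivative_iff_has_vector_derivative
    by (rule has_vector_derivative_within_subset) auto
  then have "((\<lambda>u. LBINT y=(v-1)..u. std_normal_density y) has_real_derivative std_normal_density v) (at v)"
    by (subst (asm) at_within_open) simp_all
  from DERIV_add[OF DERIV_const this]
  have D: "((\<lambda>u. std_normal_cdf (v-1) + (LBINT y=(v-1)..u. std_normal_density y))
      has_real_derivative std_normal_density v) (at v)"
    by (simp only: add_0)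
  have "eventually (\<lambda>u. u \<in> {v - 1<..}) (nhds v)"
    by (rule eventually_nhds_in_open) simp_all
  then have "\<forall>\<^sub>F u in nhds v. std_normal_cdf (v-1) + (LBINT y=(v-1)..u. std_normal_density y)
      = std_normal_cdf u"
    by eventually_elim (rule std_normal_cdf_diff[symmetric], simp)
  from DERIV_cong_ev[OF refl this refl] D show ?thesis by (simp only:)
qed

lemma std_normal_cdf_strict_mono: "a < b \<Longrightarrow> std_normal_cdf a < std_normal_cdf b"
proof (erule DERIV_pos_imp_increasing)
  fix x show "\<exists>y. (std_normal_cdf has_real_derivative y) (at x) \<and> 0 < y"
    by (rule exI[of _ "std_normal_density x"]) (simp add: std_normal_cdf_deriv normal_density_pos del: std_normal_density_def)
qed

lemma std_normal_cdf_le_iff: "std_normal_cdf a \<le> std_normal_cdf b \<longleftrightarrow> a \<le> b"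
  using std_normal_cdf_strict_mono[of a b] std_normal_cdf_strict_mono[of b a] by fastforce

lemma std_normal_cdf_less_iff: "std_normal_cdf a < std_normal_cdf b \<longleftrightarrow> a < b"
  using std_normal_cdf_le_iff[of b a] by linarith

text \<open>The density is even, so the sum of the cdf at \<open>v\<close> and at \<open>- v\<close>
  has derivative 0; the constant is its limit 1 at infinity.\<close>

lemma std_normal_cdf_uminus: "std_normal_cdf (- v) = 1 - std_normal_cdf v"
proof -
  have "((\<lambda>v. std_normal_cdf v + std_normal_cdf (- v)) has_real_derivative 0) (at v)" for v
  proof -
    have "((\<lambda>v. std_normal_cdf (- v)) has_real_derivative std_normal_density (- v) * - 1) (at v)"
      by (rule DERIV_chain2[OF std_normal_cdf_deriv]) (auto intro!: derivative_eq_intros)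
    from DERIV_add[OF std_normal_cdf_deriv this] show ?thesis
      by (simp add: normal_density_def)
  qed
  then have const: "std_normal_cdf v + std_normal_cdf (- v) = std_normal_cdf w + std_normal_cdf (- w)" for v w
    by (intro DERIV_isconst_all) auto
  have "((\<lambda>v. std_normal_cdf v + std_normal_cdf (- v)) \<longlongrightarrow> 1 + 0) at_top"
    by (intro tendsto_add std_normal.cdf_lim_at_top_prob
        filterlim_compose[OF std_normal.cdf_lim_at_bot filterlim_uminus_at_bot_at_top])
  moreover have "((\<lambda>w. std_normal_cdf w + std_normal_cdf (- w)) \<longlongrightarrow> std_normal_cdf v + std_normal_cdf (- v)) at_top"
    by (intro tendsto_eventually always_eventually allI) (rule const)
  ultimately have "std_normal_cdf v + std_normal_cdf (- v) = 1 + 0"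
    using tendsto_unique trivial_limit_at_top_linorder by blast
  then show ?thesis by linarith
qed

lemma std_normal_cdf_0: "std_normal_cdf 0 = 1 / 2"
  using std_normal_cdf_uminus[of 0] by simp

lemma std_normal_cdf_between: "0 < std_normal_cdf v" "std_normal_cdf v < 1"
  using std_normal_cdf_strict_mono[of "v - 1" v] std_normal_cdf_strict_mono[of v "v + 1"]
    std_normal.cdf_nonneg[of "v - 1"] std_normal.cdf_bounded_prob[of "v + 1"] by linarith+

text \<open>On \<open>x \<le> - v\<close> the standard density is at most
  \<open>exp (- v\<^sup>2 / 2)\<close> times the normal density centred at \<open>- v\<close>,
  because \<open>v * (x + v) \<le> 0\<close> there; the shifted density has total mass 1.\<close>

lemma std_normal_tail_le:
  "std_normal_cdf (- v) \<le> exp (- v\<^sup>2 / 2)" if "v \<ge> 0"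
proof -
  have "std_normal_cdf (- v) = (\<integral>x. std_normal_density x * indicator {..- v} x \<partial>lborel)"
    unfolding cdf_def by (rule std_normal_measure) simp
  also have "\<dots> \<le> (\<integral>x. exp (- v\<^sup>2 / 2) * normal_density (- v) 1 x \<partial>lborel)"
  proof (rule integral_mono)
    show "integrable lborel (\<lambda>x. std_normal_density x * indicator {..- v} x)"
      by (intro integrable_real_mult_indicator integrable_normal_density) auto
    show "std_normal_density x * indicator {..- v} x \<le> exp (- v\<^sup>2 / 2) * normal_density (- v) 1 x" for x
    proof (cases "x \<le> - v")
      case True
      have "v * (x + v) \<le> 0" using that True by (intro mult_nonneg_nonpos) auto
      then have "- x\<^sup>2 / 2 \<le> - v\<^sup>2 / 2 + - (x + v)\<^sup>2 / 2"
        by (simp add: power2_eq_square algebra_simps)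
      then have "exp (- x\<^sup>2 / 2) \<le> exp (- v\<^sup>2 / 2) * exp (- (x + v)\<^sup>2 / 2)"
        by (simp add: exp_add[symmetric])
      then show ?thesis using True
        by (simp add: normal_density_def divide_right_mono)
    qed auto
  qed (auto intro!: integrable_normal_density)
  also have "\<dots> = exp (- v\<^sup>2 / 2)" by simp
  finally show ?thesis .
qed

text \<open>The product of this weight with the standard density is \<open>sqrt 2\<close> times the
  density of variance 2. All errors in the splittings are later brought below a constant times
  \<open>exp (g\<^sup>2 / 4)\<close>, which is where the factor \<open>sqrt 2\<close> per splitting
  comes from.\<close>

lemma std_normal_exp_square:
  "(\<integral>\<^sup>+ g. ennreal (exp (g\<^sup>2 / 4)) \<partial>std_normal_distribution) = ennreal (sqrt 2)"
proof -
  have "std_normal_density g * exp (g\<^sup>2 / 4) = sqrt 2 * normal_density 0 (sqrt 2) g" for g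
  proof -
    have "exp (- g\<^sup>2 / 2) * exp (g\<^sup>2 / 4) = exp (- (g\<^sup>2 / 4))"
      by (simp add: exp_add[symmetric])
    then have "std_normal_density g * exp (g\<^sup>2 / 4) = 1 / sqrt (2 * pi) * exp (- (g\<^sup>2 / 4))"
      unfolding std_normal_density_def by (simp only: mult.assoc)
    moreover have "sqrt 2 * normal_density 0 (sqrt 2) g = sqrt 2 / (2 * sqrt pi) * exp (- (g\<^sup>2 / 4))"
      by (simp add: normal_density_def real_sqrt_mult)
    moreover have "1 / sqrt (2 * pi) = sqrt 2 / (2 * sqrt pi)"
      by (subst frac_eq_eq) (auto simp: real_sqrt_mult)
    ultimately show ?thesis by (simp only:)
  qed
  then have "(\<integral>\<^sup>+ g. ennreal (exp (g\<^sup>2 / 4)) \<partial>std_normal_distribution)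
    = (\<integral>\<^sup>+ g. ennreal (sqrt 2) * ennreal (normal_density 0 (sqrt 2) g) \<partial>lborel)"
    by (subst nn_integral_density) (simp_all add: ennreal_mult[symmetric])
  also have "\<dots> = ennreal (sqrt 2) * (\<integral>\<^sup>+ g. ennreal (normal_density 0 (sqrt 2) g) \<partial>lborel)"
    by (rule nn_integral_cmult) auto
  also have "(\<integral>\<^sup>+ g. ennreal (normal_density 0 (sqrt 2) g) \<partial>lborel) = 1"
    by (subst nn_integral_eq_integral) auto
  finally show ?thesis by simp
qed

lemma continuous_on_std_normal_cdf: "continuous_on A std_normal_cdf"
  using DERIV_isCont[OF std_normal_cdf_deriv] continuous_at_imp_continuous_on by blast

lemma std_normal_cdf_measurable [measurable]: "std_normal_cdf \<in> borel_measurable borel"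
  by (rule borel_measurable_continuous_onI[OF continuous_on_std_normal_cdf])

lemma std_normal_cdf_attains:
  assumes "0 < c" "c < 1" obtains v where "std_normal_cdf v = c"
proof -
  obtain l where l: "std_normal_cdf l < c"
    using eventually_happens'[OF _ order_tendstoD(2)[OF std_normal.cdf_lim_at_bot assms(1)]] by auto
  obtain r where r: "std_normal_cdf r > c"
    using eventually_happens'[OF _ order_tendstoD(1)[OF std_normal.cdf_lim_at_top_prob assms(2)]] by auto
  have "l \<le> r" using l r std_normal_cdf_less_iff[of l r] by linarith
  then show ?thesis
    using that IVT'[of std_normal_cdf l c r] l r continuous_on_std_normal_cdf by fastforce
qed

text \<open>Probability integral transform. The levels 0 and 1 are treated apart because the cdf
  never attains them.\<close>

lemma std_normal_cdf_uniform:
  assumes "0 \<le> c" "c \<le> 1"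
  shows "measure std_normal_distribution {g. std_normal_cdf g \<le> c} = c"
proof -
  consider "c = 0" | "c = 1" | "0 < c" "c < 1" using assms by linarith
  then show ?thesis
  proof cases
    case 1
    then have "{g. std_normal_cdf g \<le> c} = {}"
      using std_normal_cdf_between(1) by (auto simp: not_le)
    then show ?thesis using 1 by simp
  next
    case 2
    then have "{g. std_normal_cdf g \<le> c} = space std_normal_distribution"
      using std_normal_cdf_between(2) by (auto intro: less_imp_le)
    then show ?thesis using 2 std_normal.prob_space by simp
  next
    case 3
    then obtain v where v: "std_normal_cdf v = c" using std_normal_cdf_attains by blast
    have "{g. std_normal_cdf g \<le> c} = {..v}"
      unfolding v[symmetric] by (auto simp: std_normal_cdf_le_iff)
    then show ?thesis using v by (simp add: cdf_def)
  qed
qed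

text \<open>\<open>u g\<close> is the least k whose cumulative weight reaches the normal cdf at
  \<open>g\<close>. The two bracketing inequalities hold for every \<open>g\<close>; through them a
  comparison of tails becomes a pointwise comparison of \<open>u g\<close> with
  \<open>g\<close>.\<close>

lemma quantile_coupling:
  fixes p :: "nat \<Rightarrow> real"
  assumes nonneg: "\<And>k. p k \<ge> 0" and total: "(\<Sum>k\<le>N. p k) = 1"
  obtains u :: "real \<Rightarrow> nat" where
    "u \<in> measurable borel (count_space UNIV)"
    "\<And>g. u g \<le> N" "\<And>g. (\<Sum>j<u g. p j) < std_normal_cdf g" "\<And>g. std_normal_cdf g \<le> (\<Sum>j\<le>u g. p j)"
    "\<And>k. k \<le> N \<Longrightarrow> measure std_normal_distribution {g. u g = k} = p k"
proof -
  define u where "u g = (LEAST k. std_normal_cdf g \<le> (\<Sum>j\<le>k. p j))" for g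
  have N: "std_normal_cdf g \<le> (\<Sum>j\<le>N. p j)" for g
    using std_normal_cdf_between(2)[of g] total by simp
  have upper: "std_normal_cdf g \<le> (\<Sum>j\<le>u g. p j)" for g
    unfolding u_def by (rule LeastI, rule N)
  have lower: "(\<Sum>j<u g. p j) < std_normal_cdf g" for g
  proof (cases "u g")
    case 0 then show ?thesis using std_normal_cdf_between(1) by simp
  next
    case (Suc k)
    then have "\<not> std_normal_cdf g \<le> (\<Sum>j\<le>k. p j)"
      unfolding u_def by (metis lessI not_less_Least)
    then show ?thesis using Suc by (simp add: lessThan_Suc_atMost)
  qed
  have uN: "u g \<le> N" for g unfolding u_def by (rule Least_le, rule N)
  have le_iff: "u g \<le> k \<longleftrightarrow> std_normal_cdf g \<le> (\<Sum>j\<le>k. p j)" for g k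
  proof
    assume "u g \<le> k"
    then have "(\<Sum>j\<le>u g. p j) \<le> (\<Sum>j\<le>k. p j)" by (intro sum_mono2) (auto simp: nonneg)
    then show "std_normal_cdf g \<le> (\<Sum>j\<le>k. p j)" using upper[of g] by linarith
  next
    assume "std_normal_cdf g \<le> (\<Sum>j\<le>k. p j)"
    then show "u g \<le> k" unfolding u_def by (rule Least_le)
  qed
  have eq_set: "{g. u g = k} = {g. std_normal_cdf g \<le> (\<Sum>j\<le>k. p j)} - {g. std_normal_cdf g \<le> (\<Sum>j<k. p j)}" for k
  proof (cases k)
    case 0
    have "\<not> std_normal_cdf g \<le> 0" for g
      using std_normal_cdf_between(1)[of g] by linarith
    then have "{g. std_normal_cdf g \<le> (\<Sum>j<k. p j)} = {}" using 0 by auto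
    then show ?thesis unfolding le_iff[symmetric] using 0 by auto
  next
    case (Suc l)
    show ?thesis unfolding Suc lessThan_Suc_atMost le_iff[symmetric] by auto
  qed
  have [measurable]: "{g. std_normal_cdf g \<le> c} \<in> sets borel" for c
    by measurable
  have meas: "u \<in> measurable borel (count_space UNIV)"
    by (subst measurable_count_space_eq2_countable) (auto simp: vimage_def eq_set)
  have law: "measure std_normal_distribution {g. u g = k} = p k" if "k \<le> N" for k
  proof -
    have le1: "(\<Sum>j\<le>k. p j) \<le> 1"
      using sum_mono2[of "{..N}" "{..k}" p] that nonneg total by auto
    have split: "(\<Sum>j\<le>k. p j) = (\<Sum>j<k. p j) + p k"
      by (simp add: lessThan_Suc_atMost[symmetric])
    let ?A = "\<lambda>c. {g. std_normal_cdf g \<le> c}"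
    have ge0: "0 \<le> (\<Sum>j<k. p j)" by (intro sum_nonneg nonneg)
    have "measure std_normal_distribution {g. u g = k}
        = measure std_normal_distribution (?A (\<Sum>j\<le>k. p j)) - measure std_normal_distribution (?A (\<Sum>j<k. p j))"
      unfolding eq_set using split nonneg[of k]
      by (intro std_normal.finite_measure_Diff) auto
    also have "\<dots> = (\<Sum>j\<le>k. p j) - (\<Sum>j<k. p j)"
      using le1 split nonneg[of k] ge0
      by (intro arg_cong2[where f = "(-)"] std_normal_cdf_uniform) linarith+
    finally have "measure std_normal_distribution {g. u g = k} = (\<Sum>j\<le>k. p j) - (\<Sum>j<k. p j)" .
    then show ?thesis using split by simp
  qed
  show ?thesis using that meas uN lower upper law by blast
qed

section \<open>Hypergeometric against normal tails\<close>

text \<open>The hypothesis on the ratios of increments makes \<open>Q - P\<close> first increase and then decrease, so it is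
  nonnegative once it is so at both ends. No normalising constant ever has to be estimated.\<close>
lemma tail_comparison:
  fixes P Q :: "nat \<Rightarrow> real"
  assumes dec: "\<And>k. k0 \<le> k \<Longrightarrow> k < J \<Longrightarrow> Q (Suc k) < Q k"
    and ratio: "\<And>k. k0 \<le> k \<Longrightarrow> Suc k < J \<Longrightarrow>
      (P (Suc k) - P (Suc (Suc k))) * (Q k - Q (Suc k)) \<le> (P k - P (Suc k)) * (Q (Suc k) - Q (Suc (Suc k)))"
    and "P k0 \<le> Q k0" "P J \<le> Q J" "k0 \<le> k" "k \<le> J"
  shows "P k \<le> Q k"
proof (rule ccontr)
  assume neg: "\<not> P k \<le> Q k"
  define D where "D j = Q j - P j" for j
  have ex: "\<exists>i\<ge>k0. i < k \<and> D (Suc i) < D i"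
  proof (rule ccontr)
    assume none: "\<not> ?thesis"
    have "D k0 \<le> D j" if "k0 \<le> j" "j \<le> k" for j
      using that
    proof (induction j rule: dec_induct)
      case (step j)
      then have "D j \<le> D (Suc j)" using none by (auto simp: not_less)
      then show ?case using step by simp
    qed simp
    from this[of k] show False using neg assms(3,5) by (simp add: D_def)
  qed
  then obtain i where i: "k0 \<le> i" "i < k" "D (Suc i) < D i" by blast
  \<comment> \<open>Once \<open>?a < ?b\<close>, the ratio hypothesis gives
    \<open>?a' * ?b \<le> ?a * ?b' < ?b * ?b'\<close>, hence \<open>?a' < ?b'\<close>: a descent of
    \<open>D\<close> never stops before \<open>J\<close>. A negative value at \<open>k\<close> would
    therefore persist up to \<open>J\<close>.\<close>
  have desc: "D (Suc j) < D j" if "i \<le> j" "j < J" for j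
    using that
  proof (induction j rule: dec_induct)
    case base then show ?case using i by simp
  next
    case (step j)
    let ?a = "P j - P (Suc j)" and ?b = "Q j - Q (Suc j)"
    let ?a' = "P (Suc j) - P (Suc (Suc j))" and ?b' = "Q (Suc j) - Q (Suc (Suc j))"
    have b: "?b > 0" "?b' > 0" using dec[of j] dec[of "Suc j"] step i by auto
    have "?a < ?b" using step by (simp add: D_def)
    then have "?a * ?b' < ?b * ?b'" using b by simp
    then have "?a' * ?b < ?b' * ?b" using ratio[of j] step i by (simp add: mult.commute)
    then have "?a' < ?b'" using b by (simp add: mult_less_cancel_right)
    then show ?case by (simp add: D_def)
  qed
  have "D J \<le> D j" if "k \<le> j" "j \<le> J" for j
    using that(2,1)
  proof (induction j rule: inc_induct)
    case (step j)
    then show ?case using desc[of j] i by auto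
  qed simp
  from this[of k] show False using neg assms by (simp add: D_def)
qed

text \<open>\<open>\<psi>\<close> is minus the derivative of the normal tail distorted by
  \<open>H\<close>, so a pointwise bound on \<open>\<psi> (t + d)\<close> against
  \<open>\<psi> t\<close> integrates to the same bound for the masses of two adjacent cells of width
  \<open>d\<close>. The integration is replaced by the monotonicity of \<open>F\<close>, the
  difference of the two sides with \<open>x + d\<close> made variable.\<close>

lemma std_normal_cell_ratio:
  fixes H H' :: "real \<Rightarrow> real" and \<psi> :: "real \<Rightarrow> real"
  assumes deriv: "\<And>t. (H has_real_derivative H' t) (at t)"
  defines "\<psi> \<equiv> \<lambda>t. std_normal_density (- H t) * H' t"
  shows "(\<And>t. x \<le> t \<Longrightarrow> t \<le> x + d \<Longrightarrow> \<psi> (t + d) \<le> r * \<psi> t) \<Longrightarrow> d \<ge> 0 \<Longrightarrow>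
      std_normal_cdf (- H (x + d)) - std_normal_cdf (- H (x + d + d))
        \<le> r * (std_normal_cdf (- H x) - std_normal_cdf (- H (x + d)))"
    and "(\<And>t. x \<le> t \<Longrightarrow> t \<le> x + d \<Longrightarrow> r * \<psi> t \<le> \<psi> (t + d)) \<Longrightarrow> d \<ge> 0 \<Longrightarrow>
      r * (std_normal_cdf (- H x) - std_normal_cdf (- H (x + d)))
        \<le> std_normal_cdf (- H (x + d)) - std_normal_cdf (- H (x + d + d))"
proof -
  have D0: "((\<lambda>t. std_normal_cdf (- H t)) has_real_derivative - \<psi> t) (at t)" for t
    using DERIV_chain2[OF std_normal_cdf_deriv DERIV_minus[OF deriv]] by (simp add: \<psi>_def)
  have D1: "((\<lambda>t. std_normal_cdf (- H (t + d))) has_real_derivative - \<psi> (t + d)) (at t)" for t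
    using DERIV_shift[of "\<lambda>t. std_normal_cdf (- H t)" "- \<psi> (t + d)" t d] D0 by simp
  define F where "F t = r * (std_normal_cdf (- H x) - std_normal_cdf (- H t))
      - (std_normal_cdf (- H (x + d)) - std_normal_cdf (- H (t + d)))" for t
  have DF: "(F has_real_derivative r * \<psi> t - \<psi> (t + d)) (at t)" for t
    unfolding F_def by (rule derivative_eq_intros D0 D1 refl)+ simp
  have F0: "F x = 0" by (simp add: F_def)
  show "std_normal_cdf (- H (x + d)) - std_normal_cdf (- H (x + d + d))
        \<le> r * (std_normal_cdf (- H x) - std_normal_cdf (- H (x + d)))"
    if "\<And>t. x \<le> t \<Longrightarrow> t \<le> x + d \<Longrightarrow> \<psi> (t + d) \<le> r * \<psi> t" "d \<ge> 0"
  proof -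
    have "F x \<le> F (x + d)"
      by (rule DERIV_nonneg_imp_nondecreasing) (use that DF in \<open>auto intro!: exI\<close>)
    then show ?thesis unfolding F0 by (simp add: F_def)
  qed
  show "r * (std_normal_cdf (- H x) - std_normal_cdf (- H (x + d)))
        \<le> std_normal_cdf (- H (x + d)) - std_normal_cdf (- H (x + d + d))"
    if "\<And>t. x \<le> t \<Longrightarrow> t \<le> x + d \<Longrightarrow> r * \<psi> t \<le> \<psi> (t + d)" "d \<ge> 0"
  proof -
    have "F x \<ge> F (x + d)"
      by (rule DERIV_nonpos_imp_nonincreasing) (use that DF in \<open>auto intro!: exI\<close>)
    then show ?thesis unfolding F0 by (simp add: F_def)
  qed
qed

text \<open>The logarithm of \<open>(1 - s) / (1 + s)\<close> is
  \<open>- 2 * (s + s ^ 3 / 3 + ...)\<close>; dropping all terms but the first gives an upper bound.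
  In product form the inequality also covers \<open>s \<ge> 1\<close>.\<close>

lemma one_minus_le_exp:
  fixes s :: real assumes "0 \<le> s"
  shows "1 - s \<le> (1 + s) * exp (- 2 * s)"
proof -
  have "(\<lambda>s. (1 + s) * exp (- 2 * s) - (1 - s)) 0 \<le> (\<lambda>s. (1 + s) * exp (- 2 * s) - (1 - s)) s"
  proof (rule DERIV_nonneg_imp_nondecreasing[OF assms])
    fix t :: real assume t: "0 \<le> t" "t \<le> s"
    have "(1 + 2 * t) * exp (- (2 * t)) \<le> exp (2 * t) * exp (- (2 * t))"
      by (intro mult_right_mono exp_ge_add_one_self) auto
    then have "0 \<le> 1 - (1 + 2 * t) * exp (- 2 * t)" by (simp add: exp_minus)
    moreover have "((\<lambda>s. (1 + s) * exp (- 2 * s) - (1 - s)) has_real_derivative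
        1 - (1 + 2 * t) * exp (- 2 * t)) (at t)"
      by (auto intro!: derivative_eq_intros simp: algebra_simps)
    ultimately show "\<exists>y. ((\<lambda>s. (1 + s) * exp (- 2 * s) - (1 - s)) has_real_derivative y) (at t) \<and> 0 \<le> y"
      by blast
  qed
  then show ?thesis by simp
qed

text \<open>The converse bound: for \<open>s \<le> 1/2\<close> the cubic term with coefficient 2
  dominates the whole remainder of the logarithmic series. This cubic term is what later forces a
  quadratic correction in the normal argument.\<close>

lemma one_minus_ge_exp:
  fixes s :: real assumes "0 \<le> s" "s \<le> 1/2"
  shows "1 - s \<ge> (1 + s) * exp (- (2 * s + 2 * s ^ 3))"
proof -
  let ?f = "\<lambda>s::real. (1 - s) * exp (2 * s + 2 * s ^ 3) - (1 + s)"
  have "?f 0 \<le> ?f s"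
  proof (rule DERIV_nonneg_imp_nondecreasing[OF assms(1)])
    fix t :: real assume t: "0 \<le> t" "t \<le> s"
    have t2: "t \<le> 1/2" using t assms by simp
    \<comment> \<open>\<open>?q\<close> is the cofactor of the exponential in the derivative of
      \<open>?f\<close>; the bound \<open>1 \<le> (1 + 2 * t) * ?q\<close> then suffices, since the
      exponential is at least \<open>1 + 2 * t\<close>.\<close>
    let ?q = "1 - 2 * t + 6 * t\<^sup>2 - 6 * t ^ 3"
    have "6 * t ^ 3 \<le> 6 * t\<^sup>2" using t t2 by (simp add: power3_eq_cube power2_eq_square mult_left_le)
    then have q: "?q \<ge> 0" using t2 by linarith
    have "0 \<le> t\<^sup>2 * (2 + 6 * t * (1 - 2 * t))"
      using t t2 by (intro mult_nonneg_nonneg add_nonneg_nonneg) auto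
    then have "1 \<le> (1 + 2 * t) * ?q"
      by (simp add: algebra_simps power2_eq_square power3_eq_cube)
    also have "\<dots> \<le> exp (2 * t + 2 * t ^ 3) * ?q"
    proof (rule mult_right_mono[OF _ q])
      have "1 + 2 * t \<le> 1 + (2 * t + 2 * t ^ 3)" using t by simp
      also have "\<dots> \<le> exp (2 * t + 2 * t ^ 3)" by (rule exp_ge_add_one_self)
      finally show "1 + 2 * t \<le> exp (2 * t + 2 * t ^ 3)" .
    qed
    finally have "0 \<le> exp (2 * t + 2 * t ^ 3) * ?q - 1" by simp
    moreover have "(?f has_real_derivative exp (2 * t + 2 * t ^ 3) * ?q - 1) (at t)"
      by (auto intro!: derivative_eq_intros simp: algebra_simps power2_eq_square power3_eq_cube)
    ultimately show "\<exists>y. (?f has_real_derivative y) (at t) \<and> 0 \<le> y" by blast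
  qed
  then have "(1 + s) * exp (- (2 * s + 2 * s ^ 3))
      \<le> (1 - s) * exp (2 * s + 2 * s ^ 3) * exp (- (2 * s + 2 * s ^ 3))"
    by (intro mult_right_mono) auto
  also have "\<dots> = 1 - s" by (simp add: mult.assoc exp_add[symmetric])
  finally show ?thesis .
qed

text \<open>The number \<open>u\<close> of up-steps in the first half of a walk of length \<open>2 * m\<close> with \<open>T\<close> up-steps in total.
  The walk at time \<open>m\<close> then deviates from the midpoint of its endpoints by \<open>2 * u - T\<close>, which is compared
  below with a normal variable of variance \<open>m / 2\<close>.\<close>
definition hypergeom :: "nat \<Rightarrow> nat \<Rightarrow> nat \<Rightarrow> real" where
  "hypergeom m T u = (if u \<le> T then real (m choose u) * real (m choose (T - u)) / real (2 * m choose T) else 0)"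

definition hypergeom_tail :: "nat \<Rightarrow> nat \<Rightarrow> nat \<Rightarrow> real" where
  "hypergeom_tail m T k = (\<Sum>j=k..T. hypergeom m T j)"

section \<open>Symmetry and median of the hypergeometric law\<close>

lemma hypergeom_nonneg: "hypergeom m T u \<ge> 0"
  by (simp add: hypergeom_def)

lemma hypergeom_sum:
  assumes "T \<le> 2 * m" shows "(\<Sum>u\<le>T. hypergeom m T u) = 1"
proof -
  have "(\<Sum>u\<le>T. (m choose u) * (m choose (T - u))) = 2 * m choose T"
    using vandermonde[of m m T] by (simp add: mult_2)
  then have "(\<Sum>u\<le>T. real (m choose u) * real (m choose (T - u))) = real (2 * m choose T)"
    by (metis (mono_tags, lifting) of_nat_mult of_nat_sum sum.cong)
  moreover have "(\<Sum>u\<le>T. hypergeom m T u) = (\<Sum>u\<le>T. real (m choose u) * real (m choose (T - u))) / real (2 * m choose T)"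
    by (simp add: hypergeom_def sum_divide_distrib)
  ultimately show ?thesis using assms by simp
qed

lemma hypergeom_sym: "u \<le> T \<Longrightarrow> hypergeom m T (T - u) = hypergeom m T u"
  by (simp add: hypergeom_def mult.commute)

lemma hypergeom_tail_Suc: "k \<le> T \<Longrightarrow> hypergeom_tail m T k - hypergeom_tail m T (Suc k) = hypergeom m T k"
  by (simp add: hypergeom_tail_def sum.atLeast_Suc_atMost)

lemma hypergeom_tail_lower_sum:
  assumes "T \<le> 2 * m" shows "hypergeom_tail m T k = 1 - (\<Sum>j<k. hypergeom m T j)"
proof (cases "k \<le> T")
  case True
  have "{..T} = {..<k} \<union> {k..T}" using True by auto
  then have "(\<Sum>u\<le>T. hypergeom m T u) = (\<Sum>j<k. hypergeom m T j) + hypergeom_tail m T k"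
    unfolding hypergeom_tail_def by (simp only:) (rule sum.union_disjoint, auto)
  then show ?thesis using hypergeom_sum[OF assms] by simp
next
  case False
  have "(\<Sum>j<k. hypergeom m T j) = (\<Sum>u\<le>T. hypergeom m T u)"
    by (rule sum.mono_neutral_right) (use False in \<open>auto simp: hypergeom_def\<close>)
  then show ?thesis using False hypergeom_sum[OF assms] by (simp add: hypergeom_tail_def)
qed

lemma hypergeom_lower_sum_sym:
  assumes "u \<le> T"
  shows "(\<Sum>j\<le>u. hypergeom m T j) = hypergeom_tail m T (T - u)"
  unfolding hypergeom_tail_def
  by (rule sum.reindex_bij_witness[where i = "\<lambda>j. T - j" and j = "\<lambda>j. T - j"])
     (use assms in \<open>auto simp: hypergeom_sym\<close>)

lemma hypergeom_tail_sym:
  assumes "T \<le> 2 * m" "k \<le> T"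
  shows "hypergeom_tail m T (Suc k) + hypergeom_tail m T (T - k) = 1"
  using hypergeom_tail_lower_sum[OF assms(1), of "Suc k"] hypergeom_lower_sum_sym[OF assms(2), of m]
  by (simp add: lessThan_Suc_atMost)

lemma hypergeom_tail_antimono: "k \<le> l \<Longrightarrow> hypergeom_tail m T l \<le> hypergeom_tail m T k"
  unfolding hypergeom_tail_def by (rule sum_mono2) (auto simp: hypergeom_nonneg)

text \<open>Reflection of \<open>u\<close> into \<open>T - u\<close> (exchanging the two halves of
  the walk) puts the median at \<open>T / 2\<close>. The normal tail also equals 1/2 at its centre,
  which supplies the left end of the range in \<open>tail_comparison\<close>.\<close>

lemma hypergeom_tail_le_half:
  assumes "T \<le> 2 * m" "T < 2 * k" "k \<le> Suc T" shows "hypergeom_tail m T k \<le> 1 / 2"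
proof -
  obtain l where l: "k = Suc l" using assms(2) by (cases k) auto
  have "hypergeom_tail m T k + hypergeom_tail m T (T - l) = 1"
    using hypergeom_tail_sym[OF assms(1), of l] assms(3) l by simp
  moreover have "hypergeom_tail m T k \<le> hypergeom_tail m T (T - l)"
    by (rule hypergeom_tail_antimono) (use assms(2) l in auto)
  ultimately show ?thesis by linarith
qed

lemma hypergeom_tail_ge_half:
  assumes "T \<le> 2 * m" "2 * k \<le> Suc T" shows "hypergeom_tail m T k \<ge> 1 / 2"
proof (cases k)
  case 0
  then show ?thesis using hypergeom_tail_lower_sum[OF assms(1), of 0] by simp
next
  case (Suc l)
  then have "hypergeom_tail m T k + hypergeom_tail m T (T - l) = 1"
    using hypergeom_tail_sym[OF assms(1), of l] assms(2) by simp
  moreover have "hypergeom_tail m T (T - l) \<le> hypergeom_tail m T k"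
    by (rule hypergeom_tail_antimono) (use assms(2) Suc in auto)
  ultimately show ?thesis by linarith
qed

section \<open>Ratios of consecutive hypergeometric weights\<close>

lemma hypergeom_rec:
  assumes "k \<le> m" "k < T" "T - k \<le> m"
  shows "hypergeom m T (Suc k) * ((real k + 1) * (real m - real T + real k + 1))
       = hypergeom m T k * ((real m - real k) * (real T - real k))"
proof -
  obtain j where j: "T - k = Suc j" "T - Suc k = j" "T = Suc (k + j)" using assms(2)
    by (metis Suc_diff_Suc add_Suc_right le_add_diff_inverse less_imp_le)
  have a: "real (Suc k) * real (m choose Suc k) = real (m - k) * real (m choose k)"
    by (metis binomial_absorb_comp of_nat_mult mult.commute binomial_absorption)
  have b: "real (Suc j) * real (m choose Suc j) = real (m - j) * real (m choose j)"
    by (metis binomial_absorb_comp of_nat_mult mult.commute binomial_absorption)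
  have e: "real m - real T + real k + 1 = real (m - j)" "real T - real k = real (Suc j)"
    "real m - real k = real (m - k)" "real k + 1 = real (Suc k)"
    using j assms by (auto simp: of_nat_diff)
  have "hypergeom m T (Suc k) * (real (Suc k) * real (m - j))
    = (real (Suc k) * real (m choose Suc k)) * (real (m - j) * real (m choose j)) / real (2 * m choose T)"
    using assms j by (simp add: hypergeom_def)
  also have "\<dots> = hypergeom m T k * (real (m - k) * real (Suc j))"
    unfolding a b[symmetric] using assms j by (simp add: hypergeom_def)
  finally show ?thesis unfolding e .
qed

lemma diff_le_add_mult_exp:
  fixes c x :: real assumes "c > 0" "x \<ge> 0"
  shows "c - x \<le> (c + x) * exp (- 2 * (x / c))"
proof -
  have "c * (1 - x / c) \<le> c * ((1 + x / c) * exp (- 2 * (x / c)))"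
    using assms by (intro mult_left_mono one_minus_le_exp) auto
  moreover have "c * (1 - x / c) = c - x" "c * (1 + x / c) = c + x"
    using assms by (simp_all add: right_diff_distrib distrib_left)
  ultimately show ?thesis by (simp only: mult.assoc[symmetric])
qed

text \<open>With \<open>x = 2 * k - T + 1\<close>, the deviation midway between \<open>k\<close> and
  \<open>Suc k\<close>, and \<open>\<alpha> = T + 1\<close>, \<open>\<beta> = 2 * m - T + 1\<close>,
  the ratio is \<open>(\<alpha> - x) * (\<beta> - x) / ((\<alpha> + x) * (\<beta> + x))\<close>.
  Each factor is bounded by \<open>one_minus_le_exp\<close>. As
  \<open>\<alpha> + \<beta> = 2 * (m + 1)\<close>, the product \<open>\<alpha> * \<beta>\<close> is
  at most \<open>(m + 1)\<^sup>2\<close>, so the bound is uniform in \<open>T\<close>.\<close>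

lemma hypergeom_ratio_upper:
  assumes "T \<le> 2 * m" "k < T" "T \<le> 2 * k"
  shows "hypergeom m T (Suc k) \<le> hypergeom m T k * exp (- (4 * (2 * real k - real T + 1) / (real m + 1)))"
proof (cases "k \<le> m")
  case False
  then show ?thesis using hypergeom_nonneg[of m T k] by (simp add: hypergeom_def binomial_eq_0)
next
  case True
  define x where "x = 2 * real k - real T + 1"
  define \<alpha> where "\<alpha> = real T + 1"
  define \<beta> where "\<beta> = 2 * real m - real T + 1"
  have T2: "real T \<le> 2 * real m" "real T \<le> 2 * real k" "real k < real T" "real k \<le> real m"
    using assms True by linarith+
  have pos: "\<alpha> > 0" "\<beta> > 0" "x \<ge> 0" using T2 by (auto simp: x_def \<alpha>_def \<beta>_def)
  have A: "real T - real k \<le> (real k + 1) * exp (- 2 * (x / \<alpha>))"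
  proof -
    have "\<alpha> - x = 2 * (real T - real k)" "\<alpha> + x = 2 * (real k + 1)" by (simp_all add: x_def \<alpha>_def)
    then have "2 * (real T - real k) \<le> 2 * ((real k + 1) * exp (- 2 * (x / \<alpha>)))"
      using diff_le_add_mult_exp[of \<alpha> x] pos by (simp only: mult.assoc)
    then show ?thesis by (subst (asm) mult_le_cancel_left_pos) simp_all
  qed
  have B: "real m - real k \<le> (real m - real T + real k + 1) * exp (- 2 * (x / \<beta>))"
  proof -
    have "\<beta> - x = 2 * (real m - real k)" "\<beta> + x = 2 * (real m - real T + real k + 1)"
      by (simp_all add: x_def \<beta>_def)
    then have "2 * (real m - real k) \<le> 2 * ((real m - real T + real k + 1) * exp (- 2 * (x / \<beta>)))"
      using diff_le_add_mult_exp[of \<beta> x] pos by (simp only: mult.assoc)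
    then show ?thesis by (subst (asm) mult_le_cancel_left_pos) simp_all
  qed
  have E: "4 * x / (real m + 1) \<le> 2 * (x / \<alpha>) + 2 * (x / \<beta>)"
  proof -
    have "0 \<le> (real m - real T)\<^sup>2" by simp
    then have "\<alpha> * \<beta> \<le> (real m + 1)\<^sup>2"
      by (simp add: \<alpha>_def \<beta>_def power2_eq_square algebra_simps)
    then have "4 * x * (\<alpha> * \<beta>) \<le> 4 * x * (real m + 1)\<^sup>2"
      using pos by (intro mult_left_mono) auto
    then have "4 * x / (real m + 1) \<le> 2 * x * (2 * (real m + 1)) / (\<alpha> * \<beta>)"
      using pos by (simp add: divide_simps power2_eq_square mult_ac)
    also have "2 * (real m + 1) = \<alpha> + \<beta>" by (simp add: \<alpha>_def \<beta>_def)
    also have "2 * x * (\<alpha> + \<beta>) / (\<alpha> * \<beta>) = 2 * (x / \<alpha>) + 2 * (x / \<beta>)"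
      using pos by (simp add: field_simps)
    finally show ?thesis .
  qed
  define AB where "AB = (real k + 1) * (real m - real T + real k + 1)"
  have AB: "AB > 0" unfolding AB_def using T2 by (intro mult_pos_pos) linarith+
  have "(real m - real k) * (real T - real k)
     \<le> ((real m - real T + real k + 1) * exp (- 2 * (x / \<beta>))) * ((real k + 1) * exp (- 2 * (x / \<alpha>)))"
    using A B T2 by (intro mult_mono) (auto intro!: mult_nonneg_nonneg)
  also have "\<dots> = AB * exp (- (2 * (x / \<alpha>) + 2 * (x / \<beta>)))"
    by (simp add: AB_def exp_diff exp_minus field_simps)
  also have "\<dots> \<le> AB * exp (- (4 * x / (real m + 1)))"
    using E AB by (intro mult_left_mono) auto
  finally have le: "(real m - real k) * (real T - real k) \<le> AB * exp (- (4 * x / (real m + 1)))" .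
  have "hypergeom m T (Suc k) * AB = hypergeom m T k * ((real m - real k) * (real T - real k))"
    unfolding AB_def by (rule hypergeom_rec) (use assms True in auto)
  also have "\<dots> \<le> hypergeom m T k * (AB * exp (- (4 * x / (real m + 1))))"
    using le hypergeom_nonneg by (rule mult_left_mono)
  finally have "hypergeom m T (Suc k) * AB \<le> (hypergeom m T k * exp (- (4 * x / (real m + 1)))) * AB"
    by (simp add: mult_ac)
  then show ?thesis using AB unfolding x_def by simp
qed

text \<open>The two factors of the ratio combine into a single \<open>(1 - s) / (1 + s)\<close> with
  \<open>s = x * (2 * m + 2) / (q + x\<^sup>2)\<close>, to which \<open>one_minus_ge_exp\<close>
  applies. \<open>\<kappa>\<close> is chosen so that
  \<open>\<kappa> * q \<ge> q + y\<^sup>2 = (m + 1)\<^sup>2\<close>, using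
  \<open>q \<ge> m\<^sup>2 / 2\<close>; hence \<open>s \<le> 2 * x * \<kappa> / m\<close>. The range
  \<open>x \<le> m / 6\<close> makes \<open>s \<le> 1 / 2\<close>.\<close>

lemma hypergeom_ratio_lower:
  fixes m T k :: nat
  defines "y \<equiv> real T - real m" and "x \<equiv> 2 * real k - real T + 1"
  defines "\<kappa> \<equiv> 1 + 2 * y\<^sup>2 / (real m)\<^sup>2"
  assumes "m \<ge> 2" "\<bar>y\<bar> \<le> real m / 2" "0 \<le> x" "x \<le> real m / 6"
  shows "hypergeom m T k * exp (- (4 * x * \<kappa> / real m * (1 + 9 * x\<^sup>2 / (real m)\<^sup>2))) \<le> hypergeom m T (Suc k)"
proof -
  have m: "real m \<ge> 2" using assms(4) by simp
  have y2: "y\<^sup>2 \<le> (real m)\<^sup>2 / 4"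
    using power_mono[of "\<bar>y\<bar>" "real m / 2" 2] assms(5) by (simp add: power_divide)
  have \<kappa>: "1 \<le> \<kappa>" "\<kappa> \<le> 3 / 2" using y2 m by (auto simp: \<kappa>_def divide_simps)
  define q where "q = (real m + 1)\<^sup>2 - y\<^sup>2"
  have "(real m)\<^sup>2 \<le> (real m + 1)\<^sup>2" by (intro power_mono) auto
  then have qm: "(real m)\<^sup>2 / 2 \<le> q" unfolding q_def using y2 zero_le_power2[of "real m"] by linarith
  have "0 < (real m)\<^sup>2" using m by simp
  then have q0: "q > 0" using qm by linarith
  have "y\<^sup>2 = 2 * y\<^sup>2 / (real m)\<^sup>2 * ((real m)\<^sup>2 / 2)" using m by simp
  also have "\<dots> \<le> 2 * y\<^sup>2 / (real m)\<^sup>2 * q"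
    by (rule mult_left_mono[OF qm]) simp
  finally have "q + y\<^sup>2 \<le> \<kappa> * q"
    unfolding \<kappa>_def distrib_right by simp
  moreover have "q + y\<^sup>2 = real m * (real m + 1) + (real m + 1)"
    by (simp add: q_def power2_eq_square algebra_simps)
  ultimately have "real m * (real m + 1) \<le> \<kappa> * q" using m by linarith
  then have q: "(real m + 1) / q \<le> \<kappa> / real m" using m q0 by (simp add: divide_simps mult_ac)
  define s where "s = x * (2 * real m + 2) / (q + x\<^sup>2)"
  have s0: "s \<ge> 0" using assms(6) q0 m by (simp add: s_def)
  have "s \<le> x * (2 * real m + 2) / q"
    unfolding s_def by (rule divide_left_mono) (use assms(6) q0 m in \<open>auto intro!: mult_pos_pos add_pos_nonneg\<close>)
  also have "\<dots> = 2 * x * ((real m + 1) / q)" by (simp add: field_simps)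
  also have "\<dots> \<le> 2 * x * (\<kappa> / real m)" using q assms(6) by (intro mult_left_mono) auto
  finally have s1: "s \<le> 2 * x * \<kappa> / real m" by simp
  also have "\<dots> \<le> 2 * x * (3/2) / real m"
    using \<kappa> assms(6) m by (intro divide_right_mono mult_left_mono) auto
  finally have s2: "s \<le> 3 * x / real m" by simp
  also have "\<dots> \<le> 1 / 2" using assms(7) m by (simp add: field_simps)
  finally have s3: "s \<le> 1 / 2" .
  have "2 * s + 2 * s ^ 3 = 2 * s * (1 + s\<^sup>2)" by (simp add: power2_eq_square power3_eq_cube algebra_simps)
  also have "\<dots> \<le> 2 * (2 * x * \<kappa> / real m) * (1 + (3 * x / real m)\<^sup>2)"
    using s1 s2 s0 by (intro mult_mono add_mono power_mono) auto
  also have "\<dots> = 4 * x * \<kappa> / real m * (1 + 9 * x\<^sup>2 / (real m)\<^sup>2)"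
    by (simp add: power_mult_distrib power_divide)
  finally have E: "2 * s + 2 * s ^ 3 \<le> 4 * x * \<kappa> / real m * (1 + 9 * x\<^sup>2 / (real m)\<^sup>2)" .
  have kk: "2 * real k = x + y + real m - 1" "real T = y + real m" by (auto simp: x_def y_def)
  have dom: "real k \<le> real m" "real k < real T" "real T \<le> real m + real k"
    using kk assms(5-7) m by linarith+
  have q2: "q + x\<^sup>2 > 0" using q0 by (simp add: add_pos_nonneg)
  have qs: "s * (q + x\<^sup>2) = x * (2 * real m + 2)" using q2 by (simp add: s_def)
  have AB: "(real k + 1) * (real m - real T + real k + 1) = (q + x\<^sup>2) * (1 + s) / 4"
  proof -
    have "(q + x\<^sup>2) * (1 + s) = q + x\<^sup>2 + x * (2 * real m + 2)" using qs by (simp add: algebra_simps)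
    also have "\<dots> = (real m + 1 + y + x) * (real m + 1 - y + x)"
      by (simp add: q_def power2_eq_square algebra_simps)
    also have "\<dots> = 4 * ((real k + 1) * (real m - real T + real k + 1))"
      by (simp add: x_def y_def algebra_simps)
    finally show ?thesis by simp
  qed
  have CD: "(real m - real k) * (real T - real k) = (q + x\<^sup>2) * (1 - s) / 4"
  proof -
    have "(q + x\<^sup>2) * (1 - s) = q + x\<^sup>2 - x * (2 * real m + 2)" using qs by (simp add: algebra_simps)
    also have "\<dots> = (real m + 1 + y - x) * (real m + 1 - y - x)"
      by (simp add: q_def power2_eq_square algebra_simps)
    also have "\<dots> = 4 * ((real m - real k) * (real T - real k))"
      by (simp add: x_def y_def algebra_simps)
    finally show ?thesis by simp
  qed
  have "hypergeom m T (Suc k) * ((q + x\<^sup>2) * (1 + s) / 4) = hypergeom m T k * ((q + x\<^sup>2) * (1 - s) / 4)"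
    unfolding AB[symmetric] CD[symmetric] by (rule hypergeom_rec) (use dom in auto)
  then have "(q + x\<^sup>2) * (hypergeom m T (Suc k) * (1 + s)) = (q + x\<^sup>2) * (hypergeom m T k * (1 - s))"
    by (simp add: mult_ac)
  then have eq: "hypergeom m T (Suc k) * (1 + s) = hypergeom m T k * (1 - s)" using q2 by simp
  have "hypergeom m T k * exp (- (4 * x * \<kappa> / real m * (1 + 9 * x\<^sup>2 / (real m)\<^sup>2))) * (1 + s)
      \<le> hypergeom m T k * exp (- (2 * s + 2 * s ^ 3)) * (1 + s)"
    using E s0 hypergeom_nonneg by (intro mult_right_mono mult_left_mono) auto
  also have "\<dots> \<le> hypergeom m T k * (1 - s)"
    using mult_left_mono[OF one_minus_ge_exp[OF s0 s3] hypergeom_nonneg[of m T k]] by (simp add: mult_ac)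
  also have "\<dots> = hypergeom m T (Suc k) * (1 + s)" by (rule eq[symmetric])
  finally show ?thesis using s0 by simp
qed

text \<open>\<open>tail_comparison\<close> runs from the centre to \<open>Suc T\<close>, where the
  hypergeometric tail is empty. The variance \<open>m / 2\<close> is, up to lower order, the largest
  over all \<open>T\<close> (attained at \<open>T = m\<close>), so no correction depending on
  \<open>T\<close> enters on this side.\<close>

lemma hypergeom_tail_le_normal:
  fixes m T k :: nat
  assumes "m \<ge> 1" "T \<le> 2 * m" "k \<le> T" "T < 2 * k"
  shows "hypergeom_tail m T k \<le> std_normal_cdf (- ((2 * real k - real T - 3) / sqrt (real m / 2)))"
proof -
  define \<sigma> where "\<sigma> = sqrt (real m / 2)"
  have \<sigma>: "\<sigma> > 0" "\<sigma>\<^sup>2 = real m / 2" using assms(1) by (auto simp: \<sigma>_def)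
  \<comment> \<open>The shift 3 is what the ratio condition asks for:
    \<open>(t - 1)\<^sup>2 - (t - 3)\<^sup>2 = 4 * t - 8\<close>, which is at most
    \<open>4 * x\<close> on the cell \<open>t \<le> x + 2\<close>. It also makes the normal tail at
    least 1/2 at \<open>k0\<close>.\<close>
  define H where "H t = (t - 3) / \<sigma>" for t
  define Q where "Q j = std_normal_cdf (- H (2 * real j - real T))" for j
  define k0 where "k0 = T div 2 + 1"
  have dH: "(H has_real_derivative 1 / \<sigma>) (at t)" for t
    unfolding H_def using \<sigma> by (auto intro!: derivative_eq_intros)
  have Q_dec: "Q (Suc j) < Q j" for j
    unfolding Q_def std_normal_cdf_less_iff H_def using \<sigma> by (simp add: divide_strict_right_mono)
  have "hypergeom_tail m T k \<le> Q k"
  proof (rule tail_comparison[where J = "Suc T" and ?k0.0 = k0])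
    show "k0 \<le> k" "k \<le> Suc T" using assms by (auto simp: k0_def)
    show "hypergeom_tail m T (Suc T) \<le> Q (Suc T)"
      using std_normal_cdf_between(1) by (simp add: hypergeom_tail_def Q_def less_imp_le)
    have "2 * real k0 - real T \<le> 3"
    proof -
      have "2 * k0 \<le> T + 2" by (simp add: k0_def)
      then show ?thesis by linarith
    qed
    then have "std_normal_cdf 0 \<le> Q k0"
      unfolding Q_def std_normal_cdf_le_iff H_def using \<sigma> by (simp add: divide_nonpos_pos)
    moreover have "hypergeom_tail m T k0 \<le> 1 / 2"
      by (rule hypergeom_tail_le_half) (use assms in \<open>auto simp: k0_def\<close>)
    ultimately show "hypergeom_tail m T k0 \<le> Q k0" by (simp add: std_normal_cdf_0)
    show "Q (Suc j) < Q j" for j by (rule Q_dec)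
    fix j assume j: "k0 \<le> j" "Suc j < Suc T"
    define x where "x = 2 * real j - real T"
    have "T \<le> 2 * j" using j by (auto simp: k0_def)
    then have x0: "x \<ge> 0" unfolding x_def by linarith
    have xT: "x \<le> real T" using j by (simp add: x_def)
    have Q_eq: "Q j = std_normal_cdf (- H x)" "Q (Suc j) = std_normal_cdf (- H (x + 2))"
      "Q (Suc (Suc j)) = std_normal_cdf (- H (x + 2 + 2))"
      by (simp_all add: Q_def x_def algebra_simps)
    have tails: "hypergeom_tail m T j - hypergeom_tail m T (Suc j) = hypergeom m T j"
      "hypergeom_tail m T (Suc j) - hypergeom_tail m T (Suc (Suc j)) = hypergeom m T (Suc j)"
      using j by (auto intro!: hypergeom_tail_Suc)
    show "(hypergeom_tail m T (Suc j) - hypergeom_tail m T (Suc (Suc j))) * (Q j - Q (Suc j))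
      \<le> (hypergeom_tail m T j - hypergeom_tail m T (Suc j)) * (Q (Suc j) - Q (Suc (Suc j)))"
    proof (cases "j < m")
      case False
      then have "hypergeom m T (Suc j) = 0" by (simp add: hypergeom_def)
      then show ?thesis unfolding tails using hypergeom_nonneg Q_dec[of "Suc j"] by (simp add: mult_nonneg_nonneg)
    next
      case True
      have xm: "x \<le> real m" using True xT by (simp add: x_def)
      define r where "r = exp (- (4 * (x + 1) / (real m + 1)))"
      have "r * (std_normal_cdf (- H x) - std_normal_cdf (- H (x + 2)))
        \<le> std_normal_cdf (- H (x + 2)) - std_normal_cdf (- H (x + 2 + 2))"
      proof (rule std_normal_cell_ratio(2)[OF dH])
        fix t assume t: "x \<le> t" "t \<le> x + 2"
        have sq: "(H s)\<^sup>2 / 2 = (s - 3)\<^sup>2 / real m" for s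
          using \<sigma> by (simp add: H_def power_divide)
        have "4 * t - 8 \<le> 4 * x" using t by simp
        then have "(4 * t - 8) / real m \<le> 4 * x / real m" by (rule divide_right_mono) simp
        also have "4 * x / real m \<le> 4 * (x + 1) / (real m + 1)"
          using xm assms(1) by (simp add: divide_simps) (simp add: algebra_simps)
        finally have "(t - 1)\<^sup>2 / real m - (t - 3)\<^sup>2 / real m \<le> 4 * (x + 1) / (real m + 1)"
          by (simp add: diff_divide_distrib[symmetric] power2_eq_square algebra_simps)
        then have "- (4 * (x + 1) / (real m + 1)) + - ((H t)\<^sup>2 / 2) \<le> - ((H (t + 2))\<^sup>2 / 2)"
          unfolding sq by simp
        then have "r * exp (- ((H t)\<^sup>2 / 2)) \<le> exp (- ((H (t + 2))\<^sup>2 / 2))"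
          unfolding r_def exp_add[symmetric] by simp
        then have "(r * exp (- ((H t)\<^sup>2 / 2))) * (1 / (sqrt (2 * pi) * \<sigma>))
            \<le> exp (- ((H (t + 2))\<^sup>2 / 2)) * (1 / (sqrt (2 * pi) * \<sigma>))"
          using \<sigma> by (intro mult_right_mono) auto
        then show "r * (std_normal_density (- H t) * (1 / \<sigma>)) \<le> std_normal_density (- H (t + 2)) * (1 / \<sigma>)"
          by (simp add: std_normal_density_def)
      qed simp
      then have cell: "r * (Q j - Q (Suc j)) \<le> Q (Suc j) - Q (Suc (Suc j))" unfolding Q_eq .
      have "hypergeom m T (Suc j) * (Q j - Q (Suc j)) \<le> (hypergeom m T j * r) * (Q j - Q (Suc j))"
        using hypergeom_ratio_upper[OF assms(2) _ \<open>T \<le> 2 * j\<close>] j Q_dec[of j]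
        unfolding r_def x_def by (intro mult_right_mono) auto
      also have "\<dots> \<le> hypergeom m T j * (Q (Suc j) - Q (Suc (Suc j)))"
        using mult_left_mono[OF cell hypergeom_nonneg[of m T j]] by (simp only: mult.assoc)
      finally show ?thesis unfolding tails .
    qed
  qed
  then show ?thesis by (simp add: Q_def H_def \<sigma>_def)
qed

text \<open>The factor \<open>\<kappa>\<close> compensates for the smaller variance of a walk with drift, and the quadratic term of \<open>h\<close>
  for the third-order term of the logarithm of the ratio in \<open>hypergeom_ratio_lower\<close>. The constant 100 makes the normal
  tail smaller than \<open>1 / 4 ^ m\<close>, hence than any atom, once the argument reaches \<open>m / 8\<close>.\<close>
lemma normal_le_hypergeom_tail:
  fixes m T k :: nat
  defines "y \<equiv> real T - real m"
  defines "\<kappa> \<equiv> 1 + 2 * y\<^sup>2 / (real m)\<^sup>2"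
  defines "h \<equiv> \<lambda>t. \<kappa> * t + 100 + 100 * t\<^sup>2 / real m"
  assumes "m \<ge> 80" "T \<le> 2 * m" "\<bar>y\<bar> \<le> real m / 2" "T \<le> 2 * k" "2 * real k - real T \<le> real m / 8"
  shows "std_normal_cdf (- (h (2 * real k - real T) / sqrt (real m / 2))) \<le> hypergeom_tail m T k"
proof -
  have m: "real m \<ge> 80" using assms(4) by simp
  define \<sigma> where "\<sigma> = sqrt (real m / 2)"
  have \<sigma>: "\<sigma> > 0" "\<sigma>\<^sup>2 = real m / 2" using m by (auto simp: \<sigma>_def)
  have \<kappa>: "1 \<le> \<kappa>" by (simp add: \<kappa>_def)
  define h' where "h' t = \<kappa> + 200 * t / real m" for t
  define H where "H t = h t / \<sigma>" for t
  define P where "P j = std_normal_cdf (- H (2 * real j - real T))" for j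
  have dh: "(h has_real_derivative h' t) (at t)" for t
    unfolding h_def h'_def using m by (auto intro!: derivative_eq_intros)
  have dH: "(H has_real_derivative h' t / \<sigma>) (at t)" for t
    unfolding H_def by (rule DERIV_cdivide[OF dh])
  have sq: "(H s)\<^sup>2 / 2 = (h s)\<^sup>2 / real m" for s
    using \<sigma> by (simp add: H_def power_divide)
  define k0 where "k0 = (T + 1) div 2"
  \<comment> \<open>\<open>J\<close> is the first index whose deviation \<open>2 * J - T\<close>
    reaches \<open>m / 8\<close>. Rounding adds less than 2, and \<open>m \<ge> 80\<close> keeps the
    result below \<open>m / 6\<close>, the range of \<open>hypergeom_ratio_lower\<close>.\<close>
  define J where "J = nat \<lceil>(real T + real m / 8) / 2\<rceil>"
  have J: "(real T + real m / 8) / 2 \<le> real J" "real J < (real T + real m / 8) / 2 + 1"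
    unfolding J_def by (simp_all add: real_nat_ceiling_ge) (smt (verit) of_nat_0_le_iff ceiling_correct of_nat_nat zero_le_ceiling m)
  have J2: "real m / 8 \<le> 2 * real J - real T" "2 * real J - real T \<le> real m / 6"
    using J m by (auto simp: field_simps)
  have dom: "j \<le> T" "j \<le> m" "T - j \<le> m" "0 < hypergeom m T j" if "k0 \<le> j" "j \<le> J" for j
  proof -
    have "T \<le> 2 * j" using that(1) by (simp add: k0_def)
    then have *: "real T \<le> 2 * real j" "2 * real j \<le> real T + real m / 6" "real m / 2 \<le> real T" "real T \<le> 3 / 2 * real m"
      using J2 that(2) assms(6) unfolding y_def by linarith+
    show 1: "j \<le> T" "j \<le> m" "T - j \<le> m" using * by linarith+
    have "m choose j > 0" "m choose (T - j) > 0" "2 * m choose T > 0"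
      using 1 assms(5) by (auto simp: zero_less_binomial_iff)
    then show "0 < hypergeom m T j" using 1 by (simp add: hypergeom_def)
  qed
  have "P k \<le> hypergeom_tail m T k"
  proof (rule tail_comparison[where J = J and ?k0.0 = k0])
    show "k0 \<le> k" using assms(7) by (simp add: k0_def)
    show "k \<le> J" using assms(8) J2(1) by linarith
    then have k0J: "k0 \<le> J" using \<open>k0 \<le> k\<close> by simp
    show "hypergeom_tail m T (Suc j) < hypergeom_tail m T j" if "k0 \<le> j" "j < J" for j
      using hypergeom_tail_Suc[of j T m] dom[of j] that by simp
    have h0: "h t \<ge> 0" if "t \<ge> 0" for t using that \<kappa> m by (simp add: h_def)
    have k0: "T \<le> 2 * k0" "2 * k0 \<le> Suc T" by (auto simp: k0_def)
    then have "P k0 \<le> std_normal_cdf 0"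
      unfolding P_def std_normal_cdf_le_iff H_def using \<sigma> h0[of "2 * real k0 - real T"] by simp
    also have "\<dots> \<le> hypergeom_tail m T k0"
      unfolding std_normal_cdf_0 by (rule hypergeom_tail_ge_half[OF assms(5) k0(2)])
    finally show "P k0 \<le> hypergeom_tail m T k0" .
    show "P J \<le> hypergeom_tail m T J"
    proof -
      define t where "t = 2 * real J - real T"
      have t: "real m / 8 \<le> t" using J2 by (simp add: t_def)
      have "(real m / 8)\<^sup>2 \<le> t\<^sup>2" using t by (intro power_mono) auto
      then have "100 * (real m / 8)\<^sup>2 / real m \<le> 100 * t\<^sup>2 / real m" using m by (intro divide_right_mono) auto
      then have "100 * real m / 64 \<le> 100 * t\<^sup>2 / real m" using m by (simp add: power2_eq_square)
      moreover have "0 \<le> \<kappa> * t" using \<kappa> t m by (intro mult_nonneg_nonneg) linarith+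
      ultimately have ht: "3 / 2 * real m \<le> h t" using m unfolding h_def by linarith
      then have "(3 / 2 * real m)\<^sup>2 \<le> (h t)\<^sup>2" by (intro power_mono) auto
      then have "(3 / 2 * real m)\<^sup>2 / real m \<le> (h t)\<^sup>2 / real m" by (rule divide_right_mono) simp
      moreover have "(3 / 2 * real m)\<^sup>2 / real m = 9 / 4 * real m" using m by (simp add: power2_eq_square)
      ultimately have ht2: "2 * real m \<le> (h t)\<^sup>2 / real m" using m by linarith
      have "H t \<ge> 0" unfolding H_def using ht \<sigma> m by simp
      then have "P J \<le> exp (- (H t)\<^sup>2 / 2)"
        unfolding P_def t_def[symmetric] by (rule std_normal_tail_le)
      also have "\<dots> \<le> exp (- (2 * real m))" using ht2 sq[of t] by simp
      also have "\<dots> \<le> 1 / 4 ^ m"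
      proof -
        have "(2::real) \<le> exp 1" using exp_ge_add_one_self[of "1::real"] by simp
        then have "(2::real) ^ (2 * m) \<le> exp 1 ^ (2 * m)" by (intro power_mono) auto
        also have "\<dots> = exp (2 * real m)" by (simp add: exp_of_nat_mult[symmetric])
        finally have "(4::real) ^ m \<le> exp (2 * real m)" by (simp add: power_mult)
        then show ?thesis by (simp add: exp_minus field_simps)
      qed
      also have "\<dots> \<le> hypergeom m T J"
      proof -
        have "1 \<le> real ((m choose J) * (m choose (T - J)))"
        proof -
          have "0 < (m choose J) * (m choose (T - J))"
            using dom(2,3)[OF k0J order_refl] by (simp add: zero_less_binomial_iff)
          then show ?thesis by linarith
        qed
        moreover have "real (2 * m choose T) \<le> 4 ^ m"
        proof -
          have "2 * m choose T \<le> 2 ^ (2 * m)" by (rule binomial_le_pow2)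
          then have "2 * m choose T \<le> 4 ^ m" by (simp add: power_mult)
          then show ?thesis by (metis of_nat_le_iff of_nat_numeral of_nat_power)
        qed
        moreover have "real (2 * m choose T) > 0" using assms(5) by (simp add: zero_less_binomial_iff)
        ultimately have "1 / 4 ^ m \<le> real ((m choose J) * (m choose (T - J))) / real (2 * m choose T)"
          by (intro frac_le) auto
        then show ?thesis using dom(1)[OF k0J order_refl] by (simp add: hypergeom_def)
      qed
      also have "\<dots> \<le> hypergeom_tail m T J"
        using hypergeom_tail_Suc[of J T m] dom(1)[OF k0J order_refl] sum_nonneg[of "{Suc J..T}" "hypergeom m T"] hypergeom_nonneg
        by (simp add: hypergeom_tail_def)
      finally show ?thesis .
    qed
    fix j assume j: "k0 \<le> j" "Suc j < J"
    define x where "x = 2 * real j - real T + 1"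
    have "T \<le> 2 * j" using j by (auto simp: k0_def)
    then have x1: "x \<ge> 1" unfolding x_def by linarith
    have "real (Suc j) \<le> real J" using j by simp
    then have x6: "x \<le> real m / 6" using J2 unfolding x_def by linarith
    have P_eq: "P j = std_normal_cdf (- H (x - 1))" "P (Suc j) = std_normal_cdf (- H (x - 1 + 2))"
      "P (Suc (Suc j)) = std_normal_cdf (- H (x - 1 + 2 + 2))"
      by (simp_all add: P_def x_def algebra_simps)
    have tails: "hypergeom_tail m T j - hypergeom_tail m T (Suc j) = hypergeom m T j"
      "hypergeom_tail m T (Suc j) - hypergeom_tail m T (Suc (Suc j)) = hypergeom m T (Suc j)"
      using j dom[of j] dom[of "Suc j"] by (auto intro!: hypergeom_tail_Suc)
    define E where "E = 4 * x * \<kappa> / real m * (1 + 9 * x\<^sup>2 / (real m)\<^sup>2)"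
    have "std_normal_cdf (- H (x - 1 + 2)) - std_normal_cdf (- H (x - 1 + 2 + 2))
      \<le> exp (- E) * (std_normal_cdf (- H (x - 1)) - std_normal_cdf (- H (x - 1 + 2)))"
    proof (rule std_normal_cell_ratio(1)[OF dH])
      fix t assume t: "x - 1 \<le> t" "t \<le> x - 1 + 2"
      \<comment> \<open>\<open>\<tau>\<close> is the midpoint of the cell from \<open>t\<close> to
        \<open>t + 2\<close>; in terms of it, the sum and the difference of \<open>h (t + 2)\<close>
        and \<open>h t\<close> have no mixed terms.\<close>
      define \<tau> where "\<tau> = t + 1"
      have \<tau>: "x \<le> \<tau>" "1 \<le> \<tau>" using t x1 by (auto simp: \<tau>_def)
      have h'1: "h' t \<ge> 1" using \<kappa> t x1 m by (simp add: h'_def add_increasing2)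
      \<comment> \<open>The density contains the factor \<open>h'\<close>, which grows along the
        cell. This growth is turned into an exponential factor, to be paid for by the constant term
        of \<open>h\<close>.\<close>
      have "h' (t + 2) = h' t + 400 / real m" by (simp add: h'_def add_divide_distrib algebra_simps)
      also have "\<dots> \<le> h' t + h' t * (400 * \<kappa> / real m)"
      proof -
        have "1 * 400 \<le> \<kappa> * 400" using \<kappa> by simp
        then have "400 / real m \<le> 400 * \<kappa> / real m" by (intro divide_right_mono) auto
        also have "\<dots> \<le> h' t * (400 * \<kappa> / real m)" using mult_right_mono[OF h'1, of "400 * \<kappa> / real m"] \<kappa> by simp
        finally show ?thesis by simp
      qed
      also have "\<dots> = h' t * (1 + 400 * \<kappa> / real m)" by (simp add: algebra_simps)
      also have "\<dots> \<le> h' t * exp (400 * \<kappa> / real m)"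
        using h'1 by (intro mult_left_mono exp_ge_add_one_self) auto
      finally have hr: "h' (t + 2) \<le> h' t * exp (400 * \<kappa> / real m)" .
      have diff: "(h (t + 2))\<^sup>2 - (h t)\<^sup>2 = (2 * \<kappa> + 400 * \<tau> / real m) * (2 * \<kappa> * \<tau> + 200 + 100 * (2 * \<tau>\<^sup>2 + 2) / real m)"
      proof -
        have "h (t + 2) - h t = 2 * \<kappa> + 400 * \<tau> / real m"
          by (simp add: h_def \<tau>_def power2_eq_square add_divide_distrib diff_divide_distrib algebra_simps)
        moreover have "h (t + 2) + h t = 2 * \<kappa> * \<tau> + 200 + 100 * (2 * \<tau>\<^sup>2 + 2) / real m"
          by (simp add: h_def \<tau>_def power2_eq_square add_divide_distrib diff_divide_distrib algebra_simps)
        ultimately show ?thesis by (simp add: square_diff_square_factored[unfolded power2_eq_square[symmetric]] power2_eq_square mult.commute)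
      qed
      have "real m * E = 4 * x * \<kappa> + 36 * \<kappa> * (x * (x\<^sup>2 / (real m)\<^sup>2))"
        using m by (simp add: E_def field_simps power2_eq_square)
      also have "x * (x\<^sup>2 / (real m)\<^sup>2) \<le> real m * (x\<^sup>2 / (real m)\<^sup>2)"
        using x6 m by (intro mult_right_mono) auto
      also have "\<dots> = x\<^sup>2 / real m" using m by (simp add: power2_eq_square)
      finally have "real m * E \<le> 4 * x * \<kappa> + 36 * \<kappa> * (x\<^sup>2 / real m)" using \<kappa> by simp
      also have "\<dots> \<le> 4 * \<tau> * \<kappa> + 36 * \<kappa> * (\<tau>\<^sup>2 / real m)"
        using \<tau> \<kappa> x1 by (intro add_mono mult_mono divide_right_mono power_mono) auto
      also have "\<dots> \<le> 4 * \<tau> * \<kappa>\<^sup>2 + 800 * \<kappa> * (\<tau>\<^sup>2 / real m)"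
        using \<tau> \<kappa> m by (intro add_mono mult_mono mult_nonneg_nonneg) (auto simp: self_le_power)
      finally have "400 * \<kappa> + real m * E \<le> 400 * \<kappa> + (4 * \<tau> * \<kappa>\<^sup>2 + 800 * \<kappa> * (\<tau>\<^sup>2 / real m))" by simp
      \<comment> \<open>Matching the terms of the expanded product:
        \<open>4 * \<kappa>\<^sup>2 * \<tau>\<close> covers the linear term of \<open>E\<close>
        because \<open>\<kappa> \<ge> 1\<close>, \<open>800 * \<kappa> * \<tau>\<^sup>2 / m\<close>
        its cubic correction, and \<open>2 * \<kappa> * 200\<close>, coming from the constant 100 in
        \<open>h\<close>, the growth of \<open>h'\<close>.\<close>
      also have "\<dots> \<le> (2 * \<kappa> + 400 * \<tau> / real m) * (2 * \<kappa> * \<tau> + 200)"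
        using \<tau> m by (simp add: algebra_simps power2_eq_square)
      also have "\<dots> \<le> (2 * \<kappa> + 400 * \<tau> / real m) * (2 * \<kappa> * \<tau> + 200 + 100 * (2 * \<tau>\<^sup>2 + 2) / real m)"
        using \<tau> \<kappa> m by (intro mult_left_mono) auto
      finally have key: "400 * \<kappa> + real m * E \<le> (h (t + 2))\<^sup>2 - (h t)\<^sup>2" unfolding diff .
      then have "(400 * \<kappa> + real m * E) / real m \<le> ((h (t + 2))\<^sup>2 - (h t)\<^sup>2) / real m"
        by (rule divide_right_mono) simp
      then have key2: "400 * \<kappa> / real m + - (H (t + 2))\<^sup>2 / 2 \<le> - E + - (H t)\<^sup>2 / 2"
        using m sq[of t] sq[of "t + 2"] by (simp add: add_divide_distrib diff_divide_distrib)
      have "exp (- (H (t + 2))\<^sup>2 / 2) * h' (t + 2) \<le> exp (- (H (t + 2))\<^sup>2 / 2) * (h' t * exp (400 * \<kappa> / real m))"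
        by (intro mult_left_mono hr) auto
      also have "\<dots> = exp (400 * \<kappa> / real m + - (H (t + 2))\<^sup>2 / 2) * h' t"
        by (simp only: exp_add mult_ac)
      also have "\<dots> \<le> exp (- E + - (H t)\<^sup>2 / 2) * h' t"
        using key2 h'1 by (intro mult_right_mono) auto
      also have "\<dots> = exp (- E) * (exp (- (H t)\<^sup>2 / 2) * h' t)"
        by (simp only: exp_add mult.assoc)
      finally have "(exp (- (H (t + 2))\<^sup>2 / 2) * h' (t + 2)) * (1 / (sqrt (2 * pi) * \<sigma>))
          \<le> (exp (- E) * (exp (- (H t)\<^sup>2 / 2) * h' t)) * (1 / (sqrt (2 * pi) * \<sigma>))"
        using \<sigma> by (intro mult_right_mono) auto
      then show "std_normal_density (- H (t + 2)) * (h' (t + 2) / \<sigma>)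
          \<le> exp (- E) * (std_normal_density (- H t) * (h' t / \<sigma>))"
        by (simp add: std_normal_density_def)
    qed simp
    then have cell: "P (Suc j) - P (Suc (Suc j)) \<le> exp (- E) * (P j - P (Suc j))" unfolding P_eq .
    have "exp (- E) * (P j - P (Suc j)) \<ge> 0"
    proof -
      have "h (x - 1) \<le> h (x - 1 + 2)"
        unfolding h_def using \<kappa> x1 m by (intro add_mono mult_left_mono divide_right_mono power_mono) auto
      then have "P (Suc j) \<le> P j"
        unfolding P_eq std_normal_cdf_le_iff H_def using \<sigma> by (simp add: divide_right_mono)
      then show ?thesis by simp
    qed
    have r: "hypergeom m T j * exp (- E) \<le> hypergeom m T (Suc j)"
      unfolding E_def x_def \<kappa>_def y_def
      by (rule hypergeom_ratio_lower) (use assms(4,6) x1 x6 in \<open>auto simp: x_def y_def\<close>)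
    have "(P (Suc j) - P (Suc (Suc j))) * hypergeom m T j \<le> (exp (- E) * (P j - P (Suc j))) * hypergeom m T j"
      by (rule mult_right_mono[OF cell hypergeom_nonneg])
    also have "\<dots> = (P j - P (Suc j)) * (hypergeom m T j * exp (- E))" by (simp only: mult_ac)
    also have "\<dots> \<le> (P j - P (Suc j)) * hypergeom m T (Suc j)"
      using \<open>exp (- E) * (P j - P (Suc j)) \<ge> 0\<close>
      by (intro mult_left_mono[OF r]) (simp add: zero_le_mult_iff)
    finally show "(P (Suc j) - P (Suc (Suc j))) * (hypergeom_tail m T j - hypergeom_tail m T (Suc j))
      \<le> (P j - P (Suc j)) * (hypergeom_tail m T (Suc j) - hypergeom_tail m T (Suc (Suc j)))"
      unfolding tails .
  qed
  then show ?thesis by (simp add: P_def H_def \<sigma>_def)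
qed

section \<open>The coupling at the splitting time\<close>

text \<open>The brackets on the quantile, fed into the two tail comparisons, give
  \<open>x - 3 \<le> \<sigma> * g\<close> for \<open>x > 0\<close> and
  \<open>\<sigma> * g \<le> h (x + 2)\<close>. The first bounds \<open>x\<^sup>2 / m\<close> by
  \<open>g\<^sup>2\<close> plus a constant, so the quadratic term of \<open>h\<close> costs
  \<open>200 * g\<^sup>2\<close>; this is the origin of 200. The excess of \<open>\<kappa>\<close>
  over 1 costs a multiple of \<open>y\<^sup>2 / m\<close>.\<close>

lemma midpoint_error_nonneg:
  fixes m T k :: nat and g :: real
  defines "y \<equiv> real T - real m" and "x \<equiv> 2 * real k - real T" and "\<sigma> \<equiv> sqrt (real m / 2)"
  assumes m: "m \<ge> 1" and T: "T \<le> 2 * m" and k: "k \<le> T" "T \<le> 2 * k"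
    and lo: "std_normal_cdf (- g) \<le> hypergeom_tail m T k"
    and up: "hypergeom_tail m T (Suc k) \<le> std_normal_cdf (- g)"
    and lo0: "T = 2 * k \<Longrightarrow> hypergeom_tail m T (Suc k) \<le> std_normal_cdf g"
  shows "\<bar>\<sigma> * g - x\<bar> \<le> 200 * (1 + g\<^sup>2 + y\<^sup>2 / real m) \<and> x\<^sup>2 \<le> real m * (g\<^sup>2 + 18)"
proof -
  have m0: "real m \<ge> 1" using m by simp
  have \<sigma>: "\<sigma> > 0" "\<sigma>\<^sup>2 = real m / 2" using m by (auto simp: \<sigma>_def)
  have x0: "x \<ge> 0" using k by (simp add: x_def)
  have lower: "x - 3 \<le> \<sigma> * g" if "x > 0"
  proof -
    have "std_normal_cdf (- g) \<le> std_normal_cdf (- ((x - 3) / \<sigma>))"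
      using lo hypergeom_tail_le_normal[OF m T k(1)] that unfolding x_def \<sigma>_def by force
    then have "(x - 3) / \<sigma> \<le> g" unfolding std_normal_cdf_le_iff by simp
    then show ?thesis using \<sigma> by (simp add: divide_le_eq mult.commute)
  qed
  have xg: "x \<le> \<sigma> * \<bar>g\<bar> + 3"
  proof (cases "x > 0")
    case True
    have "\<sigma> * g \<le> \<sigma> * \<bar>g\<bar>" using \<sigma> by (intro mult_left_mono) auto
    then show ?thesis using lower[OF True] by linarith
  next
    case False
    have "0 \<le> \<sigma> * \<bar>g\<bar>" using \<sigma> by simp
    then show ?thesis using False by linarith
  qed
  have "x\<^sup>2 \<le> (\<sigma> * \<bar>g\<bar> + 3)\<^sup>2" using xg x0 by (intro power_mono) auto
  also have "\<dots> \<le> 2 * (\<sigma> * \<bar>g\<bar>)\<^sup>2 + 18"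
    using zero_le_power2[of "\<sigma> * \<bar>g\<bar> - 3"] by (simp add: power2_eq_square algebra_simps)
  also have "\<dots> = real m * g\<^sup>2 + 18" using \<sigma>(2) by (simp add: power_mult_distrib)
  finally have x2: "x\<^sup>2 \<le> real m * g\<^sup>2 + 18" .
  also have "\<dots> \<le> real m * (g\<^sup>2 + 18)" using m0 by (simp add: algebra_simps)
  finally have second: "x\<^sup>2 \<le> real m * (g\<^sup>2 + 18)" .
  define R where "R = y\<^sup>2 / real m"
  have R: "R \<ge> 0" by (simp add: R_def)
  define G where "G = g\<^sup>2"
  have g2: "G \<ge> 0" by (simp add: G_def)
  have "\<bar>\<sigma> * g - x\<bar> \<le> 200 * (1 + G + R)"
  proof (cases "m \<ge> 80 \<and> \<bar>y\<bar> \<le> real m / 2 \<and> x + 2 \<le> real m / 8")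
    case True
    define h where "h t = (1 + 2 * y\<^sup>2 / (real m)\<^sup>2) * t + 100 + 100 * t\<^sup>2 / real m" for t
    have m80: "real m \<ge> 80" using True by simp
    have upper: "\<sigma> * g' \<le> h (x + 2)" if "hypergeom_tail m T (Suc k) \<le> std_normal_cdf (- g')" for g'
    proof -
      have e: "2 * real (Suc k) - real T = x + 2" by (simp add: x_def)
      have "std_normal_cdf (- (h (2 * real (Suc k) - real T) / \<sigma>)) \<le> hypergeom_tail m T (Suc k)"
        unfolding h_def \<sigma>_def y_def
        by (rule normal_le_hypergeom_tail) (use True T k in \<open>auto simp: y_def x_def\<close>)
      then have "std_normal_cdf (- (h (x + 2) / \<sigma>)) \<le> hypergeom_tail m T (Suc k)" unfolding e .
      then have "std_normal_cdf (- (h (x + 2) / \<sigma>)) \<le> std_normal_cdf (- g')" using that by linarith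
      then have "g' \<le> h (x + 2) / \<sigma>" unfolding std_normal_cdf_le_iff by simp
      then show ?thesis using \<sigma> by (simp add: le_divide_eq mult.commute)
    qed
    have "(x + 2)\<^sup>2 \<le> 2 * x\<^sup>2 + 8"
      using zero_le_power2[of "x - 2"] by (simp add: power2_eq_square algebra_simps)
    also have "\<dots> \<le> 2 * (real m * g\<^sup>2) + 44" using x2 by simp
    finally have "100 * (x + 2)\<^sup>2 / real m \<le> 100 * (2 * (real m * g\<^sup>2) + 44) / real m"
      by (intro divide_right_mono mult_left_mono) auto
    also have "\<dots> = 200 * g\<^sup>2 + 4400 / real m" using m0 by (simp add: field_simps)
    also have "4400 / real m \<le> 55" using m80 by (simp add: divide_le_eq)
    finally have t1: "100 * (x + 2)\<^sup>2 / real m \<le> 200 * G + 55" by (simp add: G_def)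
    have "2 * y\<^sup>2 / (real m)\<^sup>2 * (x + 2) \<le> 2 * y\<^sup>2 / (real m)\<^sup>2 * real m"
      using True m80 by (intro mult_left_mono) auto
    also have "\<dots> = 2 * R" using m0 by (simp add: R_def power2_eq_square)
    finally have hb: "h (x + 2) - x \<le> 2 * R + 200 * G + 157"
      using t1 unfolding h_def distrib_right mult_1_left by linarith
    have 1: "\<sigma> * g - x \<le> 200 * (1 + G + R)" using upper[OF up] hb R by simp
    have 2: "x - \<sigma> * g \<le> 200 * (1 + G + R)"
    proof (cases "x > 0")
      case True
      show ?thesis using lower[OF True] R g2 by (simp add: algebra_simps)
    next
      case False
      then have "x = 0" using x0 by simp
      then have "T = 2 * k" by (simp add: x_def)
      then have "\<sigma> * (- g) \<le> h (x + 2)" using upper[of "- g"] lo0 by simp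
      then show ?thesis using hb R \<open>x = 0\<close> by simp
    qed
    show ?thesis using 1 2 by linarith
  next
    case False
    \<comment> \<open>Outside the range of \<open>normal_le_hypergeom_tail\<close> the triangle
      inequality is enough: either \<open>m\<close> is bounded, or \<open>m\<close> is dominated by
      \<open>y\<^sup>2 / m\<close>, or it is dominated by \<open>g\<^sup>2\<close>.\<close>
    have tri: "\<bar>\<sigma> * g - x\<bar> \<le> 2 * (\<sigma> * \<bar>g\<bar>) + 3"
    proof -
      have "\<bar>\<sigma> * g\<bar> = \<sigma> * \<bar>g\<bar>" using \<sigma> by (simp add: abs_mult)
      then show ?thesis using xg x0 by linarith
    qed
    have amgm: "2 * (\<sigma> * \<bar>g\<bar>) \<le> \<sigma>\<^sup>2 + G"
      unfolding G_def using zero_le_power2[of "\<sigma> - \<bar>g\<bar>"] by (simp add: power2_eq_square algebra_simps)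
    consider "m < 80" | "\<bar>y\<bar> > real m / 2" | "m \<ge> 80" "x + 2 > real m / 8" using False by linarith
    then show ?thesis
    proof cases
      case 1
      then have "\<sigma>\<^sup>2 \<le> 40" using \<sigma>(2) by simp
      then show ?thesis using tri amgm R g2 by (simp add: algebra_simps)
    next
      case 2
      then have "(real m / 2)\<^sup>2 \<le> y\<^sup>2" using power_mono[of "real m / 2" "\<bar>y\<bar>" 2] m0 by simp
      then have "(real m / 2)\<^sup>2 / real m \<le> R" unfolding R_def by (rule divide_right_mono) simp
      then have "real m / 2 \<le> 2 * R" using m0 by (simp add: power2_eq_square)
      then show ?thesis using tri amgm \<sigma>(2) R g2 by (simp add: algebra_simps)
    next
      case 3
      then have "real m \<ge> 80" by simp
      \<comment> \<open>Here \<open>\<sigma> * \<bar>g\<bar>\<close> exceeds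
        \<open>m / 8 - 5\<close>, and 5 is at most \<open>m / 16\<close> exactly when
        \<open>m \<ge> 80\<close>.\<close>
      then have "real m / 16 \<le> \<sigma> * \<bar>g\<bar>" using 3 xg by linarith
      then have "\<sigma> * \<sigma> \<le> \<sigma> * (8 * \<bar>g\<bar>)" using \<sigma>(2) by (simp add: power2_eq_square)
      then have "\<sigma> \<le> 8 * \<bar>g\<bar>" using \<sigma>(1) by simp
      then have "\<sigma> * \<bar>g\<bar> \<le> 8 * \<bar>g\<bar> * \<bar>g\<bar>" by (intro mult_right_mono) auto
      then have "\<sigma> * \<bar>g\<bar> \<le> 8 * G" by (simp add: G_def power2_eq_square abs_mult_self_eq mult.assoc)
      then show ?thesis using tri R g2 by (simp add: algebra_simps)
    qed
  qed
  then show ?thesis using second by (simp add: R_def G_def)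
qed

text \<open>The case of negative deviation reduces to the nonnegative one by reflecting
  \<open>k\<close> into \<open>T - k\<close> and \<open>g\<close> into \<open>- g\<close>; the
  brackets exchange their roles.\<close>

lemma midpoint_error:
  fixes m T k :: nat and g :: real
  defines "y \<equiv> real T - real m" and "x \<equiv> 2 * real k - real T" and "\<sigma> \<equiv> sqrt (real m / 2)"
  assumes m: "m \<ge> 1" and T: "T \<le> 2 * m" and k: "k \<le> T"
    and lower: "(\<Sum>j<k. hypergeom m T j) \<le> std_normal_cdf g"
    and upper: "std_normal_cdf g \<le> (\<Sum>j\<le>k. hypergeom m T j)"
  shows "\<bar>\<sigma> * g - x\<bar> \<le> 200 * (1 + g\<^sup>2 + y\<^sup>2 / real m) \<and> x\<^sup>2 \<le> real m * (g\<^sup>2 + 18)"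
proof -
  have 1: "std_normal_cdf (- g) \<le> hypergeom_tail m T k"
    using lower by (simp add: hypergeom_tail_lower_sum[OF T] std_normal_cdf_uminus)
  have 2: "hypergeom_tail m T (Suc k) \<le> std_normal_cdf (- g)"
    using upper by (simp add: hypergeom_tail_lower_sum[OF T] std_normal_cdf_uminus lessThan_Suc_atMost)
  have 3: "std_normal_cdf g \<le> hypergeom_tail m T (T - k)"
    using upper hypergeom_lower_sum_sym[OF k] by simp
  have 4: "hypergeom_tail m T (Suc (T - k)) \<le> std_normal_cdf g"
  proof -
    have "hypergeom_tail m T (Suc (T - k)) = 1 - (\<Sum>j\<le>T - k. hypergeom m T j)"
      by (simp add: hypergeom_tail_lower_sum[OF T] lessThan_Suc_atMost)
    also have "(\<Sum>j\<le>T - k. hypergeom m T j) = hypergeom_tail m T k"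
      using hypergeom_lower_sum_sym[of "T - k" T m] k by simp
    finally show ?thesis using lower by (simp add: hypergeom_tail_lower_sum[OF T])
  qed
  show ?thesis
  proof (cases "T \<le> 2 * k")
    case True
    show ?thesis unfolding x_def y_def \<sigma>_def
      by (rule midpoint_error_nonneg[OF m T k True 1 2]) (use 4 in auto)
  next
    case False
    have e: "2 * real (T - k) - real T = - x" using k by (simp add: x_def of_nat_diff)
    have "\<bar>\<sigma> * (- g) - (2 * real (T - k) - real T)\<bar> \<le> 200 * (1 + (- g)\<^sup>2 + y\<^sup>2 / real m)
        \<and> (2 * real (T - k) - real T)\<^sup>2 \<le> real m * ((- g)\<^sup>2 + 18)"
      unfolding y_def \<sigma>_def
      by (rule midpoint_error_nonneg[OF m T]) (use 3 4 False k in auto)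
    then show ?thesis unfolding e by (simp add: abs_minus_commute)
  qed
qed

text \<open>\<open>u g\<close> counts the up-steps among the first \<open>n1\<close> steps, and
  \<open>p\<close> is its law under the walk bridge.\<close>

lemma walk_split_quantile:
  fixes n1 n2 T :: nat
  defines "z \<equiv> 2 * int T - int (n1 + n2)"
  defines "p \<equiv> \<lambda>k. real (walk_count n1 (2 * int k - int n1)) * real (walk_count n2 (z - (2 * int k - int n1)))
      / real (walk_count (n1 + n2) z)"
  assumes T: "T \<le> n1 + n2"
  shows "\<exists>u :: real \<Rightarrow> nat. u \<in> measurable borel (count_space UNIV) \<and> (\<forall>g. u g \<le> T) \<and>
    (\<forall>g. (\<Sum>j<u g. p j) < std_normal_cdf g) \<and> (\<forall>g. std_normal_cdf g \<le> (\<Sum>j\<le>u g. p j)) \<and>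
    (\<forall>g. 2 * int (u g) - int n1 \<in> L n1) \<and> (\<forall>g. z - (2 * int (u g) - int n1) \<in> L n2) \<and>
    (\<forall>w. w \<in> L n1 \<longrightarrow> z - w \<in> L n2 \<longrightarrow> measure std_normal_distribution {g. 2 * int (u g) - int n1 = w}
       = real (walk_count n1 w) * real (walk_count n2 (z - w)) / real (walk_count (n1 + n2) z))"
proof -
  have pos: "walk_count (n1 + n2) z > 0" using T by (simp add: z_def walk_count_binomial del: of_nat_add)
  have p0: "p k \<ge> 0" for k by (simp add: p_def)
  have "(\<Sum>k\<le>T. p k) = real (\<Sum>k\<le>T. walk_count n1 (2 * int k - int n1) *
      walk_count n2 (z - (2 * int k - int n1))) / real (walk_count (n1 + n2) z)"
    by (simp add: p_def sum_divide_distrib)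
  also have "(\<Sum>k\<le>T. walk_count n1 (2 * int k - int n1) * walk_count n2 (z - (2 * int k - int n1)))
      = walk_count (n1 + n2) z"
    unfolding z_def by (rule sum_walk_count_split[OF T])
  finally have p1: "(\<Sum>k\<le>T. p k) = 1" using pos by simp
  obtain u where u: "u \<in> measurable borel (count_space UNIV)" "\<And>g. u g \<le> T"
    "\<And>g. (\<Sum>j<u g. p j) < std_normal_cdf g" "\<And>g. std_normal_cdf g \<le> (\<Sum>j\<le>u g. p j)"
    "\<And>k. k \<le> T \<Longrightarrow> measure std_normal_distribution {g. u g = k} = p k"
    using quantile_coupling[of p T] p0 p1 by blast
  \<comment> \<open>The strict lower bracket makes the chosen weight positive for every
    \<open>g\<close>, not merely almost every one, so both parts always receive an attainable
    endpoint.\<close>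
  have "p (u g) > 0" for g
    using u(3)[of g] u(4)[of g] by (simp add: lessThan_Suc_atMost[symmetric])
  then have in_L: "2 * int (u g) - int n1 \<in> L n1" "z - (2 * int (u g) - int n1) \<in> L n2" for g
    unfolding L_iff_count p_def by (auto simp: zero_less_divide_iff zero_less_mult_iff)
  have law: "measure std_normal_distribution {g. 2 * int (u g) - int n1 = w}
       = real (walk_count n1 w) * real (walk_count n2 (z - w)) / real (walk_count (n1 + n2) z)"
    if w: "w \<in> L n1" "z - w \<in> L n2" for w
  proof -
    obtain k where k: "k \<le> n1" "w = 2 * int k - int n1" using w(1) by (auto simp: L_eq)
    have "k \<le> T" using w(2) k by (auto simp: L_eq z_def)
    moreover have "{g. 2 * int (u g) - int n1 = w} = {g. u g = k}" using k by auto
    ultimately show ?thesis using u(5)[of k] k by (simp add: p_def)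
  qed
  show ?thesis by (intro exI[of _ u] conjI allI impI u(1-4) in_L law)
qed

text \<open>\<open>W z g\<close> is the position at time \<open>n1\<close> of a walk bridge of length \<open>n1 + n2\<close> to \<open>z\<close>, driven by the same standard
  normal variable \<open>g\<close> as the Brownian bridge. The integral is what remains of the exponential moment after
  integrating out the two halves.\<close>
definition walk_splitting ::
  "real \<Rightarrow> real \<Rightarrow> nat \<Rightarrow> nat \<Rightarrow> real \<Rightarrow> real \<Rightarrow> real \<Rightarrow> (int \<Rightarrow> real \<Rightarrow> int) \<Rightarrow> bool" where
  "walk_splitting a b n1 n2 C1 C2 C W \<longleftrightarrow>
    (\<forall>z\<in>L (n1 + n2).
      W z \<in> measurable borel (count_space UNIV) \<and>
      (\<forall>g. W z g \<in> L n1 \<and> z - W z g \<in> L n2) \<and>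
      (\<forall>w\<in>L n1. z - w \<in> L n2 \<longrightarrow> measure std_normal_distribution {g. W z g = w}
         = real (walk_count n1 w) * real (walk_count n2 (z - w)) / real (walk_count (n1 + n2) z)) \<and>
      (\<integral>\<^sup>+ g. ennreal (exp (a * \<bar>real n1 * real_of_int z / real (n1 + n2)
             + sqrt (real n1 * real n2 / real (n1 + n2)) * g - real_of_int (W z g)\<bar>)
           * (C1 * exp (b * (real_of_int (W z g))\<^sup>2 / real n1)
              + C2 * exp (b * (real_of_int (z - W z g))\<^sup>2 / real n2))) \<partial>std_normal_distribution)
        \<le> ennreal (C * exp (b * (real_of_int z)\<^sup>2 / real (n1 + n2))))"

lemma nn_integral_std_normal_bound:
  assumes "\<And>g. f g \<le> A * exp (g\<^sup>2 / 4)" "A \<ge> 0"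
  shows "(\<integral>\<^sup>+ g. ennreal (f g) \<partial>std_normal_distribution) \<le> ennreal (A * sqrt 2)"
proof -
  have "(\<integral>\<^sup>+ g. ennreal (f g) \<partial>std_normal_distribution)
      \<le> (\<integral>\<^sup>+ g. ennreal A * ennreal (exp (g\<^sup>2 / 4)) \<partial>std_normal_distribution)"
    using assms by (intro nn_integral_mono) (simp add: ennreal_mult[symmetric])
  also have "\<dots> = ennreal A * (\<integral>\<^sup>+ g. ennreal (exp (g\<^sup>2 / 4)) \<partial>std_normal_distribution)"
    by (rule nn_integral_cmult) simp
  also have "\<dots> = ennreal (A * sqrt 2)"
    unfolding std_normal_exp_square using assms(2) by (simp add: ennreal_mult)
  finally show ?thesis .
qed

text \<open>In the constant, 2 comes from the two halves, \<open>sqrt 2\<close> from the Gaussian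
  integral and \<open>exp 4\<close> from the bounded terms of the exponent. With
  \<open>z = 2 * y\<close> the target exponent is \<open>2 * b * R\<close>: the halves use
  \<open>3 / 2 * b * R\<close>, and the remaining \<open>b / 2 * R\<close> pays for the error, as
  \<open>200 * a \<le> b / 2\<close>.\<close>

lemma even_splitting:
  assumes m: "m \<ge> 1" and b: "0 < b" "b \<le> 1 / 14" and a: "0 \<le> a" "400 * a \<le> b" and C: "C \<ge> 0"
  shows "\<exists>W. walk_splitting a b m m C C (2 * exp 4 * sqrt 2 * C) W"
proof -
  have "\<exists>W. W \<in> measurable borel (count_space UNIV) \<and>
      (\<forall>g. W g \<in> L m \<and> z - W g \<in> L m) \<and>
      (\<forall>w\<in>L m. z - w \<in> L m \<longrightarrow> measure std_normal_distribution {g. W g = w}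
         = real (walk_count m w) * real (walk_count m (z - w)) / real (walk_count (m + m) z)) \<and>
      (\<integral>\<^sup>+ g. ennreal (exp (a * \<bar>real m * real_of_int z / real (m + m)
             + sqrt (real m * real m / real (m + m)) * g - real_of_int (W g)\<bar>)
           * (C * exp (b * (real_of_int (W g))\<^sup>2 / real m)
              + C * exp (b * (real_of_int (z - W g))\<^sup>2 / real m))) \<partial>std_normal_distribution)
        \<le> ennreal (2 * exp 4 * sqrt 2 * C * exp (b * (real_of_int z)\<^sup>2 / real (m + m)))"
    if "z \<in> L (m + m)" for z
  proof -
    have m0: "real m > 0" using m by simp
    obtain T where T: "T \<le> m + m" "z = 2 * int T - int (m + m)" using \<open>z \<in> L (m + m)\<close> by (auto simp: L_eq)
    define p where "p k = real (walk_count m (2 * int k - int m)) * real (walk_count m (z - (2 * int k - int m)))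
      / real (walk_count (m + m) z)" for k
    have p_hypergeom: "p k = hypergeom m T k" if "k \<le> T" for k
    proof -
      have "z - (2 * int k - int m) = 2 * int (T - k) - int m" using that T by simp
      then show ?thesis unfolding p_def T(2) hypergeom_def
        by (simp only: walk_count_binomial that if_True mult_2[of m])
    qed
    obtain u where u: "u \<in> measurable borel (count_space UNIV)" "\<And>g. u g \<le> T"
      "\<And>g. (\<Sum>j<u g. p j) < std_normal_cdf g" "\<And>g. std_normal_cdf g \<le> (\<Sum>j\<le>u g. p j)"
      "\<And>g. 2 * int (u g) - int m \<in> L m" "\<And>g. z - (2 * int (u g) - int m) \<in> L m"
      "\<And>w. w \<in> L m \<Longrightarrow> z - w \<in> L m \<Longrightarrow> measure std_normal_distribution {g. 2 * int (u g) - int m = w}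
         = real (walk_count m w) * real (walk_count m (z - w)) / real (walk_count (m + m) z)"
      using walk_split_quantile[OF T(1), folded T(2)] unfolding p_def by blast
    define W where "W g = 2 * int (u g) - int m" for g
    define y where "y = real T - real m"
    define \<sigma> where "\<sigma> = sqrt (real m / 2)"
    have zy: "real_of_int z = 2 * y" using T by (simp add: y_def)
    define R where "R = y\<^sup>2 / real m"
    have R: "R \<ge> 0" by (simp add: R_def)
    have err: "\<bar>\<sigma> * g - (2 * real (u g) - real T)\<bar> \<le> 200 * (1 + g\<^sup>2 + R)"
      "(2 * real (u g) - real T)\<^sup>2 \<le> real m * (g\<^sup>2 + 18)" for g
    proof -
      have s: "(\<Sum>j<u g. p j) = (\<Sum>j<u g. hypergeom m T j)" "(\<Sum>j\<le>u g. p j) = (\<Sum>j\<le>u g. hypergeom m T j)"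
        using u(2)[of g] by (auto intro!: sum.cong p_hypergeom)
      show "\<bar>\<sigma> * g - (2 * real (u g) - real T)\<bar> \<le> 200 * (1 + g\<^sup>2 + R)"
        "(2 * real (u g) - real T)\<^sup>2 \<le> real m * (g\<^sup>2 + 18)"
        using midpoint_error[OF m _ u(2), of g g] u(3,4)[of g] T(1)
        unfolding s \<sigma>_def y_def R_def by auto
    qed
    have bound: "exp (a * \<bar>real m * real_of_int z / real (m + m)
             + sqrt (real m * real m / real (m + m)) * g - real_of_int (W g)\<bar>)
           * (C * exp (b * (real_of_int (W g))\<^sup>2 / real m)
              + C * exp (b * (real_of_int (z - W g))\<^sup>2 / real m))
        \<le> (2 * exp 4 * C * exp (2 * b * R)) * exp (g\<^sup>2 / 4)" for g
    proof -
      define x where "x = 2 * real (u g) - real T"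
      have W: "real_of_int (W g) = y + x" "real_of_int (z - W g) = y - x"
        using zy T(2) by (auto simp: W_def y_def x_def)
      have "real m * real_of_int z / real (m + m) = y" using m0 zy by (simp add: field_simps)
      moreover have "sqrt (real m * real m / real (m + m)) = \<sigma>" using m0 by (simp add: \<sigma>_def field_simps)
      ultimately have V: "\<bar>real m * real_of_int z / real (m + m)
             + sqrt (real m * real m / real (m + m)) * g - real_of_int (W g)\<bar> = \<bar>\<sigma> * g - x\<bar>"
        unfolding W by simp
      have x2: "x\<^sup>2 / real m \<le> g\<^sup>2 + 18"
        using err(2)[of g] m0 unfolding x_def[symmetric] by (simp add: divide_le_eq mult.commute)
      have sq: "b * v\<^sup>2 / real m \<le> 3 / 2 * b * R + 3 * b * (g\<^sup>2 + 18)" if "v = y + x \<or> v = y - x" for v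
      proof -
        have "v\<^sup>2 = 3 / 2 * y\<^sup>2 + 3 * x\<^sup>2 - (y - 2 * x)\<^sup>2 / 2 \<or>
            v\<^sup>2 = 3 / 2 * y\<^sup>2 + 3 * x\<^sup>2 - (y + 2 * x)\<^sup>2 / 2"
          using that by (auto simp: power2_eq_square field_simps)
        then have "v\<^sup>2 \<le> 3 / 2 * y\<^sup>2 + 3 * x\<^sup>2"
          using zero_le_power2[of "y + 2 * x"] zero_le_power2[of "y - 2 * x"] by linarith
        then have "b * v\<^sup>2 / real m \<le> b * (3 / 2 * y\<^sup>2 + 3 * x\<^sup>2) / real m"
          using b m0 by (intro divide_right_mono mult_left_mono) auto
        also have "\<dots> = 3 / 2 * b * R + 3 * b * (x\<^sup>2 / real m)"
          using m0 by (simp add: R_def field_simps)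
        also have "\<dots> \<le> 3 / 2 * b * R + 3 * b * (g\<^sup>2 + 18)"
          using x2 b by (intro add_left_mono mult_left_mono) auto
        finally show ?thesis .
      qed
      define D where "D = 3 / 2 * b * R + 3 * b * (g\<^sup>2 + 18)"
      have "C * exp (b * (real_of_int (W g))\<^sup>2 / real m) + C * exp (b * (real_of_int (z - W g))\<^sup>2 / real m)
          \<le> C * exp D + C * exp D"
        unfolding W D_def using sq C by (intro add_mono mult_left_mono) auto
      then have "exp (a * \<bar>\<sigma> * g - x\<bar>)
           * (C * exp (b * (real_of_int (W g))\<^sup>2 / real m) + C * exp (b * (real_of_int (z - W g))\<^sup>2 / real m))
          \<le> exp (a * (200 * (1 + g\<^sup>2 + R))) * (C * exp D + C * exp D)"
        using err(1)[of g] a C unfolding x_def[symmetric]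
        by (intro mult_mono) (auto intro!: mult_left_mono)
      also have "\<dots> = 2 * C * exp (a * (200 * (1 + g\<^sup>2 + R)) + D)"
        by (simp add: exp_add)
      also have "\<dots> \<le> 2 * C * exp (4 + 2 * b * R + g\<^sup>2 / 4)"
      proof -
        have "a * (200 * (1 + g\<^sup>2 + R)) = (200 * a) * (1 + g\<^sup>2 + R)" by simp
        also have "\<dots> \<le> (b / 2) * (1 + g\<^sup>2 + R)" using a R by (intro mult_right_mono) auto
        finally have "a * (200 * (1 + g\<^sup>2 + R)) + D \<le> (b / 2) * (1 + g\<^sup>2 + R) + D" by simp
        also have "\<dots> = 2 * b * R + (7 / 2 * b) * g\<^sup>2 + b * (54 + 1 / 2)"
          by (simp add: D_def algebra_simps)
        also have "\<dots> \<le> 2 * b * R + 1 / 4 * g\<^sup>2 + 1 / 14 * (54 + 1 / 2)"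
          using b by (intro add_mono mult_right_mono order_refl) auto
        also have "\<dots> \<le> 4 + 2 * b * R + g\<^sup>2 / 4" by simp
        finally have "a * (200 * (1 + g\<^sup>2 + R)) + D \<le> 4 + 2 * b * R + g\<^sup>2 / 4" .
        then show ?thesis using C by (intro mult_left_mono) auto
      qed
      also have "\<dots> = (2 * exp 4 * C * exp (2 * b * R)) * exp (g\<^sup>2 / 4)"
        by (simp add: exp_add)
      finally show ?thesis unfolding V .
    qed
    have "(2 * exp 4 * C * exp (2 * b * R)) * sqrt 2 = 2 * exp 4 * sqrt 2 * C * exp (b * (real_of_int z)\<^sup>2 / real (m + m))"
      using m0 zy by (simp add: R_def power2_eq_square)
    then have int: "(\<integral>\<^sup>+ g. ennreal (exp (a * \<bar>real m * real_of_int z / real (m + m)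
             + sqrt (real m * real m / real (m + m)) * g - real_of_int (W g)\<bar>)
           * (C * exp (b * (real_of_int (W g))\<^sup>2 / real m)
              + C * exp (b * (real_of_int (z - W g))\<^sup>2 / real m))) \<partial>std_normal_distribution)
        \<le> ennreal (2 * exp 4 * sqrt 2 * C * exp (b * (real_of_int z)\<^sup>2 / real (m + m)))"
      using nn_integral_std_normal_bound[OF bound] C by (simp only: mult_nonneg_nonneg exp_ge_zero zero_le_numeral)
    have meas: "W \<in> measurable borel (count_space UNIV)"
      unfolding W_def using u(1) by (rule measurable_compose) simp
    have in_L: "W g \<in> L m" "z - W g \<in> L m" for g using u(5,6) by (simp_all only: W_def)
    have law: "measure std_normal_distribution {g. W g = w}
         = real (walk_count m w) * real (walk_count m (z - w)) / real (walk_count (m + m) z)"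
      if "w \<in> L m" "z - w \<in> L m" for w using u(7)[OF that] by (simp only: W_def)
    show ?thesis by (intro exI[of _ W] conjI allI ballI impI meas in_L law int)
  qed
  then show ?thesis unfolding walk_splitting_def by (intro bchoice ballI)
qed

text \<open>After a single step only bounded quantities change:
  \<open>\<bar>z\<bar> \<le> n + 1\<close> gives
  \<open>(z - w)\<^sup>2 / n \<le> z\<^sup>2 / (n + 1) + 7\<close>, and
  \<open>7 * b \<le> 1 / 2\<close>. No normal approximation is involved; the constant is
  deliberately that of the even case.\<close>

lemma odd_splitting:
  assumes n: "n \<ge> 1" and b: "0 < b" "b \<le> 1 / 14" and a: "0 \<le> a" "400 * a \<le> b" and C: "C \<ge> 0"
  shows "\<exists>W. walk_splitting a b 1 n C C (2 * exp 4 * sqrt 2 * C) W"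
proof -
  have "\<exists>W. W \<in> measurable borel (count_space UNIV) \<and>
      (\<forall>g. W g \<in> L 1 \<and> z - W g \<in> L n) \<and>
      (\<forall>w\<in>L 1. z - w \<in> L n \<longrightarrow> measure std_normal_distribution {g. W g = w}
         = real (walk_count 1 w) * real (walk_count n (z - w)) / real (walk_count (1 + n) z)) \<and>
      (\<integral>\<^sup>+ g. ennreal (exp (a * \<bar>real 1 * real_of_int z / real (1 + n)
             + sqrt (real 1 * real n / real (1 + n)) * g - real_of_int (W g)\<bar>)
           * (C * exp (b * (real_of_int (W g))\<^sup>2 / real 1)
              + C * exp (b * (real_of_int (z - W g))\<^sup>2 / real n))) \<partial>std_normal_distribution)
        \<le> ennreal (2 * exp 4 * sqrt 2 * C * exp (b * (real_of_int z)\<^sup>2 / real (1 + n)))"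
    if "z \<in> L (1 + n)" for z
  proof -
    have n0: "real n \<ge> 1" using n by simp
    obtain T where T: "T \<le> 1 + n" "z = 2 * int T - int (1 + n)" using \<open>z \<in> L (1 + n)\<close> by (auto simp: L_eq)
    define zr where "zr = real_of_int z"
    have zn: "\<bar>zr\<bar> \<le> 1 + real n" using T by (simp add: zr_def abs_le_iff)
    obtain u where u: "u \<in> measurable borel (count_space UNIV)"
      "\<And>g. 2 * int (u g) - int 1 \<in> L 1" "\<And>g. z - (2 * int (u g) - int 1) \<in> L n"
      "\<And>w. w \<in> L 1 \<Longrightarrow> z - w \<in> L n \<Longrightarrow> measure std_normal_distribution {g. 2 * int (u g) - int 1 = w}
         = real (walk_count 1 w) * real (walk_count n (z - w)) / real (walk_count (1 + n) z)"
      using walk_split_quantile[OF T(1), folded T(2)] by blast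
    define W where "W g = 2 * int (u g) - int 1" for g
    define B where "B = b * zr\<^sup>2 / real (1 + n)"
    have B0: "B \<ge> 0" using b by (simp add: B_def)
    have bound: "exp (a * \<bar>real 1 * real_of_int z / real (1 + n)
             + sqrt (real 1 * real n / real (1 + n)) * g - real_of_int (W g)\<bar>)
           * (C * exp (b * (real_of_int (W g))\<^sup>2 / real 1)
              + C * exp (b * (real_of_int (z - W g))\<^sup>2 / real n))
        \<le> (2 * exp 4 * C * exp B) * exp (g\<^sup>2 / 4)" for g
    proof -
      define w where "w = real_of_int (W g)"
      have w: "\<bar>w\<bar> = 1"
      proof -
        obtain k :: nat where "k \<le> 1" "W g = 2 * int k - int 1" using u(2)[of g] unfolding W_def by (auto simp: L_eq)
        moreover from this have "k = 0 \<or> k = 1" by linarith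
        ultimately show ?thesis by (auto simp: w_def)
      qed
      then have w2: "w\<^sup>2 = 1" by (metis power2_abs one_power2)
      have "sqrt (real n / real (1 + n)) \<le> 1" using n0 by simp
      then have "\<bar>sqrt (real n / real (1 + n)) * g\<bar> \<le> 1 * \<bar>g\<bar>"
        unfolding abs_mult by (intro mult_right_mono) auto
      moreover have "\<bar>zr / real (1 + n)\<bar> \<le> 1" using zn n0 by (simp add: abs_divide divide_le_eq)
      ultimately have V: "\<bar>zr / real (1 + n) + sqrt (real n / real (1 + n)) * g - w\<bar> \<le> 2 + \<bar>g\<bar>"
        using w by linarith
      have "0 \<le> (\<bar>g\<bar> - 1)\<^sup>2" by simp
      then have "2 * \<bar>g\<bar> \<le> 1 + g\<^sup>2" by (simp add: power2_diff)
      then have "\<bar>g\<bar> \<le> 1 + g\<^sup>2" by linarith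
      then have V': "\<bar>zr / real (1 + n) + sqrt (real n / real (1 + n)) * g - w\<bar> \<le> 3 + g\<^sup>2" using V by linarith
      have "(zr - w)\<^sup>2 \<le> zr\<^sup>2 + 2 * \<bar>zr\<bar> + 1"
      proof -
        have "\<bar>zr * w\<bar> = \<bar>zr\<bar>" using w by (simp add: abs_mult)
        then have "- (zr * w) \<le> \<bar>zr\<bar>" by linarith
        then show ?thesis using w2 by (simp add: power2_diff mult.commute)
      qed
      then have "(zr - w)\<^sup>2 / real n \<le> (zr\<^sup>2 + 2 * \<bar>zr\<bar> + 1) / real n" by (rule divide_right_mono) simp
      also have "\<dots> = zr\<^sup>2 / real (1 + n) + zr\<^sup>2 / (real n * real (1 + n)) + (2 * \<bar>zr\<bar> + 1) / real n"
        using n0 by (simp add: divide_simps) (simp add: algebra_simps)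
      also have "zr\<^sup>2 / (real n * real (1 + n)) \<le> (1 + real n)\<^sup>2 / (real n * real (1 + n))"
        using power_mono[OF zn, of 2] by (intro divide_right_mono) auto
      also have "\<dots> = 1 / real n + 1" using n0 by (simp add: power2_eq_square add_divide_distrib)
      also have "1 / real n \<le> 1" using n0 by simp
      also have "(2 * \<bar>zr\<bar> + 1) / real n \<le> 5" using zn n0 by (simp add: divide_le_eq)
      finally have "(zr - w)\<^sup>2 / real n \<le> zr\<^sup>2 / real (1 + n) + 7" by simp
      then have "b * ((zr - w)\<^sup>2 / real n) \<le> b * (zr\<^sup>2 / real (1 + n) + 7)" using b by (intro mult_left_mono) auto
      also have "\<dots> \<le> B + 1 / 2" using b by (simp add: B_def distrib_left)
      finally have e2: "b * (zr - w)\<^sup>2 / real n \<le> B + 1 / 2" by simp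
      have e1: "b * w\<^sup>2 / real 1 \<le> B + 1 / 2" using w2 b B0 by simp
      have "C * exp (b * w\<^sup>2 / real 1) + C * exp (b * (zr - w)\<^sup>2 / real n)
          \<le> C * exp (B + 1 / 2) + C * exp (B + 1 / 2)"
        using e1 e2 C by (intro add_mono mult_left_mono) auto
      then have "exp (a * \<bar>zr / real (1 + n) + sqrt (real n / real (1 + n)) * g - w\<bar>)
           * (C * exp (b * w\<^sup>2 / real 1) + C * exp (b * (zr - w)\<^sup>2 / real n))
          \<le> exp (a * (3 + g\<^sup>2)) * (C * exp (B + 1 / 2) + C * exp (B + 1 / 2))"
        using V' a C by (intro mult_mono) (auto intro!: mult_left_mono)
      also have "\<dots> = 2 * C * exp (a * (3 + g\<^sup>2) + (B + 1 / 2))" by (simp add: exp_add)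
      also have "\<dots> \<le> 2 * C * exp (4 + B + g\<^sup>2 / 4)"
      proof -
        have "a \<le> 1 / 4" using a b by linarith
        then have "a * (3 + g\<^sup>2) \<le> 1 / 4 * (3 + g\<^sup>2)" by (intro mult_right_mono) auto
        then show ?thesis using C by (intro mult_left_mono) auto
      qed
      also have "\<dots> = (2 * exp 4 * C * exp B) * exp (g\<^sup>2 / 4)" by (simp add: exp_add)
      finally show ?thesis by (simp add: zr_def w_def)
    qed
    have "(2 * exp 4 * C * exp (B)) * sqrt 2 = 2 * exp 4 * sqrt 2 * C * exp (b * (real_of_int z)\<^sup>2 / real (1 + n))"
      using C by (simp add: B_def zr_def)
    then have int: "(\<integral>\<^sup>+ g. ennreal (exp (a * \<bar>real 1 * real_of_int z / real (1 + n)
             + sqrt (real 1 * real n / real (1 + n)) * g - real_of_int (W g)\<bar>)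
           * (C * exp (b * (real_of_int (W g))\<^sup>2 / real 1)
              + C * exp (b * (real_of_int (z - W g))\<^sup>2 / real n))) \<partial>std_normal_distribution)
        \<le> ennreal (2 * exp 4 * sqrt 2 * C * exp (b * (real_of_int z)\<^sup>2 / real (1 + n)))"
      using nn_integral_std_normal_bound[OF bound] C by (simp only: mult_nonneg_nonneg exp_ge_zero zero_le_numeral)
    have meas: "W \<in> measurable borel (count_space UNIV)"
      unfolding W_def using u(1) by (rule measurable_compose) simp
    have in_L: "W g \<in> L 1" "z - W g \<in> L n" for g using u(2,3) by (simp_all only: W_def)
    have law: "measure std_normal_distribution {g. W g = w}
         = real (walk_count 1 w) * real (walk_count n (z - w)) / real (walk_count (1 + n) z)"
      if "w \<in> L 1" "z - w \<in> L n" for w using u(4)[OF that] by (simp only: W_def)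
    show ?thesis by (intro exI[of _ W] conjI allI ballI impI meas in_L law int)
  qed
  then show ?thesis unfolding walk_splitting_def by (intro bchoice ballI)
qed

section \<open>Gluing bridges\<close>

definition bridge_cov :: "real \<Rightarrow> real \<Rightarrow> real" where
  "bridge_cov s t = min s t - s * t"

text \<open>The tent with peak at \<open>\<theta>\<close> whose height
  \<open>sqrt (\<theta> * (1 - \<theta>))\<close> is the standard deviation of the bridge there; for
  \<open>\<theta> = 1 / 2\<close> it is the first Schauder function.\<close>

definition glue_hat :: "real \<Rightarrow> real \<Rightarrow> real" where
  "glue_hat \<theta> t = sqrt (\<theta> * (1 - \<theta>)) * (if t \<le> \<theta> then t / \<theta> else (1 - t) / (1 - \<theta>))"

text \<open>Given its value at \<open>\<theta>\<close>, a Brownian bridge is linear interpolation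
  plus independent bridges on the two sides, rescaled by the square roots of their lengths.\<close>

definition glue_bridge :: "real \<Rightarrow> (real \<Rightarrow> 'a \<Rightarrow> real) \<Rightarrow> (real \<Rightarrow> 'b \<Rightarrow> real) \<Rightarrow> real \<Rightarrow> real \<times> 'a \<times> 'b \<Rightarrow> real" where
  "glue_bridge \<theta> B1 B2 t = (\<lambda>(g, \<omega>1, \<omega>2). glue_hat \<theta> t * g +
     (if t \<le> \<theta> then sqrt \<theta> * B1 (t / \<theta>) \<omega>1 else sqrt (1 - \<theta>) * B2 ((t - \<theta>) / (1 - \<theta>)) \<omega>2))"

text \<open>The Markov property of the bridge at \<open>\<theta>\<close> on the level of
  covariances: the two sides interact only through the tent. Besides gluing, the case
  \<open>\<theta> = 1 / 2\<close> drives the recursion in Levy's construction.\<close>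

lemma glue_cov:
  assumes "0 < \<theta>" "\<theta> < 1"
  shows "(if s \<le> \<theta> \<and> t \<le> \<theta> then \<theta> * bridge_cov (s / \<theta>) (t / \<theta>) else 0)
    + (if \<not> s \<le> \<theta> \<and> \<not> t \<le> \<theta> then (1 - \<theta>) * bridge_cov ((s - \<theta>) / (1 - \<theta>)) ((t - \<theta>) / (1 - \<theta>)) else 0)
    + glue_hat \<theta> s * glue_hat \<theta> t = bridge_cov s t"
proof -
  have sq: "sqrt (\<theta> * (1 - \<theta>)) * sqrt (\<theta> * (1 - \<theta>)) = \<theta> * (1 - \<theta>)" using assms by simp
  have H: "glue_hat \<theta> s * glue_hat \<theta> t = \<theta> * (1 - \<theta>) *
      ((if s \<le> \<theta> then s / \<theta> else (1 - s) / (1 - \<theta>)) * (if t \<le> \<theta> then t / \<theta> else (1 - t) / (1 - \<theta>)))"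
    by (subst sq[symmetric]) (simp only: glue_hat_def mult_ac)
  have mn: "min (c * x) (c * y) = c * min x y" if "c > 0" for x y c :: real
    using that by (auto simp: min_def)
  define \<eta> where "\<eta> = 1 - \<theta>"
  have \<eta>: "\<eta> > 0" "\<theta> = 1 - \<eta>" using assms by (auto simp: \<eta>_def)
  consider "s \<le> \<theta>" "t \<le> \<theta>" | "s \<le> \<theta>" "\<not> t \<le> \<theta>" | "\<not> s \<le> \<theta>" "t \<le> \<theta>" | "\<not> s \<le> \<theta>" "\<not> t \<le> \<theta>" by blast
  then show ?thesis
  proof cases
    case 1
    define p where "p = s / \<theta>" define q where "q = t / \<theta>"
    have st: "s = \<theta> * p" "t = \<theta> * q" using assms by (simp_all add: p_def q_def)
    have "bridge_cov s t = \<theta> * min p q - \<theta> * p * (\<theta> * q)"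
      unfolding bridge_cov_def st using assms by (simp add: mn)
    then show ?thesis unfolding H using 1 unfolding p_def[symmetric] q_def[symmetric]
      by (simp add: bridge_cov_def algebra_simps)
  next
    case 2
    define p where "p = s / \<theta>" define q where "q = (1 - t) / (1 - \<theta>)"
    have st: "s = \<theta> * p" "t = 1 - (1 - \<theta>) * q" using assms by (simp_all add: p_def q_def)
    have "bridge_cov s t = s - s * t" using 2 by (simp add: bridge_cov_def)
    then show ?thesis unfolding H using 2 unfolding p_def[symmetric] q_def[symmetric]
      by (simp add: st algebra_simps)
  next
    case 3
    define p where "p = t / \<theta>" define q where "q = (1 - s) / (1 - \<theta>)"
    have st: "t = \<theta> * p" "s = 1 - (1 - \<theta>) * q" using assms by (simp_all add: p_def q_def)
    have "bridge_cov s t = t - s * t" using 3 by (simp add: bridge_cov_def)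
    then show ?thesis unfolding H using 3 unfolding p_def[symmetric] q_def[symmetric]
      by (simp add: st algebra_simps)
  next
    case 4
    define p where "p = (s - \<theta>) / \<eta>" define q where "q = (t - \<theta>) / \<eta>"
    have st: "s = \<theta> + \<eta> * p" "t = \<theta> + \<eta> * q" using \<eta> by (simp_all add: p_def q_def)
    have 1: "(1 - s) / \<eta> = 1 - p" "(1 - t) / \<eta> = 1 - q"
      using \<eta> by (simp_all add: p_def q_def diff_divide_distrib)
    have "min s t = \<theta> + \<eta> * min p q" unfolding st using \<eta> by (auto simp: min_def)
    then have "bridge_cov s t = \<theta> + \<eta> * min p q - (\<theta> + \<eta> * p) * (\<theta> + \<eta> * q)"
      unfolding bridge_cov_def st by simp
    also have "\<dots> = \<eta> * (min p q - p * q) + \<theta> * \<eta> * ((1 - p) * (1 - q))"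
      unfolding \<eta>(2) by (simp add: algebra_simps)
    finally show ?thesis unfolding H \<eta>_def[symmetric] using 4
      unfolding p_def[symmetric] q_def[symmetric] 1 by (simp add: bridge_cov_def)
  qed
qed

lemma std_normal_char: "(\<integral>g. cis (\<mu> * g) \<partial>std_normal_distribution) = complex_of_real (exp (- \<mu>\<^sup>2 / 2))"
  using fun_cong[OF char_std_normal_distribution, of \<mu>] by (simp add: char_def cis_conv_exp)

lemma integral_prod_cis:
  fixes f :: "'a \<Rightarrow> complex" and h :: "'b \<Rightarrow> complex"
  assumes "prob_space M1" "prob_space M2" "f \<in> borel_measurable M1" "h \<in> borel_measurable M2"
    and "\<And>x. norm (f x) \<le> 1" "\<And>x. norm (h x) \<le> 1"
  shows "(\<integral>p. f (fst p) * h (snd p) \<partial>(M1 \<Otimes>\<^sub>M M2)) = (\<integral>x. f x \<partial>M1) * (\<integral>x. h x \<partial>M2)"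
proof -
  interpret M1: prob_space M1 by fact
  interpret M2: prob_space M2 by fact
  interpret P: pair_prob_space M1 M2 ..
  note [measurable] = assms(3,4)
  have int: "integrable (M1 \<Otimes>\<^sub>M M2) (\<lambda>(x, y). f x * h y)"
    by (rule P.integrable_const_bound[where B = 1])
      (auto simp: norm_mult split_beta intro!: mult_le_one assms)
  have "(\<integral>p. f (fst p) * h (snd p) \<partial>(M1 \<Otimes>\<^sub>M M2)) = (\<integral>(x, y). f x * h y \<partial>(M1 \<Otimes>\<^sub>M M2))"
    by (simp add: case_prod_unfold)
  also have "\<dots> = (\<integral>x. \<integral>y. f x * h y \<partial>M2 \<partial>M1)"
    using P.integral_fst'[OF int] by simp
  also have "\<dots> = (\<integral>x. f x \<partial>M1) * (\<integral>x. h x \<partial>M2)" by simp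
  finally show ?thesis .
qed

text \<open>The exponent splits into a multiple of \<open>g\<close> and one combination for each
  side, so the characteristic function factorises over the product space and \<open>glue_cov\<close>
  adds up the quadratic forms. The pinning at \<open>\<theta>\<close> makes the two continuous
  pieces meet.\<close>

lemma brownian_bridge_glue:
  assumes M1: "prob_space M1" and M2: "prob_space M2"
    and B1: "brownian_bridge M1 B1" and B2: "brownian_bridge M2 B2"
    and pin1: "\<And>\<omega>. \<omega> \<in> space M1 \<Longrightarrow> B1 1 \<omega> = 0" and pin2: "\<And>\<omega>. \<omega> \<in> space M2 \<Longrightarrow> B2 0 \<omega> = 0"
    and \<theta>: "0 < \<theta>" "\<theta> < 1"
  shows "brownian_bridge (std_normal_distribution \<Otimes>\<^sub>M (M1 \<Otimes>\<^sub>M M2)) (glue_bridge \<theta> B1 B2)"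
    (is "brownian_bridge ?M _")
  unfolding brownian_bridge_def
proof (intro conjI ballI allI impI)
  have t1: "t / \<theta> \<in> {0..1}" if "t \<in> {0..1}" "t \<le> \<theta>" for t
    using that \<theta> by (auto simp: divide_le_eq)
  have t2: "(t - \<theta>) / (1 - \<theta>) \<in> {0..1}" if "t \<in> {0..1}" "t \<ge> \<theta>" for t
    using that \<theta> by (auto simp: divide_le_eq)
  have mB1 [measurable]: "B1 t \<in> borel_measurable M1" if "t \<in> {0..1}" for t
    using B1 that by (auto simp: brownian_bridge_def)
  have mB2 [measurable]: "B2 t \<in> borel_measurable M2" if "t \<in> {0..1}" for t
    using B2 that by (auto simp: brownian_bridge_def)
  fix t :: real assume t: "t \<in> {0..1}"
  show "glue_bridge \<theta> B1 B2 t \<in> borel_measurable ?M"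
  proof (cases "t \<le> \<theta>")
    case True
    note mB1[OF t1[OF t True], measurable]
    show ?thesis using True unfolding glue_bridge_def by simp
  next
    case False
    have [measurable]: "B2 ((t - \<theta>) / (1 - \<theta>)) \<in> borel_measurable M2" using False t by (intro mB2 t2) auto
    show ?thesis using False unfolding glue_bridge_def by simp
  qed
next
  have t1: "t / \<theta> \<in> {0..1}" if "0 \<le> t" "t \<le> \<theta>" for t
    using that \<theta> by (auto simp: divide_le_eq)
  have t2: "(t - \<theta>) / (1 - \<theta>) \<in> {0..1}" if "t \<le> 1" "t \<ge> \<theta>" for t
    using that \<theta> by (auto simp: divide_le_eq)
  fix \<omega> assume "\<omega> \<in> space ?M"
  then obtain g \<omega>1 \<omega>2 where \<omega>: "\<omega> = (g, \<omega>1, \<omega>2)" "\<omega>1 \<in> space M1" "\<omega>2 \<in> space M2"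
    by (auto simp: space_pair_measure)
  have c1: "continuous_on {0..1} (\<lambda>t. B1 t \<omega>1)" and c2: "continuous_on {0..1} (\<lambda>t. B2 t \<omega>2)"
    using B1 B2 \<omega> by (auto simp: brownian_bridge_def)
  define s where "s = sqrt (\<theta> * (1 - \<theta>))"
  have "continuous_on {0..\<theta>} (\<lambda>t. B1 (t / \<theta>) \<omega>1)"
    by (rule continuous_on_compose2[OF c1, of _ "\<lambda>t. t / \<theta>"]) (use \<theta> t1 in \<open>auto intro!: continuous_intros\<close>)
  moreover have "continuous_on {\<theta>..1} (\<lambda>t. B2 ((t - \<theta>) / (1 - \<theta>)) \<omega>2)"
    by (rule continuous_on_compose2[OF c2, of _ "\<lambda>t. (t - \<theta>) / (1 - \<theta>)"])
      (use \<theta> t2 in \<open>auto intro!: continuous_intros\<close>)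
  ultimately have "continuous_on ({0..\<theta>} \<union> {\<theta>..1}) (\<lambda>t. if t \<le> \<theta> then s * (t / \<theta>) * g + sqrt \<theta> * B1 (t / \<theta>) \<omega>1
      else s * ((1 - t) / (1 - \<theta>)) * g + sqrt (1 - \<theta>) * B2 ((t - \<theta>) / (1 - \<theta>)) \<omega>2)"
    using \<theta> pin1[OF \<omega>(2)] pin2[OF \<omega>(3)]
    by (intro continuous_on_cases) (auto intro!: continuous_intros)
  also have "{0..\<theta>} \<union> {\<theta>..1} = {0..1}" using \<theta> by auto
  also have "(\<lambda>t. if t \<le> \<theta> then s * (t / \<theta>) * g + sqrt \<theta> * B1 (t / \<theta>) \<omega>1
      else s * ((1 - t) / (1 - \<theta>)) * g + sqrt (1 - \<theta>) * B2 ((t - \<theta>) / (1 - \<theta>)) \<omega>2)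
      = (\<lambda>t. glue_bridge \<theta> B1 B2 t \<omega>)"
    by (auto simp: fun_eq_iff glue_bridge_def glue_hat_def \<omega>(1) s_def)
  finally show "continuous_on {0..1} (\<lambda>t. glue_bridge \<theta> B1 B2 t \<omega>)" .
next
  fix k :: nat and ts lam :: "nat \<Rightarrow> real"
  assume ts: "\<forall>j<k. ts j \<in> {0..1}"
  interpret M1: prob_space M1 by fact
  interpret M2: prob_space M2 by fact
  interpret P: pair_prob_space M1 M2 ..
  \<comment> \<open>Times on the other side receive coefficient 0 and the dummy time 0, so that both
    sides keep the full index range and the hypotheses on \<open>B1\<close> and \<open>B2\<close>
    apply directly.\<close>
  define lam1 where "lam1 j = (if ts j \<le> \<theta> then lam j * sqrt \<theta> else 0)" for j
  define ts1 where "ts1 j = (if ts j \<le> \<theta> then ts j / \<theta> else 0)" for j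
  define lam2 where "lam2 j = (if ts j \<le> \<theta> then 0 else lam j * sqrt (1 - \<theta>))" for j
  define ts2 where "ts2 j = (if ts j \<le> \<theta> then 0 else (ts j - \<theta>) / (1 - \<theta>))" for j
  define \<mu> where "\<mu> = (\<Sum>j<k. lam j * glue_hat \<theta> (ts j))"
  have ts1: "ts1 j \<in> {0..1}" and ts2: "ts2 j \<in> {0..1}" if "j < k" for j
    using ts[rule_format, OF that] \<theta> by (auto simp: ts1_def ts2_def divide_le_eq)
  define f where "f \<omega>1 = cis (\<Sum>j<k. lam1 j * B1 (ts1 j) \<omega>1)" for \<omega>1
  define h where "h \<omega>2 = cis (\<Sum>j<k. lam2 j * B2 (ts2 j) \<omega>2)" for \<omega>2
  have cis_meas: "(\<lambda>x. cis (F x)) \<in> borel_measurable M" if "F \<in> borel_measurable M" for F :: "'x \<Rightarrow> real" and M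
    using that by (rule measurable_compose) (intro borel_measurable_continuous_onI continuous_on_cis continuous_on_id)
  have f: "f \<in> borel_measurable M1"
    unfolding f_def using B1 ts1
    by (intro cis_meas borel_measurable_sum borel_measurable_times) (auto simp: brownian_bridge_def)
  have h: "h \<in> borel_measurable M2"
    unfolding h_def using B2 ts2
    by (intro cis_meas borel_measurable_sum borel_measurable_times) (auto simp: brownian_bridge_def)
  have Q1: "(\<integral>\<omega>. f \<omega> \<partial>M1) = complex_of_real (exp (- (\<Sum>i<k. \<Sum>j<k. lam1 i * lam1 j * bridge_cov (ts1 i) (ts1 j)) / 2))"
    using B1 ts1 unfolding brownian_bridge_def f_def bridge_cov_def by blast
  have Q2: "(\<integral>\<omega>. h \<omega> \<partial>M2) = complex_of_real (exp (- (\<Sum>i<k. \<Sum>j<k. lam2 i * lam2 j * bridge_cov (ts2 i) (ts2 j)) / 2))"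
    using B2 ts2 unfolding brownian_bridge_def h_def bridge_cov_def by blast
  have decomp: "lam j * glue_bridge \<theta> B1 B2 (ts j) (g, \<omega>1, \<omega>2)
      = lam j * glue_hat \<theta> (ts j) * g + (lam1 j * B1 (ts1 j) \<omega>1 + lam2 j * B2 (ts2 j) \<omega>2)" for j g \<omega>1 \<omega>2
    by (simp add: glue_bridge_def lam1_def lam2_def ts1_def ts2_def distrib_left)
  have split: "cis (\<Sum>j<k. lam j * glue_bridge \<theta> B1 B2 (ts j) \<omega>)
      = cis (\<mu> * fst \<omega>) * (f (fst (snd \<omega>)) * h (snd (snd \<omega>)))" for \<omega>
  proof -
    obtain g \<omega>1 \<omega>2 where \<omega>: "\<omega> = (g, \<omega>1, \<omega>2)" by (cases \<omega>) auto
    show ?thesis unfolding \<omega> decomp by (simp add: sum.distrib \<mu>_def f_def h_def cis_mult sum_distrib_right)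
  qed
  have "(\<integral>\<omega>. cis (\<Sum>j<k. lam j * glue_bridge \<theta> B1 B2 (ts j) \<omega>) \<partial>?M)
      = (\<integral>g. cis (\<mu> * g) \<partial>std_normal_distribution) * (\<integral>p. f (fst p) * h (snd p) \<partial>(M1 \<Otimes>\<^sub>M M2))"
    unfolding split
  proof (rule integral_prod_cis)
    show "(\<lambda>g. cis (\<mu> * g)) \<in> borel_measurable std_normal_distribution"
      by (intro cis_meas) simp
    show "(\<lambda>p. f (fst p) * h (snd p)) \<in> borel_measurable (M1 \<Otimes>\<^sub>M M2)"
      using f h by measurable
  qed (auto simp: f_def h_def norm_mult std_normal.prob_space_axioms P.prob_space_axioms)
  also have "(\<integral>p. f (fst p) * h (snd p) \<partial>(M1 \<Otimes>\<^sub>M M2)) = (\<integral>\<omega>. f \<omega> \<partial>M1) * (\<integral>\<omega>. h \<omega> \<partial>M2)"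
    by (rule integral_prod_cis[OF M1 M2 f h]) (simp_all add: f_def h_def)
  also have "(\<integral>g. cis (\<mu> * g) \<partial>std_normal_distribution) * \<dots> = complex_of_real (exp (- (\<Sum>i<k. \<Sum>j<k. lam i * lam j * bridge_cov (ts i) (ts j)) / 2))"
  proof -
    have sq: "\<mu>\<^sup>2 = (\<Sum>i<k. \<Sum>j<k. lam i * lam j * (glue_hat \<theta> (ts i) * glue_hat \<theta> (ts j)))"
      unfolding \<mu>_def power2_eq_square sum_product by (intro sum.cong refl) (simp add: mult_ac)
    have pt: "lam i * lam j * (glue_hat \<theta> (ts i) * glue_hat \<theta> (ts j)) + lam1 i * lam1 j * bridge_cov (ts1 i) (ts1 j)
        + lam2 i * lam2 j * bridge_cov (ts2 i) (ts2 j) = lam i * lam j * bridge_cov (ts i) (ts j)" for i j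
    proof -
      have aux: "lam i * r * (lam j * r) = lam i * lam j * (r * r)" for r by (simp only: mult_ac)
      have l1: "lam1 i * lam1 j * bridge_cov (ts1 i) (ts1 j)
        = lam i * lam j * (if ts i \<le> \<theta> \<and> ts j \<le> \<theta> then \<theta> * bridge_cov (ts i / \<theta>) (ts j / \<theta>) else 0)"
        using \<theta> aux[of "sqrt \<theta>"] by (simp add: lam1_def ts1_def)
      have l2: "lam2 i * lam2 j * bridge_cov (ts2 i) (ts2 j)
        = lam i * lam j * (if \<not> ts i \<le> \<theta> \<and> \<not> ts j \<le> \<theta> then (1 - \<theta>) *
            bridge_cov ((ts i - \<theta>) / (1 - \<theta>)) ((ts j - \<theta>) / (1 - \<theta>)) else 0)"
        using \<theta> aux[of "sqrt (1 - \<theta>)"] by (simp add: lam2_def ts2_def)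
      show ?thesis unfolding l1 l2 glue_cov[OF \<theta>, of "ts i" "ts j", symmetric]
        by (simp only: distrib_left add_ac)
    qed
    have "\<mu>\<^sup>2 + (\<Sum>i<k. \<Sum>j<k. lam1 i * lam1 j * bridge_cov (ts1 i) (ts1 j))
        + (\<Sum>i<k. \<Sum>j<k. lam2 i * lam2 j * bridge_cov (ts2 i) (ts2 j))
        = (\<Sum>i<k. \<Sum>j<k. lam i * lam j * bridge_cov (ts i) (ts j))"
      unfolding sq sum.distrib[symmetric] pt ..
    then show ?thesis unfolding std_normal_char Q1 Q2
      by (simp add: of_real_mult[symmetric] exp_add[symmetric] add_divide_distrib[symmetric] del: of_real_mult)
  qed
  finally show "(\<integral>\<omega>. cis (\<Sum>j<k. lam j * glue_bridge \<theta> B1 B2 (ts j) \<omega>) \<partial>?M) =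
      complex_of_real (exp (- (\<Sum>i<k. \<Sum>j<k. lam i * lam j * (min (ts i) (ts j) - ts i * ts j)) / 2))"
    unfolding bridge_cov_def .
qed

text \<open>\<open>D\<close> is a measurable majorant of \<open>Delta\<close>, whose own measurability is thereby never needed. The processes are
  pinned at their endpoints everywhere, not just almost surely, since gluing needs this for continuity of paths.\<close>
definition bridge_coupling ::
  "real \<Rightarrow> real \<Rightarrow> nat \<Rightarrow> real \<Rightarrow> 'a measure \<Rightarrow> (real \<Rightarrow> 'a \<Rightarrow> real) \<Rightarrow> (int \<Rightarrow> nat \<Rightarrow> 'a \<Rightarrow> int) \<Rightarrow> (int \<Rightarrow> 'a \<Rightarrow> real) \<Rightarrow> bool"
  where "bridge_coupling a b n C M B S D \<longleftrightarrow>
    prob_space M \<and> brownian_bridge M B \<and> (\<forall>\<omega>\<in>space M. B 0 \<omega> = 0 \<and> B 1 \<omega> = 0) \<and>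
    (\<forall>z m. S z m \<in> measurable M (count_space UNIV)) \<and> (\<forall>z. D z \<in> borel_measurable M) \<and>
    (\<forall>z. \<forall>\<omega>\<in>space M. S z 0 \<omega> = 0 \<and> S z n \<omega> = z) \<and>
    (\<forall>z\<in>L n. rw_bridge_process M n z (S z)) \<and>
    (\<forall>z\<in>L n. \<forall>\<omega>\<in>space M. \<forall>t\<in>{0..real n}.
       \<bar>sqrt (real n) * B (t / real n) \<omega> + t / real n * real_of_int z - interp (\<lambda>m. S z m \<omega>) t\<bar> \<le> D z \<omega>) \<and>
    (\<forall>z\<in>L n. (\<integral>\<^sup>+ \<omega>. ennreal (exp (a * D z \<omega>)) \<partial>M) \<le> ennreal (C * exp (b * (real_of_int z)\<^sup>2 / real n)))"

text \<open>At \<open>t = n\<close> the formula for \<open>interp\<close> mentions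
  \<open>s (Suc n)\<close>, but with weight 0; hence values beyond time n do not matter.\<close>

lemma interp_cong:
  assumes "t \<ge> 0" "t \<le> real n" "\<And>m. m \<le> n \<Longrightarrow> s m = s' m"
  shows "interp s t = interp s' t"
proof -
  define k where "k = nat \<lfloor>t\<rfloor>"
  have k: "real k \<le> t" "t < real k + 1" using assms(1) by (simp_all add: k_def)
  then have "k \<le> n" using assms(2) by linarith
  show ?thesis
  proof (cases "k = n")
    case True
    then have "t = real k" using k assms(2) by simp
    then show ?thesis using assms(3)[of k] \<open>k \<le> n\<close> by (simp add: interp_def Let_def)
  next
    case False
    then show ?thesis using assms(3)[of k] assms(3)[of "Suc k"] \<open>k \<le> n\<close>
      unfolding interp_def Let_def k_def[symmetric] by simp
  qed
qed

lemma interp_shift: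
  assumes "t \<ge> 0"
  shows "interp (\<lambda>m. w + s m) t = real_of_int w + interp s t"
  by (simp add: interp_def Let_def)

lemma interp_add:
  assumes "t \<ge> 0"
  shows "interp s (real n + t) = interp (\<lambda>m. s (n + m)) t"
proof -
  have "nat \<lfloor>real n + t\<rfloor> = n + nat \<lfloor>t\<rfloor>"
    using assms by (simp add: nat_add_distrib floor_add_int[symmetric] add.commute)
  then show ?thesis by (simp add: interp_def Let_def)
qed

definition glue_walk :: "nat \<Rightarrow> (int \<Rightarrow> real \<Rightarrow> int) \<Rightarrow> (int \<Rightarrow> nat \<Rightarrow> 'a \<Rightarrow> int) \<Rightarrow> (int \<Rightarrow> nat \<Rightarrow> 'b \<Rightarrow> int)
    \<Rightarrow> int \<Rightarrow> nat \<Rightarrow> real \<times> 'a \<times> 'b \<Rightarrow> int" where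
  "glue_walk n1 W S1 S2 z m = (\<lambda>(g, \<omega>1, \<omega>2).
     if m \<le> n1 then S1 (W z g) m \<omega>1 else W z g + S2 (z - W z g) (m - n1) \<omega>2)"

text \<open>The event of following a given path is a product of three events, one for each factor of
  the space. In the product of their probabilities the path counts of the parts cancel and
  \<open>1 / walk_count (n1 + n2) z\<close> remains.\<close>

lemma rw_bridge_process_glue:
  assumes M1: "prob_space M1" and M2: "prob_space M2"
    and n: "n1 \<ge> 1" "n2 \<ge> 1"
    and S1: "\<And>z m. S1 z m \<in> measurable M1 (count_space UNIV)" "\<And>z. z \<in> L n1 \<Longrightarrow> rw_bridge_process M1 n1 z (S1 z)"
      "\<And>z \<omega>. \<omega> \<in> space M1 \<Longrightarrow> S1 z n1 \<omega> = z"
    and S2: "\<And>z m. S2 z m \<in> measurable M2 (count_space UNIV)" "\<And>z. z \<in> L n2 \<Longrightarrow> rw_bridge_process M2 n2 z (S2 z)"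
      "\<And>z \<omega>. \<omega> \<in> space M2 \<Longrightarrow> S2 z 0 \<omega> = 0" "\<And>z \<omega>. \<omega> \<in> space M2 \<Longrightarrow> S2 z n2 \<omega> = z"
    and W: "W z \<in> measurable borel (count_space UNIV)"
    and law: "\<And>w. w \<in> L n1 \<Longrightarrow> z - w \<in> L n2 \<Longrightarrow> measure std_normal_distribution {g. W z g = w}
         = real (walk_count n1 w) * real (walk_count n2 (z - w)) / real (walk_count (n1 + n2) z)"
    and meas: "\<And>m. glue_walk n1 W S1 S2 z m \<in> measurable (std_normal_distribution \<Otimes>\<^sub>M (M1 \<Otimes>\<^sub>M M2)) (count_space UNIV)"
  shows "rw_bridge_process (std_normal_distribution \<Otimes>\<^sub>M (M1 \<Otimes>\<^sub>M M2)) (n1 + n2) z (glue_walk n1 W S1 S2 z)"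
    (is "rw_bridge_process ?M _ _ ?S")
  unfolding rw_bridge_process_def
proof (intro conjI allI ballI)
  show "?S m \<in> measurable ?M (count_space UNIV)" for m by (rule meas)
  interpret M1: prob_space M1 by fact
  interpret M2: prob_space M2 by fact
  interpret P: pair_prob_space M1 M2 ..
  fix p assume p: "p \<in> walk_paths (n1 + n2)"
  have space: "\<omega> \<in> space ?M \<longleftrightarrow> fst (snd \<omega>) \<in> space M1 \<and> snd (snd \<omega>) \<in> space M2" for \<omega>
    by (cases \<omega>) (auto simp: space_pair_measure)
  show "measure ?M {\<omega> \<in> space ?M. \<forall>m\<le>n1 + n2. ?S m \<omega> = p m} = srw_cond_prob (n1 + n2) z p"
  proof (cases "p (n1 + n2) = z")
    case False
    have "?S (n1 + n2) \<omega> = z" if "\<omega> \<in> space ?M" for \<omega>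
      using that n S2(4) by (cases \<omega>) (auto simp: glue_walk_def space_pair_measure)
    then have "{\<omega> \<in> space ?M. \<forall>m\<le>n1 + n2. ?S m \<omega> = p m} = {}"
      using False by (metis (mono_tags, lifting) Collect_empty_eq order_refl)
    then show ?thesis using False by (simp only: srw_cond_prob_eq if_False measure_empty)
  next
    case True
    define w where "w = p n1"
    define p1 where "p1 = (\<lambda>m. if m \<le> n1 then p m else 0)"
    define p2 where "p2 = (\<lambda>m. if m \<le> n2 then p (n1 + m) - p n1 else 0)"
    have p1: "p1 \<in> walk_paths n1" "p1 n1 = w" using walk_paths_take[OF p] by (auto simp: p1_def w_def)
    have p2: "p2 \<in> walk_paths n2" "p2 n2 = z - w" using walk_paths_drop[OF p] True by (auto simp: p2_def w_def)
    have wL: "w \<in> L n1" "z - w \<in> L n2"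
      using walk_paths_end_in_L[OF p1(1)] walk_paths_end_in_L[OF p2(1)] p1 p2 by auto
    define E1 where "E1 = {\<omega> \<in> space M1. \<forall>m\<le>n1. S1 w m \<omega> = p1 m}"
    define E2 where "E2 = {\<omega> \<in> space M2. \<forall>m\<le>n2. S2 (z - w) m \<omega> = p2 m}"
    define G where "G = {g. W z g = w}"
    have "{\<omega> \<in> space ?M. \<forall>m\<le>n1 + n2. ?S m \<omega> = p m} = G \<times> (E1 \<times> E2)"
    proof (intro equalityI subsetI)
      fix \<omega> assume "\<omega> \<in> {\<omega> \<in> space ?M. \<forall>m\<le>n1 + n2. ?S m \<omega> = p m}"
      then obtain g \<omega>1 \<omega>2 where \<omega>: "\<omega> = (g, \<omega>1, \<omega>2)" "\<omega>1 \<in> space M1" "\<omega>2 \<in> space M2"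
        and eq: "\<And>m. m \<le> n1 + n2 \<Longrightarrow> ?S m (g, \<omega>1, \<omega>2) = p m"
        by (auto simp: space_pair_measure)
      \<comment> \<open>As \<open>S1\<close> is pinned at its endpoint everywhere, the value of the
        glued walk at time \<open>n1\<close> is \<open>W z g\<close> itself, so the path determines
        the event \<open>G\<close>.\<close>
      have Wg: "W z g = w" using eq[of n1] S1(3)[OF \<omega>(2)] by (simp add: glue_walk_def w_def)
      have "S1 w m \<omega>1 = p1 m" if "m \<le> n1" for m
        using eq[of m] that Wg by (simp add: glue_walk_def p1_def)
      moreover have "S2 (z - w) m \<omega>2 = p2 m" if "m \<le> n2" for m
      proof (cases "m = 0")
        case True then show ?thesis using S2(3)[OF \<omega>(3)] by (simp add: p2_def)
      next
        case False
        then show ?thesis using eq[of "n1 + m"] that Wg by (simp add: glue_walk_def p2_def w_def)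
      qed
      ultimately show "\<omega> \<in> G \<times> (E1 \<times> E2)" using \<omega> Wg by (simp add: G_def E1_def E2_def)
    next
      fix \<omega> assume "\<omega> \<in> G \<times> (E1 \<times> E2)"
      then obtain g \<omega>1 \<omega>2 where \<omega>: "\<omega> = (g, \<omega>1, \<omega>2)" "\<omega>1 \<in> space M1" "\<omega>2 \<in> space M2" "W z g = w"
        and e1: "\<And>m. m \<le> n1 \<Longrightarrow> S1 w m \<omega>1 = p1 m" and e2: "\<And>m. m \<le> n2 \<Longrightarrow> S2 (z - w) m \<omega>2 = p2 m"
        by (auto simp: G_def E1_def E2_def)
      have "?S m \<omega> = p m" if "m \<le> n1 + n2" for m
        using that e1[of m] e2[of "m - n1"] by (auto simp: \<omega> glue_walk_def p1_def p2_def w_def)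
      then show "\<omega> \<in> {\<omega> \<in> space ?M. \<forall>m\<le>n1 + n2. ?S m \<omega> = p m}"
        using \<omega> by (simp add: space_pair_measure)
    qed
    moreover have E1s: "E1 \<in> sets M1"
    proof -
      have "{\<omega> \<in> space M1. S1 w m \<omega> = p1 m} \<in> sets M1" for m
        using measurable_sets[OF S1(1)[of w m], of "{p1 m}"] by (simp add: vimage_def Int_def conj_commute)
      then have "{\<omega> \<in> space M1. \<forall>m\<in>{..n1}. S1 w m \<omega> = p1 m} \<in> sets M1"
        by (intro sets.sets_Collect_finite_All) auto
      also have "{\<omega> \<in> space M1. \<forall>m\<in>{..n1}. S1 w m \<omega> = p1 m} = E1" by (auto simp: E1_def)
      finally show ?thesis .
    qed
    moreover have E2s: "E2 \<in> sets M2"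
    proof -
      have "{\<omega> \<in> space M2. S2 (z - w) m \<omega> = p2 m} \<in> sets M2" for m
        using measurable_sets[OF S2(1)[of "z - w" m], of "{p2 m}"] by (simp add: vimage_def Int_def conj_commute)
      then have "{\<omega> \<in> space M2. \<forall>m\<in>{..n2}. S2 (z - w) m \<omega> = p2 m} \<in> sets M2"
        by (intro sets.sets_Collect_finite_All) auto
      also have "{\<omega> \<in> space M2. \<forall>m\<in>{..n2}. S2 (z - w) m \<omega> = p2 m} = E2" by (auto simp: E2_def)
      finally show ?thesis .
    qed
    moreover have Gs: "G \<in> sets std_normal_distribution"
      using measurable_sets[OF W, of "{w}"] by (simp add: vimage_def G_def)
    ultimately have "measure ?M {\<omega> \<in> space ?M. \<forall>m\<le>n1 + n2. ?S m \<omega> = p m}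
        = measure std_normal_distribution G * (measure M1 E1 * measure M2 E2)"
      using P.P.emeasure_pair_measure_Times[of G std_normal_distribution "E1 \<times> E2"]
        M2.emeasure_pair_measure_Times[of E1 M1 E2]
      by (simp add: measure_def enn2real_mult)
    also have "measure M1 E1 = 1 / real (walk_count n1 w)"
      using S1(2)[OF wL(1)] p1 unfolding rw_bridge_process_def E1_def by (simp add: srw_cond_prob_eq)
    also have "measure M2 E2 = 1 / real (walk_count n2 (z - w))"
      using S2(2)[OF wL(2)] p2 unfolding rw_bridge_process_def E2_def by (simp add: srw_cond_prob_eq)
    also have "measure std_normal_distribution G
        = real (walk_count n1 w) * real (walk_count n2 (z - w)) / real (walk_count (n1 + n2) z)"
      unfolding G_def by (rule law[OF wL])
    finally show ?thesis using wL True by (simp add: srw_cond_prob_eq L_iff_count)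
  qed
qed

text \<open>An exact identity followed by the triangle inequality: the tent and the drift are linear
  up to time \<open>n1\<close>, so the discrepancy is \<open>t / n1\<close> times the one at the
  splitting time plus the discrepancy of the left part with endpoint \<open>w\<close>.\<close>

lemma glue_pointwise_left:
  fixes n1 n2 :: nat and t g z w X I :: real
  defines "n \<equiv> real (n1 + n2)" and "\<theta> \<equiv> real n1 / real (n1 + n2)"
  assumes n: "n1 \<ge> 1" "n2 \<ge> 1" and t: "0 \<le> t" "t \<le> real n1"
  shows "\<bar>sqrt n * (glue_hat \<theta> (t / n) * g + sqrt \<theta> * X) + t / n * z - I\<bar>
    \<le> \<bar>real n1 * z / n + sqrt (real n1 * real n2 / n) * g - w\<bar>
      + \<bar>sqrt (real n1) * X + t / real n1 * w - I\<bar>"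
proof -
  define s where "s = sqrt (real n1 * real n2 / n)"
  have pos: "n > 0" "real n1 > 0" "real n2 > 0" using n by (auto simp: n_def)
  have \<theta>n: "\<theta> = real n1 / n" by (simp add: \<theta>_def n_def)
  have 1: "sqrt n * sqrt \<theta> = sqrt (real n1)" using pos by (simp add: real_sqrt_mult[symmetric] \<theta>n)
  have th: "1 - \<theta> = real n2 / n" using pos unfolding \<theta>n by (simp add: divide_simps n_def)
  have "n * (\<theta> * (1 - \<theta>)) = real n1 * real n2 / n" unfolding th using pos by (simp add: \<theta>n)
  then have 2: "sqrt n * sqrt (\<theta> * (1 - \<theta>)) = s" by (simp only: real_sqrt_mult[symmetric] s_def)
  have "t / n \<le> \<theta>" using t pos by (simp add: \<theta>n divide_right_mono)
  moreover have "t / n / \<theta> = t / real n1" using pos by (simp add: \<theta>n)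
  ultimately have hat: "glue_hat \<theta> (t / n) = sqrt (\<theta> * (1 - \<theta>)) * (t / real n1)" by (simp add: glue_hat_def)
  have "sqrt n * (glue_hat \<theta> (t / n) * g + sqrt \<theta> * X)
      = (sqrt n * sqrt (\<theta> * (1 - \<theta>))) * (t / real n1) * g + (sqrt n * sqrt \<theta>) * X"
    unfolding hat by (simp add: algebra_simps)
  also have "\<dots> = s * (t / real n1) * g + sqrt (real n1) * X" unfolding 1 2 ..
  finally have eq: "sqrt n * (glue_hat \<theta> (t / n) * g + sqrt \<theta> * X) + t / n * z - I
     = t / real n1 * (real n1 * z / n + s * g - w) + (sqrt (real n1) * X + t / real n1 * w - I)"
    using pos by (simp add: algebra_simps)
  have "\<bar>t / real n1 * (real n1 * z / n + s * g - w)\<bar> \<le> 1 * \<bar>real n1 * z / n + s * g - w\<bar>"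
    unfolding abs_mult using t pos by (intro mult_right_mono) auto
  from order_trans[OF abs_triangle_ineq add_right_mono[OF this]] show ?thesis
    unfolding eq s_def[symmetric] mult_1_left .
qed

text \<open>As on the left, with weight \<open>(n2 - r) / n2\<close> decreasing to 0 at the right
  end. \<open>r\<close> is positive because time \<open>n1\<close> itself belongs to the left branch
  of \<open>glue_bridge\<close>.\<close>

lemma glue_pointwise_right:
  fixes n1 n2 :: nat and r g z w X I :: real
  defines "n \<equiv> real (n1 + n2)" and "\<theta> \<equiv> real n1 / real (n1 + n2)"
  assumes n: "n1 \<ge> 1" "n2 \<ge> 1" and r: "0 < r" "r \<le> real n2"
  shows "\<bar>sqrt n * (glue_hat \<theta> ((real n1 + r) / n) * g + sqrt (1 - \<theta>) * X) + (real n1 + r) / n * z - (w + I)\<bar>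
    \<le> \<bar>real n1 * z / n + sqrt (real n1 * real n2 / n) * g - w\<bar>
      + \<bar>sqrt (real n2) * X + r / real n2 * (z - w) - I\<bar>"
proof -
  define s where "s = sqrt (real n1 * real n2 / n)"
  have pos: "n > 0" "real n1 > 0" "real n2 > 0" "n = real n1 + real n2" using n by (auto simp: n_def)
  have \<theta>n: "\<theta> = real n1 / n" by (simp add: \<theta>_def n_def)
  have th: "1 - \<theta> = real n2 / n" using pos unfolding \<theta>n by (simp add: divide_simps n_def)
  have 1: "sqrt n * sqrt (1 - \<theta>) = sqrt (real n2)" unfolding th using pos(1) by (simp add: real_sqrt_mult[symmetric])
  have "n * (\<theta> * (1 - \<theta>)) = real n1 * real n2 / n" unfolding th using pos by (simp add: \<theta>n)
  then have 2: "sqrt n * sqrt (\<theta> * (1 - \<theta>)) = s" by (simp only: real_sqrt_mult[symmetric] s_def)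
  have "\<not> (real n1 + r) / n \<le> \<theta>" using r pos by (simp add: \<theta>n divide_le_cancel)
  moreover have "(1 - (real n1 + r) / n) / (1 - \<theta>) = (real n2 - r) / real n2"
  proof -
    have "1 - (real n1 + r) / n = (real n2 - r) / n" using pos(1,4) by (simp add: divide_simps)
    then show ?thesis unfolding th using pos by simp
  qed
  ultimately have hat: "glue_hat \<theta> ((real n1 + r) / n) = sqrt (\<theta> * (1 - \<theta>)) * ((real n2 - r) / real n2)"
    by (simp add: glue_hat_def)
  have "sqrt n * (glue_hat \<theta> ((real n1 + r) / n) * g + sqrt (1 - \<theta>) * X)
      = (sqrt n * sqrt (\<theta> * (1 - \<theta>))) * ((real n2 - r) / real n2) * g + (sqrt n * sqrt (1 - \<theta>)) * X"
    unfolding hat by (simp add: algebra_simps)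
  also have "\<dots> = s * ((real n2 - r) / real n2) * g + sqrt (real n2) * X" unfolding 1 2 ..
  finally have e1: "sqrt n * (glue_hat \<theta> ((real n1 + r) / n) * g + sqrt (1 - \<theta>) * X)
    = s * ((real n2 - r) / real n2) * g + sqrt (real n2) * X" .
  have e2: "(real n1 + r) / n = r / real n2 + (real n2 - r) / real n2 * (real n1 / n)"
  proof -
    have "r / real n2 + (real n2 - r) / real n2 * (real n1 / n)
      = (r * n + (real n2 - r) * real n1) / (real n2 * n)" using pos(1-3) by (simp add: divide_simps)
    also have "r * n + (real n2 - r) * real n1 = real n2 * (real n1 + r)" unfolding pos(4) by (simp add: algebra_simps)
    also have "real n2 * (real n1 + r) / (real n2 * n) = (real n1 + r) / n" using pos(3) by simp
    finally show ?thesis ..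
  qed
  have e3: "w = r / real n2 * w + (real n2 - r) / real n2 * w" using pos by (simp add: divide_simps) (simp add: algebra_simps)
  define q where "q = (real n2 - r) / real n2"
  define q' where "q' = r / real n2"
  have eq: "sqrt n * (glue_hat \<theta> ((real n1 + r) / n) * g + sqrt (1 - \<theta>) * X) + (real n1 + r) / n * z - (w + I)
     = q * (real n1 * z / n + s * g - w) + (sqrt (real n2) * X + r / real n2 * (z - w) - I)"
    using e3 unfolding e1 unfolding e2 q_def[symmetric] q'_def[symmetric] by (simp add: algebra_simps)
  have "\<bar>q * (real n1 * z / n + s * g - w)\<bar> \<le> 1 * \<bar>real n1 * z / n + s * g - w\<bar>"
    unfolding abs_mult q_def using r pos by (intro mult_right_mono) auto
  from order_trans[OF abs_triangle_ineq add_right_mono[OF this]] show ?thesis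
    unfolding eq s_def[symmetric] mult_1_left .
qed

text \<open>The new majorant is the discrepancy at the splitting time plus the maximum of the two
  old ones, taken at the random endpoints. For fixed \<open>g\<close> these endpoints are constants,
  so the inner integral uses the hypotheses on the parts, and \<open>walk_splitting\<close> bounds
  the outer one.\<close>

lemma bridge_coupling_glue:
  assumes c1: "bridge_coupling a b n1 C1 M1 B1 S1 D1" and c2: "bridge_coupling a b n2 C2 M2 B2 S2 D2"
    and split: "walk_splitting a b n1 n2 C1 C2 C W"
    and n: "n1 \<ge> 1" "n2 \<ge> 1" and a: "a \<ge> 0" and C: "C1 \<ge> 0" "C2 \<ge> 0"
  shows "\<exists>B S D. bridge_coupling a b (n1 + n2) C (std_normal_distribution \<Otimes>\<^sub>M (M1 \<Otimes>\<^sub>M M2)) B S D"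
proof -
  let ?n = "n1 + n2"
  let ?M = "std_normal_distribution \<Otimes>\<^sub>M (M1 \<Otimes>\<^sub>M M2)"
  note d1 = c1[unfolded bridge_coupling_def] and d2 = c2[unfolded bridge_coupling_def]
  interpret M1: prob_space M1 using d1 by blast
  interpret M2: prob_space M2 using d2 by blast
  interpret P: pair_prob_space M1 M2 ..
  interpret Q: pair_prob_space std_normal_distribution "M1 \<Otimes>\<^sub>M M2" ..
  have S1m [measurable]: "S1 z m \<in> measurable M1 (count_space UNIV)" for z m using d1 by blast
  have S2m [measurable]: "S2 z m \<in> measurable M2 (count_space UNIV)" for z m using d2 by blast
  have D1m [measurable]: "D1 z \<in> borel_measurable M1" for z using d1 by blast
  have D2m [measurable]: "D2 z \<in> borel_measurable M2" for z using d2 by blast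
  have S10: "S1 z 0 \<omega> = 0" "S1 z n1 \<omega> = z" if "\<omega> \<in> space M1" for z \<omega> using d1 that by blast+
  have S20: "S2 z 0 \<omega> = 0" "S2 z n2 \<omega> = z" if "\<omega> \<in> space M2" for z \<omega> using d2 that by blast+
  \<comment> \<open>The definition of \<open>bridge_coupling\<close> asks for measurability at every
    \<open>z\<close>, while \<open>walk_splitting\<close> says nothing outside \<open>L ?n\<close>;
    there \<open>W'\<close> is set to 0.\<close>
  define W' where "W' z = (if z \<in> L ?n then W z else (\<lambda>_. 0))" for z
  have W'm [measurable]: "W' z \<in> measurable borel (count_space UNIV)" for z
    using split unfolding W'_def walk_splitting_def by auto
  have W'L: "W' z g \<in> L n1" "z - W' z g \<in> L n2" if "z \<in> L ?n" for z g
    using split that unfolding W'_def walk_splitting_def by auto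
  define \<theta> where "\<theta> = real n1 / real ?n"
  have \<theta>: "0 < \<theta>" "\<theta> < 1" using n by (auto simp: \<theta>_def)
  define B where "B = glue_bridge \<theta> B1 B2"
  define S where "S = glue_walk n1 W' S1 S2"
  define V where "V z g = real n1 * real_of_int z / real ?n + sqrt (real n1 * real n2 / real ?n) * g" for z g
  define D where "D z = (\<lambda>(g, \<omega>1, \<omega>2). \<bar>V z g - real_of_int (W' z g)\<bar> + max (D1 (W' z g) \<omega>1) (D2 (z - W' z g) \<omega>2))"
    for z
  have Vm [measurable]: "V z \<in> borel_measurable borel" for z unfolding V_def by measurable
  have Wfst [measurable]: "(\<lambda>\<omega>. W' z (fst \<omega>)) \<in> measurable ?M (count_space UNIV)" for z by measurable
  have Sm: "S z m \<in> measurable ?M (count_space UNIV)" for z m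
  proof -
    \<comment> \<open>The index is itself random; it takes countably many values, so measurability
      is checked for each fixed index.\<close>
    have "(\<lambda>\<omega>. S1 (W' z (fst \<omega>)) m (fst (snd \<omega>))) \<in> measurable ?M (count_space UNIV)"
      by (rule measurable_compose_countable[OF _ Wfst]) measurable
    moreover have "(\<lambda>\<omega>. W' z (fst \<omega>) + S2 (z - W' z (fst \<omega>)) (m - n1) (snd (snd \<omega>))) \<in> measurable ?M (count_space UNIV)"
      by (rule measurable_compose_countable[OF _ Wfst, where f = "\<lambda>w \<omega>. w + S2 (z - w) (m - n1) (snd (snd \<omega>))"]) measurable
    ultimately show ?thesis unfolding S_def glue_walk_def split_beta by (cases "m \<le> n1") auto
  qed
  have Dm: "D z \<in> borel_measurable ?M" for z
  proof -
    have "(\<lambda>\<omega>. D1 (W' z (fst \<omega>)) (fst (snd \<omega>))) \<in> borel_measurable ?M"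
      by (rule measurable_compose_countable[OF _ Wfst]) measurable
    moreover have "(\<lambda>\<omega>. D2 (z - W' z (fst \<omega>)) (snd (snd \<omega>))) \<in> borel_measurable ?M"
      by (rule measurable_compose_countable[OF _ Wfst, where f = "\<lambda>w \<omega>. D2 (z - w) (snd (snd \<omega>))"]) measurable
    moreover have "(\<lambda>\<omega>. real_of_int (W' z (fst \<omega>))) \<in> borel_measurable ?M"
      by (rule measurable_compose[OF Wfst]) simp
    ultimately show ?thesis unfolding D_def split_beta by measurable
  qed
  have bb: "brownian_bridge ?M B"
    unfolding B_def by (rule brownian_bridge_glue) (use d1 d2 \<theta> in auto)
  have pin: "B 0 \<omega> = 0 \<and> B 1 \<omega> = 0" if "\<omega> \<in> space ?M" for \<omega>
    using that d1 d2 \<theta> by (cases \<omega>) (auto simp: B_def glue_bridge_def glue_hat_def space_pair_measure)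
  have S0: "S z 0 \<omega> = 0 \<and> S z ?n \<omega> = z" if "\<omega> \<in> space ?M" for z \<omega>
    using that S10 S20 n by (cases \<omega>) (auto simp: S_def glue_walk_def space_pair_measure)
  have law: "rw_bridge_process ?M ?n z (S z)" if z: "z \<in> L ?n" for z
    unfolding S_def
  proof (rule rw_bridge_process_glue)
    show "measure std_normal_distribution {g. W' z g = w}
         = real (walk_count n1 w) * real (walk_count n2 (z - w)) / real (walk_count (n1 + n2) z)"
      if "w \<in> L n1" "z - w \<in> L n2" for w
      using split z that unfolding W'_def walk_splitting_def by auto
    show "glue_walk n1 W' S1 S2 z m \<in> measurable ?M (count_space UNIV)" for m
      using Sm unfolding S_def .
    show "rw_bridge_process M1 n1 w (S1 w)" if "w \<in> L n1" for w using d1 that by blast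
    show "rw_bridge_process M2 n2 w (S2 w)" if "w \<in> L n2" for w using d2 that by blast
  qed (use n S10 S20 M1.prob_space_axioms M2.prob_space_axioms in auto)
  have bound: "\<bar>sqrt (real ?n) * B (t / real ?n) \<omega> + t / real ?n * real_of_int z - interp (\<lambda>m. S z m \<omega>) t\<bar> \<le> D z \<omega>"
    if z: "z \<in> L ?n" and \<omega>M: "\<omega> \<in> space ?M" and t: "t \<in> {0..real ?n}" for z \<omega> t
  proof -
    obtain g \<omega>1 \<omega>2 where \<omega>: "\<omega> = (g, \<omega>1, \<omega>2)" "\<omega>1 \<in> space M1" "\<omega>2 \<in> space M2"
      using \<omega>M by (auto simp: space_pair_measure)
    define w where "w = W' z g"
    have wL: "w \<in> L n1" "z - w \<in> L n2" unfolding w_def by (rule W'L[OF z])+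
    have pos: "real ?n > 0" "real n1 > 0" "real n2 > 0" using n by auto
    show ?thesis
    proof (cases "t \<le> real n1")
      case True
      have "interp (\<lambda>m. S z m \<omega>) t = interp (\<lambda>m. S1 w m \<omega>1) t"
        by (rule interp_cong[of _ n1]) (use t True in \<open>auto simp: S_def glue_walk_def \<omega>(1) w_def\<close>)
      moreover have "t / real ?n \<le> \<theta>" unfolding \<theta>_def using True pos by (intro divide_right_mono) auto
      moreover have "t / real ?n / \<theta> = t / real n1" unfolding \<theta>_def using pos by (simp del: of_nat_add)
      ultimately have "interp (\<lambda>m. S z m \<omega>) t = interp (\<lambda>m. S1 w m \<omega>1) t"
        "B (t / real ?n) \<omega> = glue_hat \<theta> (t / real ?n) * g + sqrt \<theta> * B1 (t / real n1) \<omega>1"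
        by (simp_all only: B_def glue_bridge_def \<omega>(1) prod.case if_True)
      then have eq: "\<bar>sqrt (real ?n) * B (t / real ?n) \<omega> + t / real ?n * real_of_int z - interp (\<lambda>m. S z m \<omega>) t\<bar>
        = \<bar>sqrt (real ?n) * (glue_hat \<theta> (t / real ?n) * g + sqrt \<theta> * B1 (t / real n1) \<omega>1) + t / real ?n * real_of_int z
            - interp (\<lambda>m. S1 w m \<omega>1) t\<bar>"
        by (simp only:)
      have "\<dots> \<le> \<bar>V z g - real_of_int w\<bar> + \<bar>sqrt (real n1) * B1 (t / real n1) \<omega>1 + t / real n1 * real_of_int w
            - interp (\<lambda>m. S1 w m \<omega>1) t\<bar>"
        unfolding V_def \<theta>_def by (rule glue_pointwise_left[OF n]) (use t True in auto)
      also have "\<dots> \<le> \<bar>V z g - real_of_int w\<bar> + D1 w \<omega>1"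
        using d1 wL(1) \<omega>(2) t True by (intro add_left_mono) auto
      also have "\<dots> \<le> D z \<omega>" by (simp add: D_def \<omega>(1) w_def)
      finally show ?thesis unfolding eq .
    next
      case False
      define r where "r = t - real n1"
      have r: "0 < r" "r \<le> real n2" "t = real n1 + r" using t False by (auto simp: r_def)
      have "interp (\<lambda>m. S z m \<omega>) t = interp (\<lambda>m. S z (n1 + m) \<omega>) r"
        unfolding r(3) by (rule interp_add) (use r in simp)
      also have "(\<lambda>m. S z (n1 + m) \<omega>) = (\<lambda>m. w + S2 (z - w) m \<omega>2)"
        using S10(2)[OF \<omega>(2)] S20(1)[OF \<omega>(3)] by (auto simp: fun_eq_iff S_def glue_walk_def \<omega>(1) w_def)
      also have "interp \<dots> r = real_of_int w + interp (\<lambda>m. S2 (z - w) m \<omega>2) r"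
        by (rule interp_shift) (use r in simp)
      finally have I: "interp (\<lambda>m. S z m \<omega>) t = real_of_int w + interp (\<lambda>m. S2 (z - w) m \<omega>2) r" .
      have "\<not> t / real ?n \<le> \<theta>" unfolding \<theta>_def using False pos by (simp add: divide_le_cancel del: of_nat_add)
      moreover have "(t / real ?n - \<theta>) / (1 - \<theta>) = r / real n2"
      proof -
        have "t / real ?n - \<theta> = r / real ?n" by (simp add: \<theta>_def r_def diff_divide_distrib)
        moreover have "1 - \<theta> = real n2 / real ?n" using pos unfolding \<theta>_def by (simp add: divide_simps)
        ultimately show ?thesis using pos(1) by (simp del: of_nat_add)
      qed
      ultimately have "B (t / real ?n) \<omega> = glue_hat \<theta> (t / real ?n) * g + sqrt (1 - \<theta>) * B2 (r / real n2) \<omega>2"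
        by (simp only: B_def glue_bridge_def \<omega>(1) prod.case if_False)
      then have eq: "\<bar>sqrt (real ?n) * B (t / real ?n) \<omega> + t / real ?n * real_of_int z - interp (\<lambda>m. S z m \<omega>) t\<bar>
        = \<bar>sqrt (real ?n) * (glue_hat \<theta> (t / real ?n) * g + sqrt (1 - \<theta>) * B2 (r / real n2) \<omega>2) + t / real ?n * real_of_int z
            - (real_of_int w + interp (\<lambda>m. S2 (z - w) m \<omega>2) r)\<bar>"
        by (simp only: I)
      have "\<dots> \<le> \<bar>V z g - real_of_int w\<bar> + \<bar>sqrt (real n2) * B2 (r / real n2) \<omega>2
            + r / real n2 * (real_of_int z - real_of_int w) - interp (\<lambda>m. S2 (z - w) m \<omega>2) r\<bar>"
        unfolding V_def \<theta>_def r(3) by (rule glue_pointwise_right[OF n r(1,2)])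
      also have "real_of_int z - real_of_int w = real_of_int (z - w)" by simp
      also have "\<bar>V z g - real_of_int w\<bar> + \<bar>sqrt (real n2) * B2 (r / real n2) \<omega>2
            + r / real n2 * real_of_int (z - w) - interp (\<lambda>m. S2 (z - w) m \<omega>2) r\<bar>
          \<le> \<bar>V z g - real_of_int w\<bar> + D2 (z - w) \<omega>2"
      proof (rule add_left_mono)
        have "r \<in> {0..real n2}" using r by simp
        then show "\<bar>sqrt (real n2) * B2 (r / real n2) \<omega>2 + r / real n2 * real_of_int (z - w)
            - interp (\<lambda>m. S2 (z - w) m \<omega>2) r\<bar> \<le> D2 (z - w) \<omega>2"
          using d2 wL(2) \<omega>(3) by blast
      qed
      also have "\<dots> \<le> D z \<omega>" by (simp add: D_def \<omega>(1) w_def)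
      finally show ?thesis unfolding eq .
    qed
  qed
  have int: "(\<integral>\<^sup>+ \<omega>. ennreal (exp (a * D z \<omega>)) \<partial>?M) \<le> ennreal (C * exp (b * (real_of_int z)\<^sup>2 / real ?n))"
    if z: "z \<in> L ?n" for z
  proof -
    have inner: "(\<integral>\<^sup>+ p. ennreal (exp (a * D z (g, p))) \<partial>(M1 \<Otimes>\<^sub>M M2))
      \<le> ennreal (exp (a * \<bar>V z g - real_of_int (W' z g)\<bar>) * (C1 * exp (b * (real_of_int (W' z g))\<^sup>2 / real n1)
              + C2 * exp (b * (real_of_int (z - W' z g))\<^sup>2 / real n2)))" for g
    proof -
      define w where "w = W' z g"
      have wL: "w \<in> L n1" "z - w \<in> L n2" unfolding w_def by (rule W'L[OF z])+
      define E where "E = exp (a * \<bar>V z g - real_of_int w\<bar>)"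
      have "(\<integral>\<^sup>+ p. ennreal (exp (a * D z (g, p))) \<partial>(M1 \<Otimes>\<^sub>M M2))
        \<le> (\<integral>\<^sup>+ p. ennreal E * (ennreal (exp (a * D1 w (fst p))) + ennreal (exp (a * D2 (z - w) (snd p)))) \<partial>(M1 \<Otimes>\<^sub>M M2))"
      proof (rule nn_integral_mono)
        fix p
        \<comment> \<open>Replacing the exponential of the maximum by a sum decouples the two parts;
          this is the origin of the sum with \<open>C1\<close> and \<open>C2\<close> in
          \<open>walk_splitting\<close>.\<close>
        have "a * max x y = max (a * x) (a * y)" for x y using a by (simp add: max_mult_distrib_left)
        then have "exp (a * max x y) \<le> exp (a * x) + exp (a * y)" for x y
          by (simp add: max_def add_increasing add_increasing2)
        then have "exp (a * D z (g, p)) \<le> E * (exp (a * D1 w (fst p)) + exp (a * D2 (z - w) (snd p)))"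
          by (simp add: D_def split_beta w_def[symmetric] distrib_left[of a] exp_add E_def mult_left_mono)
        then show "ennreal (exp (a * D z (g, p))) \<le> ennreal E * (ennreal (exp (a * D1 w (fst p))) + ennreal (exp (a * D2 (z - w) (snd p))))"
          by (simp add: E_def ennreal_mult[symmetric] ennreal_plus[symmetric] del: ennreal_plus)
      qed
      also have "\<dots> = ennreal E * ((\<integral>\<^sup>+ p. ennreal (exp (a * D1 w (fst p))) \<partial>(M1 \<Otimes>\<^sub>M M2))
            + (\<integral>\<^sup>+ p. ennreal (exp (a * D2 (z - w) (snd p))) \<partial>(M1 \<Otimes>\<^sub>M M2)))"
        by (subst nn_integral_cmult) (auto simp: nn_integral_add)
      also have "(\<integral>\<^sup>+ p. ennreal (exp (a * D1 w (fst p))) \<partial>(M1 \<Otimes>\<^sub>M M2)) = (\<integral>\<^sup>+ x. ennreal (exp (a * D1 w x)) \<partial>M1)"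
        by (subst M2.nn_integral_fst[symmetric]) (simp_all add: M2.emeasure_space_1)
      also have "(\<integral>\<^sup>+ p. ennreal (exp (a * D2 (z - w) (snd p))) \<partial>(M1 \<Otimes>\<^sub>M M2)) = (\<integral>\<^sup>+ x. ennreal (exp (a * D2 (z - w) x)) \<partial>M2)"
        by (subst M2.nn_integral_fst[symmetric]) (simp_all add: M1.emeasure_space_1)
      also have "ennreal E * ((\<integral>\<^sup>+ x. ennreal (exp (a * D1 w x)) \<partial>M1) + (\<integral>\<^sup>+ x. ennreal (exp (a * D2 (z - w) x)) \<partial>M2))
        \<le> ennreal E * (ennreal (C1 * exp (b * (real_of_int w)\<^sup>2 / real n1))
            + ennreal (C2 * exp (b * (real_of_int (z - w))\<^sup>2 / real n2)))"
        using d1 d2 wL by (intro mult_left_mono add_mono) auto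
      also have "\<dots> = ennreal (E * (C1 * exp (b * (real_of_int w)\<^sup>2 / real n1)
              + C2 * exp (b * (real_of_int (z - w))\<^sup>2 / real n2)))"
        using C by (simp add: E_def ennreal_mult ennreal_plus)
      finally show ?thesis unfolding E_def w_def .
    qed
    have "(\<integral>\<^sup>+ \<omega>. ennreal (exp (a * D z \<omega>)) \<partial>?M)
        = (\<integral>\<^sup>+ g. \<integral>\<^sup>+ p. ennreal (exp (a * D z (g, p))) \<partial>(M1 \<Otimes>\<^sub>M M2) \<partial>std_normal_distribution)"
      using Dm[of z] by (subst P.P.nn_integral_fst) auto
    also have "\<dots> \<le> (\<integral>\<^sup>+ g. ennreal (exp (a * \<bar>V z g - real_of_int (W' z g)\<bar>) * (C1 * exp (b * (real_of_int (W' z g))\<^sup>2 / real n1)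
              + C2 * exp (b * (real_of_int (z - W' z g))\<^sup>2 / real n2))) \<partial>std_normal_distribution)"
      by (intro nn_integral_mono inner)
    also have "\<dots> \<le> ennreal (C * exp (b * (real_of_int z)\<^sup>2 / real ?n))"
      using split z unfolding walk_splitting_def W'_def V_def by auto
    finally show ?thesis .
  qed
  have "bridge_coupling a b ?n C ?M B S D"
    unfolding bridge_coupling_def
    using bb pin Sm Dm S0 law bound int Q.prob_space_axioms by blast
  then show ?thesis by blast
qed

section \<open>Levy's construction of the Brownian bridge\<close>

text \<open>Schauder functions numbered as a binary heap: the root is the tent, and
  \<open>2 * i + 1\<close> and \<open>2 * i + 2\<close> are the copies of number \<open>i\<close> on
  the left and right half of the interval, scaled as in \<open>glue_bridge\<close> with
  \<open>\<theta> = 1 / 2\<close>. Their random series is thus reproduced by gluing at 1/2. This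
  numbering makes every property an induction on the index.\<close>

function schauder :: "nat \<Rightarrow> real \<Rightarrow> real" where
  "schauder n t = (if n = 0 then glue_hat (1 / 2) t
     else if odd n then (if t \<le> 1 / 2 then sqrt (1 / 2) * schauder ((n - 1) div 2) (2 * t) else 0)
     else (if t \<le> 1 / 2 then 0 else sqrt (1 / 2) * schauder ((n - 1) div 2) (2 * t - 1)))"
  by pat_completeness auto
termination by (relation "Wellfounded.measure fst") auto

declare schauder.simps [simp del]

lemma schauder_0: "schauder 0 t = glue_hat (1 / 2) t"
  by (subst schauder.simps) simp

lemma glue_hat_half: "glue_hat (1 / 2) t = min t (1 - t)"
proof -
  have "sqrt (1 / 2 * (1 - 1 / 2)) = (1 / 2 :: real)"
    using real_sqrt_unique[of "1 / 2" "1 / 2 * (1 - 1 / 2)"] by (simp add: power2_eq_square)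
  then have "glue_hat (1 / 2) t = 1 / 2 * (if t \<le> 1 / 2 then t / (1 / 2) else (1 - t) / (1 - 1 / 2))"
    unfolding glue_hat_def by (simp only:)
  then show ?thesis by (cases "t \<le> 1 / 2") (simp_all add: min_def)
qed

lemma schauder_odd: "schauder (2 * i + 1) t = (if t \<le> 1 / 2 then sqrt (1 / 2) * schauder i (2 * t) else 0)"
  by (subst schauder.simps) simp

lemma schauder_even: "schauder (2 * i + 2) t = (if t \<le> 1 / 2 then 0 else sqrt (1 / 2) * schauder i (2 * t - 1))"
  by (subst schauder.simps) simp

lemma heap_cases:
  fixes n :: nat
  obtains "n = 0" | i where "n = 2 * i + 1" "i < n" | i where "n = 2 * i + 2" "i < n"
proof -
  consider "n = 0" | m where "n = Suc m" "even m" | m where "n = Suc m" "odd m"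
    by (cases n) blast+
  then show ?thesis
  proof cases
    case 1 then show ?thesis by (rule that(1))
  next
    case (2 m)
    then obtain i where "m = 2 * i" by (elim evenE)
    then show ?thesis using 2 by (intro that(2)[of i]) simp_all
  next
    case (3 m)
    then obtain i where "m = 2 * i + 1" by (elim oddE)
    then show ?thesis using 3 by (intro that(3)[of i]) simp_all
  qed
qed

lemma schauder_nonneg: "t \<in> {0..1} \<Longrightarrow> schauder n t \<ge> 0"
proof (induction n arbitrary: t rule: less_induct)
  case (less n)
  show ?case
  proof (cases rule: heap_cases[of n])
    case 1 then show ?thesis using less.prems by (simp add: schauder_0 glue_hat_half)
  next
    case (2 i)
    then show ?thesis using less.IH[of i "2 * t"] less.prems by (simp only: schauder_odd) auto
  next
    case (3 i)
    then show ?thesis using less.IH[of i "2 * t - 1"] less.prems by (simp only: schauder_even) auto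
  qed
qed

lemma schauder_ends: "schauder n 0 = 0 \<and> schauder n 1 = 0"
proof (induction n rule: less_induct)
  case (less n)
  show ?case
  proof (cases rule: heap_cases[of n])
    case 1 then show ?thesis by (simp add: schauder_0 glue_hat_half)
  next
    case (2 i)
    then show ?thesis using less.IH[of i] by (simp only: schauder_odd) auto
  next
    case (3 i)
    then show ?thesis using less.IH[of i] by (simp only: schauder_even) auto
  qed
qed

lemma continuous_on_schauder: "continuous_on {0..1} (schauder n)"
proof (induction n rule: less_induct)
  case (less n)
  have mid: "schauder i (2 * t) = 0" "schauder i (2 * t - 1) = 0" if "t * 2 = 1" for i t
  proof -
    have t: "t = 1 / 2" using that by simp
    show "schauder i (2 * t) = 0" "schauder i (2 * t - 1) = 0" unfolding t using schauder_ends[of i] by simp_all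
  qed
  have un: "{0..1 / 2} \<union> {1 / 2..1} = {0..1::real}" by auto
  show ?case
  proof (cases rule: heap_cases[of n])
    case 1
    have "schauder n = (\<lambda>t. min t (1 - t))" using 1 by (auto simp: schauder_0 glue_hat_half)
    then show ?thesis by (auto intro!: continuous_intros)
  next
    case (2 i)
    have "continuous_on {0..1 / 2} (\<lambda>t. schauder i (2 * t))"
      by (rule continuous_on_compose2[OF less.IH[OF 2(2)]]) (auto intro!: continuous_intros)
    then have "continuous_on ({0..1 / 2} \<union> {1 / 2..1}) (\<lambda>t. if t \<le> 1 / 2 then sqrt (1 / 2) * schauder i (2 * t) else 0)"
      by (intro continuous_on_cases) (auto intro!: continuous_intros mid)
    moreover have "schauder n = (\<lambda>t. if t \<le> 1 / 2 then sqrt (1 / 2) * schauder i (2 * t) else 0)"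
      unfolding 2(1) by (simp only: schauder_odd fun_eq_iff) simp
    ultimately show ?thesis unfolding un by simp
  next
    case (3 i)
    have "continuous_on {1 / 2..1} (\<lambda>t. schauder i (2 * t - 1))"
      by (rule continuous_on_compose2[OF less.IH[OF 3(2)]]) (auto intro!: continuous_intros)
    then have "continuous_on ({0..1 / 2} \<union> {1 / 2..1}) (\<lambda>t. if t \<le> 1 / 2 then 0 else sqrt (1 / 2) * schauder i (2 * t - 1))"
      by (intro continuous_on_cases) (auto intro!: continuous_intros mid)
    moreover have "schauder n = (\<lambda>t. if t \<le> 1 / 2 then 0 else sqrt (1 / 2) * schauder i (2 * t - 1))"
      unfolding 3(1) by (simp only: schauder_even fun_eq_iff) simp
    ultimately show ?thesis unfolding un by simp
  qed
qed

text \<open>Root, left subtree and right subtree.\<close>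

lemma sum_heap:
  fixes f :: "nat \<Rightarrow> 'a :: comm_monoid_add"
  shows "(\<Sum>i<2 * N + 1. f i) = f 0 + (\<Sum>i<N. f (2 * i + 1)) + (\<Sum>i<N. f (2 * i + 2))"
proof (induction N)
  case (Suc N)
  have "(\<Sum>i<2 * Suc N + 1. f i) = (\<Sum>i<2 * N + 1. f i) + (f (2 * N + 1) + f (2 * N + 2))"
    by (simp add: ac_simps)
  then show ?case unfolding Suc by (simp add: ac_simps)
qed simp

text \<open>\<open>2 ^ k - 1\<close> counts the nodes of a complete binary tree with k
  levels.\<close>

lemma heap_depth_Suc: "2 ^ Suc k - 1 = 2 * (2 ^ k - 1) + (1::nat)"
proof -
  have "(1::nat) \<le> 2 ^ k" by simp
  then show ?thesis unfolding power_Suc by linarith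
qed

text \<open>The exponent \<open>1 / 4\<close> is small enough for \<open>3 powr (1 / 4) / sqrt 2 < 1\<close>: a child in the binary heap of indices has
  a weight at most \<open>3 powr (1 / 4)\<close> times that of its parent, and its function is scaled by \<open>1 / sqrt 2\<close>.\<close>
lemma schauder_weighted_sum_le:
  assumes "t \<in> {0..1}"
  shows "(\<Sum>i<N. (real i + 1) powr (1 / 4) * schauder i t) \<le> 16"
proof -
  define q where "q = (3::real) powr (1 / 4) * sqrt (1 / 2)"
  have q0: "q \<ge> 0" by (simp add: q_def)
  \<comment> \<open>The bound 16 is the fixed point of the recursion: the root contributes at most
    1/2, only one of the subtrees is active at \<open>t\<close>, and
    \<open>1 / 2 + 31 / 32 * 16 = 16\<close>.\<close>
  have q: "q \<le> 31 / 32"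
  proof -
    have "(3::real) powr (1 / 4) \<le> 4 / 3"
    proof -
      have "(3::real) powr (1 / 4) \<le> ((4 / 3) powr 4) powr (1 / 4)"
        by (intro powr_mono2) (simp_all add: power_divide)
      also have "\<dots> = 4 / 3" by (simp only: powr_powr) simp
      finally show ?thesis .
    qed
    moreover have "sqrt (1 / 2) \<le> (18 / 25 :: real)"
      by (rule real_le_lsqrt) (auto simp: power2_eq_square)
    ultimately have "q \<le> 4 / 3 * (18 / 25)"
      unfolding q_def by (intro mult_mono) auto
    then show ?thesis by simp
  qed
  have main: "(\<Sum>i<2 ^ k - 1. (real i + 1) powr (1 / 4) * schauder i t) \<le> 16" if "t \<in> {0..1}" for k t
    using that
  proof (induction k arbitrary: t)
    case (Suc k)
    define N where "N = (2::nat) ^ k - 1"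
    have N: "2 ^ Suc k - 1 = 2 * N + 1" unfolding N_def by (rule heap_depth_Suc)
    let ?f = "\<lambda>i. (real i + 1) powr (1 / 4) * schauder i t"
    have s0: "?f 0 \<le> 1 / 2" using Suc.prems by (simp add: schauder_0 glue_hat_half min_def)
    have child: "(\<Sum>i<N. (real (g i) + 1) powr (1 / 4) * (sqrt (1 / 2) * schauder i t')) \<le> 31 / 2"
      if t': "t' \<in> {0..1}" and g: "\<And>i. g i \<le> 2 * i + 2" for g t'
    proof -
      have "(\<Sum>i<N. (real (g i) + 1) powr (1 / 4) * (sqrt (1 / 2) * schauder i t'))
          \<le> (\<Sum>i<N. q * ((real i + 1) powr (1 / 4) * schauder i t'))"
      proof (rule sum_mono)
        fix i
        have "real (g i) \<le> real (2 * i + 2)" using g[of i] by (simp only: of_nat_le_iff)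
        then have "(real (g i) + 1) powr (1 / 4) \<le> (3 * (real i + 1)) powr (1 / 4)"
          by (intro powr_mono2) auto
        also have "\<dots> = 3 powr (1 / 4) * (real i + 1) powr (1 / 4)" by (subst powr_mult) auto
        finally have "(real (g i) + 1) powr (1 / 4) * (sqrt (1 / 2) * schauder i t')
            \<le> (3 powr (1 / 4) * (real i + 1) powr (1 / 4)) * (sqrt (1 / 2) * schauder i t')"
          using schauder_nonneg[OF t'] by (intro mult_right_mono) auto
        then show "(real (g i) + 1) powr (1 / 4) * (sqrt (1 / 2) * schauder i t')
            \<le> q * ((real i + 1) powr (1 / 4) * schauder i t')"
          by (simp only: q_def mult_ac)
      qed
      also have "\<dots> = q * (\<Sum>i<N. (real i + 1) powr (1 / 4) * schauder i t')"
        by (simp only: sum_distrib_left)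
      also have "\<dots> \<le> q * 16" using Suc.IH[OF t'] q0 unfolding N_def by (rule mult_left_mono)
      also have "\<dots> \<le> 31 / 32 * 16" using q by (rule mult_right_mono) simp
      finally show ?thesis by simp
    qed
    have "(\<Sum>i<N. ?f (2 * i + 1)) + (\<Sum>i<N. ?f (2 * i + 2)) \<le> 31 / 2"
    proof (cases "t \<le> 1 / 2")
      case True
      then show ?thesis using child[of "2 * t" "\<lambda>i. 2 * i + 1"] Suc.prems
        by (simp only: schauder_odd schauder_even if_True mult_zero_right sum.neutral_const) simp
    next
      case False
      then show ?thesis using child[of "2 * t - 1" "\<lambda>i. 2 * i + 2"] Suc.prems
        by (simp only: schauder_odd schauder_even if_False mult_zero_right sum.neutral_const) simp
    qed
    then show ?case unfolding N sum_heap using s0 by linarith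
  qed simp
  have "N \<le> 2 ^ N - 1" using less_exp[of N] by linarith
  then have "(\<Sum>i<N. (real i + 1) powr (1 / 4) * schauder i t) \<le> (\<Sum>i<2 ^ N - 1. (real i + 1) powr (1 / 4) * schauder i t)"
    using schauder_nonneg[OF assms] by (intro sum_mono2) auto
  also have "\<dots> \<le> 16" by (rule main[OF assms])
  finally show ?thesis .
qed

text \<open>By \<open>glue_cov\<close> at 1/2 the bridge covariance satisfies the same recursion as
  the kernel truncated to a complete tree. At most one half of the interval is active, with factor
  1/2, so each level halves the error.\<close>

lemma schauder_cov_error:
  assumes "s \<in> {0..1}" "t \<in> {0..1}"
  shows "\<bar>(\<Sum>i<2 ^ k - 1. schauder i s * schauder i t) - bridge_cov s t\<bar> \<le> (1 / 2) ^ k"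
  using assms
proof (induction k arbitrary: s t)
  case 0
  have "0 \<le> s * t" "s * t \<le> min s t"
    using 0 by (auto simp: min_def mult_left_le mult_left_le_one_le)
  then show ?case using 0 by (auto simp: bridge_cov_def)
next
  case (Suc k)
  define N where "N = (2::nat) ^ k - 1"
  have N: "2 ^ Suc k - 1 = 2 * N + 1" unfolding N_def by (rule heap_depth_Suc)
  define K where "K s t = (\<Sum>i<N. schauder i s * schauder i t)" for s t
  have rec: "(\<Sum>i<2 ^ Suc k - 1. schauder i s * schauder i t) = glue_hat (1 / 2) s * glue_hat (1 / 2) t
      + (if s \<le> 1 / 2 \<and> t \<le> 1 / 2 then 1 / 2 * K (2 * s) (2 * t) else 0)
      + (if \<not> s \<le> 1 / 2 \<and> \<not> t \<le> 1 / 2 then 1 / 2 * K (2 * s - 1) (2 * t - 1) else 0)"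
  proof -
    have sq: "sqrt (1 / 2) * x * (sqrt (1 / 2) * y) = 1 / 2 * (x * y)" for x y
    proof -
      have "sqrt (1 / 2) * x * (sqrt (1 / 2) * y) = (sqrt (1 / 2) * sqrt (1 / 2)) * (x * y)" by (simp only: mult_ac)
      then show ?thesis by simp
    qed
    have o: "(\<Sum>i<N. schauder (2 * i + 1) s * schauder (2 * i + 1) t) = (if s \<le> 1 / 2 \<and> t \<le> 1 / 2 then 1 / 2 * K (2 * s) (2 * t) else 0)"
    proof (cases "s \<le> 1 / 2 \<and> t \<le> 1 / 2")
      case True
      then have "schauder (2 * i + 1) s * schauder (2 * i + 1) t = 1 / 2 * (schauder i (2 * s) * schauder i (2 * t))" for i
        by (simp only: schauder_odd if_True sq simp_thms)
      then show ?thesis by (simp only: True if_True simp_thms K_def sum_distrib_left)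
    next
      case False
      then have "schauder (2 * i + 1) s * schauder (2 * i + 1) t = 0" for i
        by (simp only: schauder_odd mult_eq_0_iff) auto
      then show ?thesis by (simp only: False if_False sum.neutral_const)
    qed
    have e: "(\<Sum>i<N. schauder (2 * i + 2) s * schauder (2 * i + 2) t)
        = (if \<not> s \<le> 1 / 2 \<and> \<not> t \<le> 1 / 2 then 1 / 2 * K (2 * s - 1) (2 * t - 1) else 0)"
    proof (cases "\<not> s \<le> 1 / 2 \<and> \<not> t \<le> 1 / 2")
      case True
      then have "schauder (2 * i + 2) s * schauder (2 * i + 2) t = 1 / 2 * (schauder i (2 * s - 1) * schauder i (2 * t - 1))" for i
        by (simp only: schauder_even if_False sq simp_thms)
      then show ?thesis by (simp only: True if_True simp_thms K_def sum_distrib_left)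
    next
      case False
      then have "schauder (2 * i + 2) s * schauder (2 * i + 2) t = 0" for i
        by (simp only: schauder_even mult_eq_0_iff) auto
      then show ?thesis by (simp only: False if_False sum.neutral_const)
    qed
    show ?thesis unfolding N sum_heap o e by (simp only: schauder_0)
  qed
  have cov: "bridge_cov s t = glue_hat (1 / 2) s * glue_hat (1 / 2) t
      + (if s \<le> 1 / 2 \<and> t \<le> 1 / 2 then 1 / 2 * bridge_cov (2 * s) (2 * t) else 0)
      + (if \<not> s \<le> 1 / 2 \<and> \<not> t \<le> 1 / 2 then 1 / 2 * bridge_cov (2 * s - 1) (2 * t - 1) else 0)"
  proof -
    have e: "x / (1 / 2) = 2 * x" "(x - 1 / 2) / (1 - 1 / 2) = 2 * x - 1" "1 - 1 / 2 = (1 / 2 :: real)" for x :: real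
      by (simp_all add: field_simps)
    have "0 < (1 / 2 :: real)" "1 / 2 < (1 :: real)" by simp_all
    from glue_cov[OF this, of s t] show ?thesis unfolding e(1) e(2) unfolding e(3) by linarith
  qed
  have half: "\<bar>A + 1 / 2 * x - (A + 1 / 2 * y)\<bar> \<le> (1 / 2) ^ Suc k" if "\<bar>x - y\<bar> \<le> (1 / 2) ^ k" for A x y :: real
  proof -
    have "A + 1 / 2 * x - (A + 1 / 2 * y) = 1 / 2 * (x - y)" by (simp add: algebra_simps)
    then show ?thesis using that by (simp only: abs_mult) simp
  qed
  consider "s \<le> 1 / 2" "t \<le> 1 / 2" | "\<not> s \<le> 1 / 2" "\<not> t \<le> 1 / 2" | "s \<le> 1 / 2 \<longleftrightarrow> \<not> t \<le> 1 / 2" by blast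
  then show ?case
  proof cases
    case 1
    then have "\<bar>K (2 * s) (2 * t) - bridge_cov (2 * s) (2 * t)\<bar> \<le> (1 / 2) ^ k"
      using Suc.IH[of "2 * s" "2 * t"] Suc.prems unfolding K_def N_def by auto
    from half[OF this] show ?thesis unfolding rec cov using 1 by (simp only: simp_thms if_True if_False add_0_right)
  next
    case 2
    then have "\<bar>K (2 * s - 1) (2 * t - 1) - bridge_cov (2 * s - 1) (2 * t - 1)\<bar> \<le> (1 / 2) ^ k"
      using Suc.IH[of "2 * s - 1" "2 * t - 1"] Suc.prems unfolding K_def N_def by auto
    from half[OF this] show ?thesis unfolding rec cov using 2 by (simp only: simp_thms if_True if_False add_0_right)
  next
    \<comment> \<open>For points in different halves both sides reduce to the root term, and the
      error is 0.\<close>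
    case 3
    then show ?thesis unfolding rec cov by auto
  qed
qed

section \<open>Independent normal coordinates and their growth\<close>

abbreviation gauss_seq :: "(nat \<Rightarrow> real) measure" where
  "gauss_seq \<equiv> PiM UNIV (\<lambda>_. std_normal_distribution)"

interpretation gauss_seq: product_prob_space "\<lambda>_. std_normal_distribution" "UNIV :: nat set"
  by (intro product_prob_spaceI std_normal.prob_space_axioms)

text \<open>Only finitely many coordinates enter, so the integral is moved to a finite product
  space, where it factorises.\<close>

lemma gauss_seq_char:
  "(\<integral>\<omega>. cis (\<Sum>i<N. \<mu> i * \<omega> i) \<partial>gauss_seq) = complex_of_real (exp (- (\<Sum>i<N. (\<mu> i)\<^sup>2) / 2))"
proof -
  have cis_sum: "cis (\<Sum>i<N. \<mu> i * \<omega> i) = (\<Prod>i<N. cis (\<mu> i * \<omega> i))" for \<omega>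
    by (induction N) (simp_all add: cis_mult[symmetric])
  have cm: "(\<lambda>x. cis (\<mu> i * x)) \<in> borel_measurable borel" for i
    by (intro borel_measurable_continuous_onI continuous_on_cis continuous_intros)
  have comp: "(\<lambda>\<omega>. \<omega> i) \<in> borel_measurable (PiM {..<N} (\<lambda>_. std_normal_distribution))" if "i \<in> {..<N}" for i
    using measurable_component_singleton[OF that, of "\<lambda>_. std_normal_distribution"] by simp
  have "(\<integral>\<omega>. cis (\<Sum>i<N. \<mu> i * \<omega> i) \<partial>gauss_seq) = (\<integral>\<omega>. (\<Prod>i<N. cis (\<mu> i * restrict \<omega> {..<N} i)) \<partial>gauss_seq)"
    unfolding cis_sum by (intro Bochner_Integration.integral_cong prod.cong) auto
  also have "\<dots> = (\<integral>\<omega>. (\<Prod>i<N. cis (\<mu> i * \<omega> i))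
      \<partial>distr gauss_seq (PiM {..<N} (\<lambda>_. std_normal_distribution)) (\<lambda>\<omega>. restrict \<omega> {..<N}))"
  proof (rule integral_distr[symmetric])
    show "(\<lambda>\<omega>. \<Prod>i<N. cis (\<mu> i * \<omega> i)) \<in> borel_measurable (PiM {..<N} (\<lambda>_. std_normal_distribution))"
      by (intro borel_measurable_prod measurable_compose[OF comp cm])
  qed (rule measurable_restrict_subset, simp)
  also have "distr gauss_seq (PiM {..<N} (\<lambda>_. std_normal_distribution)) (\<lambda>\<omega>. restrict \<omega> {..<N})
      = PiM {..<N} (\<lambda>_. std_normal_distribution)"
    by (rule gauss_seq.distr_PiM_restrict_finite) auto
  also have "(\<integral>\<omega>. (\<Prod>i<N. cis (\<mu> i * \<omega> i)) \<partial>PiM {..<N} (\<lambda>_. std_normal_distribution))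
      = (\<Prod>i<N. \<integral>x. cis (\<mu> i * x) \<partial>std_normal_distribution)"
  proof (rule gauss_seq.product_integral_prod)
    show "integrable std_normal_distribution (\<lambda>x. cis (\<mu> i * x))" for i
      by (rule std_normal.integrable_const_bound[where B = 1]) (use cm in auto)
  qed simp
  also have "\<dots> = complex_of_real (exp (- (\<Sum>i<N. (\<mu> i)\<^sup>2) / 2))"
    unfolding std_normal_char
    by (induction N) (simp_all add: exp_add[symmetric] of_real_mult[symmetric] add_divide_distrib diff_divide_distrib del: of_real_mult)
  finally show ?thesis .
qed

text \<open>Finiteness of this sum replaces the Borel--Cantelli lemma: it gives logarithmic growth of the coordinates with an
  exponentially integrable constant.\<close>
definition exp_bound :: "(nat \<Rightarrow> real) \<Rightarrow> ennreal" where
  "exp_bound \<omega> = (\<Sum>i. ennreal (exp \<bar>\<omega> i\<bar> / (real i + 1)\<^sup>2))"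

lemma exp_bound_measurable [measurable]: "exp_bound \<in> borel_measurable gauss_seq"
proof -
  have [measurable]: "(\<lambda>\<omega>. \<omega> i) \<in> borel_measurable gauss_seq" for i
    using measurable_component_singleton[of i UNIV "\<lambda>_. std_normal_distribution"] by simp
  show ?thesis unfolding exp_bound_def by measurable
qed

text \<open>All coordinates have the same law with a finite exponential moment, so the terms are
  dominated by a multiple of the summable \<open>1 / (i + 1)\<^sup>2\<close>.\<close>

lemma exp_bound_integral: "(\<integral>\<^sup>+ \<omega>. exp_bound \<omega> \<partial>gauss_seq) < \<infinity>"
proof -
  have [measurable]: "(\<lambda>\<omega>. \<omega> i) \<in> borel_measurable gauss_seq" for i
    using measurable_component_singleton[of i UNIV "\<lambda>_. std_normal_distribution"] by simp
  define c where "c = exp 1 * sqrt (2::real)"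
  have abs_le: "\<bar>g\<bar> \<le> 1 + g\<^sup>2 / 4" for g :: real
  proof -
    have "0 \<le> (\<bar>g\<bar> / 2 - 1)\<^sup>2" by simp
    then show ?thesis by (simp add: power2_diff power_divide)
  qed
  have coord: "(\<integral>\<^sup>+ \<omega>. ennreal (exp \<bar>\<omega> i\<bar> / (real i + 1)\<^sup>2) \<partial>gauss_seq) \<le> ennreal (c * (1 / (real i + 1)\<^sup>2))" for i
  proof -
    have "(\<integral>\<^sup>+ \<omega>. ennreal (exp \<bar>\<omega> i\<bar> / (real i + 1)\<^sup>2) \<partial>gauss_seq)
      = (\<integral>\<^sup>+ x. ennreal (exp \<bar>x\<bar> / (real i + 1)\<^sup>2) \<partial>distr gauss_seq std_normal_distribution (\<lambda>\<omega>. \<omega> i))"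
      by (subst nn_integral_distr) auto
    also have "distr gauss_seq std_normal_distribution (\<lambda>\<omega>. \<omega> i) = std_normal_distribution"
      by (rule gauss_seq.PiM_component) simp
    also have "(\<integral>\<^sup>+ x. ennreal (exp \<bar>x\<bar> / (real i + 1)\<^sup>2) \<partial>std_normal_distribution)
      \<le> ennreal ((exp 1 / (real i + 1)\<^sup>2) * sqrt 2)"
    proof (rule nn_integral_std_normal_bound)
      fix g :: real
      have "exp \<bar>g\<bar> \<le> exp 1 * exp (g\<^sup>2 / 4)" using abs_le[of g] by (simp add: exp_add[symmetric])
      then show "exp \<bar>g\<bar> / (real i + 1)\<^sup>2 \<le> exp 1 / (real i + 1)\<^sup>2 * exp (g\<^sup>2 / 4)"
        by (simp add: divide_right_mono)
    qed simp
    finally show ?thesis by (simp add: c_def)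
  qed
  have summ: "summable (\<lambda>i. c * (1 / (real i + 1)\<^sup>2))"
  proof (rule summable_mult)
    have "summable (\<lambda>i. 1 / (real i)\<^sup>2)"
      using inverse_power_summable[of 2, where 'a = real] by (simp add: inverse_eq_divide)
    then have "summable (\<lambda>i. 1 / (real (Suc i))\<^sup>2)"
      by (subst summable_Suc_iff)
    then show "summable (\<lambda>i. 1 / (real i + 1)\<^sup>2)" by (simp add: add.commute)
  qed
  have "(\<integral>\<^sup>+ \<omega>. exp_bound \<omega> \<partial>gauss_seq) = (\<Sum>i. \<integral>\<^sup>+ \<omega>. ennreal (exp \<bar>\<omega> i\<bar> / (real i + 1)\<^sup>2) \<partial>gauss_seq)"
    unfolding exp_bound_def by (rule nn_integral_suminf) measurable
  also have "\<dots> \<le> (\<Sum>i. ennreal (c * (1 / (real i + 1)\<^sup>2)))"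
    by (intro suminf_le coord) auto
  also have "\<dots> = ennreal (\<Sum>i. c * (1 / (real i + 1)\<^sup>2))"
    by (rule suminf_ennreal2[OF _ summ]) (simp add: c_def)
  also have "\<dots> < \<infinity>" by simp
  finally show ?thesis .
qed

text \<open>Each term is at most the whole sum; taking logarithms leaves
  \<open>2 * ln (i + 1)\<close>, and \<open>ln x \<le> 8 * x powr (1 / 8)\<close> produces the 16.
  The power 1/8 is half of the 1/4 available in \<open>schauder_weighted_sum_le\<close>, so a
  decaying factor is left over for the tails of the series.\<close>

lemma gauss_coordinate_bound:
  assumes "exp_bound \<omega> < \<infinity>"
  shows "1 \<le> enn2real (exp_bound \<omega>)"
    and "\<bar>\<omega> i\<bar> \<le> (ln (enn2real (exp_bound \<omega>)) + 16) * (real i + 1) powr (1 / 8)"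
proof -
  define q where "q = enn2real (exp_bound \<omega>)"
  have q: "exp_bound \<omega> = ennreal q" "q \<ge> 0" using assms by (simp_all add: q_def)
  have le: "exp \<bar>\<omega> i\<bar> / (real i + 1)\<^sup>2 \<le> q" for i
  proof -
    have "(\<Sum>j\<in>{i}. ennreal (exp \<bar>\<omega> j\<bar> / (real j + 1)\<^sup>2)) \<le> exp_bound \<omega>"
      unfolding exp_bound_def by (rule sum_le_suminf) auto
    then show ?thesis using q by simp
  qed
  have "1 \<le> exp \<bar>\<omega> 0\<bar>" by simp
  also have "\<dots> \<le> q" using le[of 0] by simp
  finally show 1: "1 \<le> enn2real (exp_bound \<omega>)" by (simp only: q_def)
  have x: "real i + 1 \<ge> 1" by simp
  have "exp \<bar>\<omega> i\<bar> \<le> q * (real i + 1)\<^sup>2" using le[of i] by (simp add: divide_le_eq)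
  then have "\<bar>\<omega> i\<bar> \<le> ln (q * (real i + 1)\<^sup>2)"
    using 1 unfolding q_def[symmetric] by (subst ln_ge_iff) auto
  also have "\<dots> = ln q + 2 * ln (real i + 1)"
    using 1 unfolding q_def[symmetric] by (subst ln_mult) (auto simp: ln_realpow)
  also have "ln (real i + 1) \<le> (real i + 1) powr (1 / 8) / (1 / 8)"
    by (rule ln_powr_bound) auto
  finally have "\<bar>\<omega> i\<bar> \<le> ln q + 16 * (real i + 1) powr (1 / 8)" by simp
  moreover have "ln q * 1 \<le> ln q * (real i + 1) powr (1 / 8)"
    using 1 unfolding q_def[symmetric] by (intro mult_left_mono ge_one_powr_ge_zero) auto
  ultimately show "\<bar>\<omega> i\<bar> \<le> (ln (enn2real (exp_bound \<omega>)) + 16) * (real i + 1) powr (1 / 8)"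
    unfolding q_def[symmetric] by (simp add: distrib_right)
qed


section \<open>Convergence and law of Levy's series\<close>

definition levy_regular :: "(nat \<Rightarrow> real) \<Rightarrow> bool" where
  "levy_regular \<omega> \<longleftrightarrow> exp_bound \<omega> < \<infinity>"

definition levy_radius :: "(nat \<Rightarrow> real) \<Rightarrow> real" where
  "levy_radius \<omega> = ln (enn2real (exp_bound \<omega>)) + 16"

text \<open>The value 0 off the almost sure event makes continuity, pinning and the bound by
  \<open>levy_radius\<close> hold for every sample point.\<close>

definition levy_bridge :: "real \<Rightarrow> (nat \<Rightarrow> real) \<Rightarrow> real" where
  "levy_bridge t \<omega> = (if levy_regular \<omega> then (\<Sum>i. \<omega> i * schauder i t) else 0)"

text \<open>Where \<open>exp_bound\<close> is infinite, \<open>enn2real\<close> returns 0 and so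
  does \<open>ln\<close> of it; the radius there is 16.\<close>

lemma levy_radius_nonneg: "levy_radius \<omega> \<ge> 0"
proof (cases "levy_regular \<omega>")
  case True
  then show ?thesis using gauss_coordinate_bound(1)[of \<omega>] by (simp add: levy_regular_def levy_radius_def)
next
  case False
  then show ?thesis by (simp add: levy_regular_def levy_radius_def not_less top.extremum_unique)
qed

text \<open>The growth rate \<open>(i + 1) powr (1 / 8)\<close> is split as
  \<open>(i + 1) powr (- (1 / 8))\<close> times the weight \<open>(i + 1) powr (1 / 4)\<close>. The
  first factor is largest at the start \<open>n\<close> of the block, the second is summed by
  \<open>schauder_weighted_sum_le\<close>. Being uniform in \<open>t\<close>, this gives
  convergence, continuity and the bound on the supremum at once.\<close>

lemma levy_shifted_sum_le:
  assumes g: "levy_regular \<omega>" and t: "t \<in> {0..1}"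
  shows "(\<Sum>i<k. \<bar>\<omega> (i + n)\<bar> * schauder (i + n) t) \<le> 16 * levy_radius \<omega> * (real n + 1) powr (- (1 / 8))"
proof -
  have "(\<Sum>i<k. \<bar>\<omega> (i + n)\<bar> * schauder (i + n) t)
      \<le> (\<Sum>i<k. levy_radius \<omega> * (real n + 1) powr (- (1 / 8)) * ((real (i + n) + 1) powr (1 / 4) * schauder (i + n) t))"
  proof (rule sum_mono)
    fix i
    have "\<bar>\<omega> (i + n)\<bar> \<le> levy_radius \<omega> * (real (i + n) + 1) powr (1 / 8)"
      using gauss_coordinate_bound(2)[of \<omega> "i + n"] g unfolding levy_regular_def levy_radius_def by blast
    also have "(real (i + n) + 1) powr (1 / 8) = (real (i + n) + 1) powr (- (1 / 8)) * (real (i + n) + 1) powr (1 / 4)"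
      by (simp add: powr_add[symmetric])
    also have "levy_radius \<omega> * \<dots> \<le> levy_radius \<omega> * ((real n + 1) powr (- (1 / 8)) * (real (i + n) + 1) powr (1 / 4))"
      using levy_radius_nonneg by (intro mult_left_mono mult_right_mono powr_mono2') auto
    finally have "\<bar>\<omega> (i + n)\<bar> * schauder (i + n) t
      \<le> (levy_radius \<omega> * ((real n + 1) powr (- (1 / 8)) * (real (i + n) + 1) powr (1 / 4))) * schauder (i + n) t"
      using schauder_nonneg[OF t] by (intro mult_right_mono) auto
    then show "\<bar>\<omega> (i + n)\<bar> * schauder (i + n) t
      \<le> levy_radius \<omega> * (real n + 1) powr (- (1 / 8)) * ((real (i + n) + 1) powr (1 / 4) * schauder (i + n) t)"
      by (simp only: mult.assoc)
  qed
  also have "\<dots> = levy_radius \<omega> * (real n + 1) powr (- (1 / 8)) * (\<Sum>i<k. (real (i + n) + 1) powr (1 / 4) * schauder (i + n) t)"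
    by (simp only: sum_distrib_left)
  also have "\<dots> \<le> levy_radius \<omega> * (real n + 1) powr (- (1 / 8)) * 16"
  proof (rule mult_left_mono)
    have "(\<Sum>i<k. (real (i + n) + 1) powr (1 / 4) * schauder (i + n) t)
        = (\<Sum>i\<in>{n..<k + n}. (real i + 1) powr (1 / 4) * schauder i t)"
      by (rule sum.reindex_bij_witness[where i = "\<lambda>i. i - n" and j = "\<lambda>i. i + n"]) auto
    also have "\<dots> \<le> (\<Sum>i<k + n. (real i + 1) powr (1 / 4) * schauder i t)"
      using schauder_nonneg[OF t] by (intro sum_mono2) auto
    also have "\<dots> \<le> 16" by (rule schauder_weighted_sum_le[OF t])
    finally show "(\<Sum>i<k. (real (i + n) + 1) powr (1 / 4) * schauder (i + n) t) \<le> 16" .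
  qed (simp add: levy_radius_nonneg)
  finally show ?thesis by (simp only: mult_ac)
qed

lemma levy_summable:
  assumes "levy_regular \<omega>" "t \<in> {0..1}"
  shows "summable (\<lambda>i. \<bar>\<omega> i * schauder i t\<bar>)"
proof (rule summableI_nonneg_bounded[where x = "16 * levy_radius \<omega> * (real 0 + 1) powr (- (1 / 8))"])
  show "(\<Sum>i<k. \<bar>\<omega> i * schauder i t\<bar>) \<le> 16 * levy_radius \<omega> * (real 0 + 1) powr (- (1 / 8))" for k
    using levy_shifted_sum_le[OF assms, where k = k and n = 0] schauder_nonneg[OF assms(2)] by (simp add: abs_mult)
qed simp

lemma levy_partial_sum_error:
  assumes "levy_regular \<omega>" "t \<in> {0..1}"
  shows "\<bar>levy_bridge t \<omega> - (\<Sum>i<n. \<omega> i * schauder i t)\<bar> \<le> 16 * levy_radius \<omega> * (real n + 1) powr (- (1 / 8))"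
proof -
  note s = levy_summable[OF assms]
  have s': "summable (\<lambda>i. \<omega> i * schauder i t)" by (rule summable_rabs_cancel[OF s])
  have sn: "summable (\<lambda>i. \<bar>\<omega> (i + n) * schauder (i + n) t\<bar>)"
    by (rule summable_ignore_initial_segment[OF s])
  have "levy_bridge t \<omega> - (\<Sum>i<n. \<omega> i * schauder i t) = (\<Sum>i. \<omega> (i + n) * schauder (i + n) t)"
    using suminf_split_initial_segment[OF s', of n] assms(1) by (simp add: levy_bridge_def)
  also have "\<bar>\<dots>\<bar> \<le> (\<Sum>i. \<bar>\<omega> (i + n) * schauder (i + n) t\<bar>)"
    by (rule summable_rabs[OF sn])
  also have "\<dots> \<le> 16 * levy_radius \<omega> * (real n + 1) powr (- (1 / 8))"
    using levy_shifted_sum_le[OF assms, where n = n] schauder_nonneg[OF assms(2)]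
    by (intro suminf_le_const[OF sn]) (simp add: abs_mult)
  finally show ?thesis .
qed

lemma powr_neg_tendsto_0: "(\<lambda>n. c * (real n + 1) powr (- (1 / 8))) \<longlonglongrightarrow> 0"
proof -
  have "filterlim (\<lambda>n. 1 + real n) at_top sequentially"
    by (rule filterlim_tendsto_add_at_top[OF tendsto_const filterlim_real_sequentially])
  then have "filterlim (\<lambda>n. real n + 1) at_top sequentially" by (simp only: add.commute)
  then have "(\<lambda>n. (real n + 1) powr (- (1 / 8))) \<longlonglongrightarrow> 0"
    by (rule tendsto_neg_powr[rotated]) simp
  then show ?thesis using tendsto_mult_right_zero by blast
qed

lemma levy_tendsto:
  assumes "levy_regular \<omega>" "t \<in> {0..1}"
  shows "(\<lambda>n. \<Sum>i<n. \<omega> i * schauder i t) \<longlonglongrightarrow> levy_bridge t \<omega>"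
  using summable_LIMSEQ[OF summable_rabs_cancel[OF levy_summable[OF assms]]] assms(1)
  by (simp add: levy_bridge_def)

lemma levy_continuous: "continuous_on {0..1} (\<lambda>t. levy_bridge t \<omega>)"
proof (cases "levy_regular \<omega>")
  case True
  have "uniform_limit {0..1} (\<lambda>n t. \<Sum>i<n. \<omega> i * schauder i t) (\<lambda>t. levy_bridge t \<omega>) sequentially"
  proof (rule uniform_limitI)
    fix e :: real assume "e > 0"
    have "eventually (\<lambda>n. 16 * levy_radius \<omega> * (real n + 1) powr (- (1 / 8)) < e) sequentially"
      by (rule order_tendstoD(2)[OF powr_neg_tendsto_0 \<open>e > 0\<close>])
    then show "\<forall>\<^sub>F n in sequentially. \<forall>t\<in>{0..1}. dist (\<Sum>i<n. \<omega> i * schauder i t) (levy_bridge t \<omega>) < e"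
    proof eventually_elim
      case (elim n)
      show ?case
      proof
        fix t :: real assume "t \<in> {0..1}"
        from le_less_trans[OF levy_partial_sum_error[OF True this, of n] elim]
        show "dist (\<Sum>i<n. \<omega> i * schauder i t) (levy_bridge t \<omega>) < e"
          by (simp add: dist_real_def abs_minus_commute)
      qed
    qed
  qed
  then show ?thesis
    by (rule uniform_limit_theorem[rotated])
      (auto intro!: always_eventually continuous_intros continuous_on_schauder)
next
  case False
  then show ?thesis by (simp add: levy_bridge_def)
qed

lemma levy_bound:
  assumes "t \<in> {0..1}" shows "\<bar>levy_bridge t \<omega>\<bar> \<le> 16 * levy_radius \<omega>"
proof (cases "levy_regular \<omega>")
  case True
  then show ?thesis using levy_partial_sum_error[OF True assms, of 0] by simp
next
  case False
  then show ?thesis using levy_radius_nonneg by (simp add: levy_bridge_def)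
qed

text \<open>Partial sums over complete trees are Gaussian with an explicit quadratic form. Dominated
  convergence passes to the limit on the side of the integrals, and
  \<open>schauder_cov_error\<close> on the side of the covariances.\<close>

lemma levy_brownian_bridge: "brownian_bridge gauss_seq levy_bridge"
  unfolding brownian_bridge_def
proof (intro conjI ballI allI impI)
  have coord [measurable]: "(\<lambda>\<omega>. \<omega> i) \<in> borel_measurable gauss_seq" for i
    using measurable_component_singleton[of i UNIV "\<lambda>_. std_normal_distribution"] by simp
  have levy_regular_m [measurable]: "Measurable.pred gauss_seq levy_regular"
    unfolding levy_regular_def by measurable
  have meas [measurable]: "levy_bridge t \<in> borel_measurable gauss_seq" for t
    unfolding levy_bridge_def by measurable
  show "levy_bridge t \<in> borel_measurable gauss_seq" for t by (rule meas)
  show "continuous_on {0..1} (\<lambda>t. levy_bridge t \<omega>)" for \<omega> by (rule levy_continuous)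
  have ae: "AE \<omega> in gauss_seq. levy_regular \<omega>"
    using nn_integral_noteq_infinite[OF exp_bound_measurable] exp_bound_integral
    by (auto simp: levy_regular_def less_top[symmetric])
  fix k :: nat and ts lam :: "nat \<Rightarrow> real"
  assume ts: "\<forall>j<k. ts j \<in> {0..1}"
  define P where "P d \<omega> = (\<Sum>j<k. lam j * (\<Sum>i<2 ^ d - 1. \<omega> i * schauder i (ts j)))" for d :: nat and \<omega>
  define c where "c i = (\<Sum>j<k. lam j * schauder i (ts j))" for i
  have P_eq: "P d \<omega> = (\<Sum>i<2 ^ d - 1. c i * \<omega> i)" for d \<omega>
    unfolding P_def c_def sum_distrib_left sum_distrib_right
    by (subst sum.swap) (intro sum.cong refl, simp add: mult_ac)
  have cis_meas: "(\<lambda>x. cis (F x)) \<in> borel_measurable gauss_seq" if "F \<in> borel_measurable gauss_seq" for F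
    using that by (rule measurable_compose) (intro borel_measurable_continuous_onI continuous_on_cis continuous_on_id)
  have lim1: "(\<lambda>d. \<integral>\<omega>. cis (P d \<omega>) \<partial>gauss_seq) \<longlonglongrightarrow> (\<integral>\<omega>. cis (\<Sum>j<k. lam j * levy_bridge (ts j) \<omega>) \<partial>gauss_seq)"
  proof (rule integral_dominated_convergence[where w = "\<lambda>_. 1"])
    show "(\<lambda>\<omega>. cis (\<Sum>j<k. lam j * levy_bridge (ts j) \<omega>)) \<in> borel_measurable gauss_seq"
      by (intro cis_meas) measurable
    show "(\<lambda>\<omega>. cis (P d \<omega>)) \<in> borel_measurable gauss_seq" for d
      unfolding P_def by (intro cis_meas) measurable
    \<comment> \<open>The covariance estimate is only available for complete trees, so the limit is
      taken along their sizes.\<close>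
    have depth: "filterlim (\<lambda>d. 2 ^ d - 1 :: nat) sequentially sequentially"
      unfolding filterlim_at_top
    proof
      fix Z :: nat
      have "Z \<le> 2 ^ d - 1" if "Z \<le> d" for d using that less_exp[of d] by linarith
      then show "\<forall>\<^sub>F d in sequentially. Z \<le> 2 ^ d - 1" by (rule eventually_sequentiallyI)
    qed
    show "AE \<omega> in gauss_seq. (\<lambda>d. cis (P d \<omega>)) \<longlonglongrightarrow> cis (\<Sum>j<k. lam j * levy_bridge (ts j) \<omega>)"
      using ae
    proof eventually_elim
      case (elim \<omega>)
      have "(\<lambda>d. P d \<omega>) \<longlonglongrightarrow> (\<Sum>j<k. lam j * levy_bridge (ts j) \<omega>)"
        unfolding P_def using elim ts
        by (intro tendsto_sum tendsto_mult tendsto_const filterlim_compose[OF levy_tendsto depth]) auto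
      moreover have "isCont cis x" for x by (rule continuous_on_interior[of UNIV]) (auto intro: continuous_on_cis continuous_on_id)
      ultimately show ?case by (rule isCont_tendsto_compose[rotated])
    qed
  qed auto
  have sq: "(\<Sum>i<N. (c i)\<^sup>2) = (\<Sum>a<k. \<Sum>b<k. lam a * lam b * (\<Sum>i<N. schauder i (ts a) * schauder i (ts b)))" for N
  proof -
    have "(\<Sum>i<N. (c i)\<^sup>2) = (\<Sum>i<N. \<Sum>a<k. \<Sum>b<k. lam a * lam b * (schauder i (ts a) * schauder i (ts b)))"
      unfolding c_def power2_eq_square sum_product by (intro sum.cong refl) (simp add: mult_ac)
    also have "\<dots> = (\<Sum>a<k. \<Sum>i<N. \<Sum>b<k. lam a * lam b * (schauder i (ts a) * schauder i (ts b)))"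
      by (rule sum.swap)
    also have "\<dots> = (\<Sum>a<k. \<Sum>b<k. \<Sum>i<N. lam a * lam b * (schauder i (ts a) * schauder i (ts b)))"
      by (intro sum.cong refl sum.swap)
    finally show ?thesis by (simp only: sum_distrib_left)
  qed
  have cov_lim: "(\<lambda>d. \<Sum>i<2 ^ d - 1. schauder i s * schauder i t) \<longlonglongrightarrow> bridge_cov s t"
    if "s \<in> {0..1}" "t \<in> {0..1}" for s t
  proof (rule LIM_zero_cancel, rule Lim_null_comparison)
    show "\<forall>\<^sub>F d in sequentially. norm ((\<Sum>i<2 ^ d - 1. schauder i s * schauder i t) - bridge_cov s t) \<le> (1 / 2) ^ d"
      using schauder_cov_error[OF that] by simp
    show "(\<lambda>d. (1 / 2) ^ d :: real) \<longlonglongrightarrow> 0" by (rule LIMSEQ_realpow_zero) auto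
  qed
  have "(\<lambda>d. \<Sum>i<2 ^ d - 1. (c i)\<^sup>2) \<longlonglongrightarrow> (\<Sum>a<k. \<Sum>b<k. lam a * lam b * bridge_cov (ts a) (ts b))"
    unfolding sq using ts by (intro tendsto_sum tendsto_mult tendsto_const cov_lim) auto
  then have "(\<lambda>d. complex_of_real (exp (- (\<Sum>i<2 ^ d - 1. (c i)\<^sup>2) / 2)))
      \<longlonglongrightarrow> complex_of_real (exp (- (\<Sum>a<k. \<Sum>b<k. lam a * lam b * bridge_cov (ts a) (ts b)) / 2))"
    by (intro tendsto_intros) auto
  moreover have "(\<integral>\<omega>. cis (P d \<omega>) \<partial>gauss_seq) = complex_of_real (exp (- (\<Sum>i<2 ^ d - 1. (c i)\<^sup>2) / 2))" for d
    unfolding P_eq by (rule gauss_seq_char)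
  ultimately show "(\<integral>\<omega>. cis (\<Sum>j<k. lam j * levy_bridge (ts j) \<omega>) \<partial>gauss_seq) =
      complex_of_real (exp (- (\<Sum>i<k. \<Sum>j<k. lam i * lam j * (min (ts i) (ts j) - ts i * ts j)) / 2))"
    using lim1 LIMSEQ_unique unfolding bridge_cov_def by simp
qed

lemma levy_radius_measurable [measurable]: "levy_radius \<in> borel_measurable gauss_seq"
  unfolding levy_radius_def by measurable

text \<open>The radius is a logarithm, so on the regular event its exponential is
  \<open>exp 16\<close> times \<open>exp_bound\<close>, whose integral is finite.\<close>

lemma levy_radius_integral:
  "(\<integral>\<^sup>+ \<omega>. ennreal (exp (levy_radius \<omega>)) \<partial>gauss_seq) < \<infinity>"
proof -
  have "(\<integral>\<^sup>+ \<omega>. ennreal (exp (levy_radius \<omega>)) \<partial>gauss_seq) \<le> (\<integral>\<^sup>+ \<omega>. ennreal (exp 16) * exp_bound \<omega> \<partial>gauss_seq)"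
  proof (rule nn_integral_mono)
    fix \<omega>
    show "ennreal (exp (levy_radius \<omega>)) \<le> ennreal (exp 16) * exp_bound \<omega>"
    proof (cases "levy_regular \<omega>")
      case True
      then have fin: "exp_bound \<omega> = ennreal (enn2real (exp_bound \<omega>))" by (simp add: levy_regular_def)
      have "1 \<le> enn2real (exp_bound \<omega>)" using True gauss_coordinate_bound(1) by (simp add: levy_regular_def)
      then have "exp (levy_radius \<omega>) = exp 16 * enn2real (exp_bound \<omega>)"
        by (simp add: levy_radius_def exp_add)
      then show ?thesis by (subst fin) (simp add: ennreal_mult[symmetric])
    next
      case False
      then show ?thesis by (simp add: levy_regular_def not_less top.extremum_unique ennreal_mult_top)
    qed
  qed
  also have "\<dots> = ennreal (exp 16) * (\<integral>\<^sup>+ \<omega>. exp_bound \<omega> \<partial>gauss_seq)"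
    by (rule nn_integral_cmult) measurable
  also have "\<dots> < \<infinity>" using exp_bound_integral by (simp add: ennreal_mult_less_top)
  finally show ?thesis .
qed

section \<open>Couplings for all lengths\<close>

lemma brownian_bridge_embed:
  assumes h: "inj h" and B: "brownian_bridge M B"
  shows "brownian_bridge (embed_measure M h) (\<lambda>t. B t \<circ> inv h)"
  unfolding brownian_bridge_def
proof (intro conjI ballI allI impI)
  have hm: "h \<in> measurable M (embed_measure M h)"
    by (rule measurable_embed_measure2[OF h])
  have Bm: "B t \<circ> inv h \<in> borel_measurable (embed_measure M h)" if "t \<in> {0..1}" for t
    using B that by (intro measurable_embed_measure1) (simp add: inv_f_f[OF h] brownian_bridge_def)
  show "B t \<circ> inv h \<in> borel_measurable (embed_measure M h)" if "t \<in> {0..1}" for t by (rule Bm[OF that])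
  show "continuous_on {0..1} (\<lambda>t. (B t \<circ> inv h) \<omega>)" if "\<omega> \<in> space (embed_measure M h)" for \<omega>
    using that B by (auto simp: space_embed_measure inv_f_f[OF h] brownian_bridge_def)
  fix k :: nat and ts lam :: "nat \<Rightarrow> real"
  assume ts: "\<forall>j<k. ts j \<in> {0..1}"
  have "(\<lambda>\<omega>. cis (\<Sum>j<k. lam j * (B (ts j) \<circ> inv h) \<omega>)) \<in> borel_measurable (embed_measure M h)"
  proof (rule measurable_compose[where g = cis])
    show "(\<lambda>\<omega>. \<Sum>j<k. lam j * (B (ts j) \<circ> inv h) \<omega>) \<in> borel_measurable (embed_measure M h)"
      using ts by (intro borel_measurable_sum borel_measurable_times Bm) auto
  qed (intro borel_measurable_continuous_onI continuous_on_cis continuous_on_id)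
  then have "(\<integral>\<omega>. cis (\<Sum>j<k. lam j * (B (ts j) \<circ> inv h) \<omega>) \<partial>embed_measure M h)
    = (\<integral>\<omega>. cis (\<Sum>j<k. lam j * B (ts j) \<omega>) \<partial>M)"
    by (subst embed_measure_eq_distr[OF h]) (subst integral_distr[OF hm], auto simp: inv_f_f[OF h])
  then show "(\<integral>\<omega>. cis (\<Sum>j<k. lam j * (B (ts j) \<circ> inv h) \<omega>) \<partial>embed_measure M h) =
      complex_of_real (exp (- (\<Sum>i<k. \<Sum>j<k. lam i * lam j * (min (ts i) (ts j) - ts i * ts j)) / 2))"
    using B ts by (simp add: brownian_bridge_def)
qed

lemma rw_bridge_process_embed:
  assumes h: "inj h" and S: "rw_bridge_process M n z S"
  shows "rw_bridge_process (embed_measure M h) n z (\<lambda>m. S m \<circ> inv h)"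
  unfolding rw_bridge_process_def
proof (intro conjI ballI allI)
  have hm: "h \<in> measurable M (embed_measure M h)"
    by (rule measurable_embed_measure2[OF h])
  have Sm: "S m \<circ> inv h \<in> measurable (embed_measure M h) (count_space UNIV)" for m
    using S by (intro measurable_embed_measure1) (simp add: inv_f_f[OF h] rw_bridge_process_def)
  then show "S m \<circ> inv h \<in> measurable (embed_measure M h) (count_space UNIV)" for m .
  fix p assume p: "p \<in> walk_paths n"
  let ?A = "{\<omega> \<in> space (embed_measure M h). \<forall>m\<le>n. (S m \<circ> inv h) \<omega> = p m}"
  have "{\<omega> \<in> space (embed_measure M h). (S m \<circ> inv h) \<omega> = p m} \<in> sets (embed_measure M h)" for m
    using measurable_sets[OF Sm[of m], of "{p m}"] by (simp add: vimage_def Int_def conj_commute)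
  then have "{\<omega> \<in> space (embed_measure M h). \<forall>m\<in>{..n}. (S m \<circ> inv h) \<omega> = p m} \<in> sets (embed_measure M h)"
    by (intro sets.sets_Collect_finite_All) auto
  also have "{\<omega> \<in> space (embed_measure M h). \<forall>m\<in>{..n}. (S m \<circ> inv h) \<omega> = p m} = ?A" by auto
  finally have "emeasure (embed_measure M h) ?A = emeasure M (h -` ?A \<inter> space M)"
    by (rule emeasure_embed_measure[OF h])
  also have "h -` ?A \<inter> space M = {\<omega> \<in> space M. \<forall>m\<le>n. S m \<omega> = p m}"
    by (auto simp: space_embed_measure inv_f_f[OF h])
  finally show "measure (embed_measure M h) ?A = srw_cond_prob n z p"
    using S p by (simp add: measure_def rw_bridge_process_def)
qed

lemma bridge_coupling_embed:
  assumes h: "inj h" and c: "bridge_coupling a b n C M B S D"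
  shows "bridge_coupling a b n C (embed_measure M h) (\<lambda>t. B t \<circ> inv h) (\<lambda>z m. S z m \<circ> inv h) (\<lambda>z. D z \<circ> inv h)"
proof -
  note d = c[unfolded bridge_coupling_def]
  have hm: "h \<in> measurable M (embed_measure M h)"
    by (rule measurable_embed_measure2[OF h])
  have "prob_space (embed_measure M h)"
    by (subst embed_measure_eq_distr[OF h]) (use d hm in \<open>auto intro: prob_space.prob_space_distr\<close>)
  moreover have "brownian_bridge (embed_measure M h) (\<lambda>t. B t \<circ> inv h)"
    using brownian_bridge_embed[OF h] d by blast
  moreover have "\<forall>\<omega>\<in>space (embed_measure M h). (B 0 \<circ> inv h) \<omega> = 0 \<and> (B 1 \<circ> inv h) \<omega> = 0"
    using d by (auto simp: space_embed_measure inv_f_f[OF h])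
  moreover have "\<forall>z m. S z m \<circ> inv h \<in> measurable (embed_measure M h) (count_space UNIV)"
    using d by (intro allI measurable_embed_measure1) (simp add: inv_f_f[OF h])
  moreover have Dm: "\<forall>z. D z \<circ> inv h \<in> borel_measurable (embed_measure M h)"
    using d by (intro allI measurable_embed_measure1) (simp add: inv_f_f[OF h])
  moreover have "\<forall>z. \<forall>\<omega>\<in>space (embed_measure M h). (S z 0 \<circ> inv h) \<omega> = 0 \<and> (S z n \<circ> inv h) \<omega> = z"
    using d by (auto simp: space_embed_measure inv_f_f[OF h])
  moreover have "\<forall>z\<in>L n. rw_bridge_process (embed_measure M h) n z (\<lambda>m. S z m \<circ> inv h)"
    using rw_bridge_process_embed[OF h] d by blast
  moreover have "\<forall>z\<in>L n. \<forall>\<omega>\<in>space (embed_measure M h). \<forall>t\<in>{0..real n}.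
       \<bar>sqrt (real n) * (B (t / real n) \<circ> inv h) \<omega> + t / real n * real_of_int z - interp (\<lambda>m. (S z m \<circ> inv h) \<omega>) t\<bar>
         \<le> (D z \<circ> inv h) \<omega>"
    using d by (auto simp: space_embed_measure inv_f_f[OF h])
  moreover have "\<forall>z\<in>L n. (\<integral>\<^sup>+ \<omega>. ennreal (exp (a * (D z \<circ> inv h) \<omega>)) \<partial>embed_measure M h)
      \<le> ennreal (C * exp (b * (real_of_int z)\<^sup>2 / real n))"
  proof
    fix z assume "z \<in> L n"
    have [measurable]: "(\<lambda>x. D z (inv h x)) \<in> borel_measurable (embed_measure M h)"
      using Dm by (simp add: comp_def)
    have "(\<integral>\<^sup>+ \<omega>. ennreal (exp (a * (D z \<circ> inv h) \<omega>)) \<partial>embed_measure M h) = (\<integral>\<^sup>+ \<omega>. ennreal (exp (a * D z \<omega>)) \<partial>M)"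
      by (subst nn_integral_embed_measure[OF h]) (auto simp: inv_f_f[OF h] comp_def)
    then show "(\<integral>\<^sup>+ \<omega>. ennreal (exp (a * (D z \<circ> inv h) \<omega>)) \<partial>embed_measure M h)
      \<le> ennreal (C * exp (b * (real_of_int z)\<^sup>2 / real n))" using d \<open>z \<in> L n\<close> by auto
  qed
  ultimately show ?thesis unfolding bridge_coupling_def by blast
qed

text \<open>Brings the triple of sample points created by gluing back into the type of sequences, so
  that the induction on the length stays within one type. Positions follow the heap numbering: the
  root holds \<open>g\<close>, odd places the left sequence, even places the right one.\<close>

definition interleave :: "real \<times> (nat \<Rightarrow> real) \<times> (nat \<Rightarrow> real) \<Rightarrow> nat \<Rightarrow> real" where
  "interleave = (\<lambda>(g, x, y) i. if i = 0 then g else if odd i then x (i div 2) else y (i div 2 - 1))"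

lemma inj_interleave: "inj interleave"
proof (rule injI)
  fix p q assume eq: "interleave p = interleave q"
  obtain g x y where p: "p = (g, x, y)" by (cases p) auto
  obtain g' x' y' where q: "q = (g', x', y')" by (cases q) auto
  have "g = g'" using fun_cong[OF eq, of 0] by (simp add: p q interleave_def)
  moreover have "x i = x' i" for i using fun_cong[OF eq, of "2 * i + 1"] by (simp add: p q interleave_def)
  moreover have "y i = y' i" for i using fun_cong[OF eq, of "2 * i + 2"] by (simp add: p q interleave_def)
  ultimately show "p = q" by (auto simp: p q)
qed

definition couplable :: "real \<Rightarrow> real \<Rightarrow> nat \<Rightarrow> real \<Rightarrow> bool" where
  "couplable a b n C \<longleftrightarrow> (\<exists>(M :: (nat \<Rightarrow> real) measure) B S D. bridge_coupling a b n C M B S D)"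

lemma couplable_glue:
  assumes "couplable a b n1 C1" "couplable a b n2 C2" "walk_splitting a b n1 n2 C1 C2 C W"
    and "n1 \<ge> 1" "n2 \<ge> 1" "a \<ge> 0" "C1 \<ge> 0" "C2 \<ge> 0"
  shows "couplable a b (n1 + n2) C"
proof -
  obtain M1 :: "(nat \<Rightarrow> real) measure" and B1 S1 D1 where 1: "bridge_coupling a b n1 C1 M1 B1 S1 D1"
    using assms(1) unfolding couplable_def by blast
  obtain M2 :: "(nat \<Rightarrow> real) measure" and B2 S2 D2 where 2: "bridge_coupling a b n2 C2 M2 B2 S2 D2"
    using assms(2) unfolding couplable_def by blast
  show ?thesis
    using bridge_coupling_glue[OF 1 2 assms(3-8)] bridge_coupling_embed[OF inj_interleave] unfolding couplable_def by blast
qed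

lemma couplable_mono: "couplable a b n C \<Longrightarrow> C \<le> C' \<Longrightarrow> couplable a b n C'"
proof -
  assume c: "couplable a b n C" and le: "C \<le> C'"
  obtain M :: "(nat \<Rightarrow> real) measure" and B S D where *: "bridge_coupling a b n C M B S D"
    using c unfolding couplable_def by blast
  have "ennreal (C * exp x) \<le> ennreal (C' * exp x)" for x
    using le by (intro ennreal_leI mult_right_mono) auto
  then have "bridge_coupling a b n C' M B S D"
    using * unfolding bridge_coupling_def by (meson order_trans)
  then show ?thesis unfolding couplable_def by blast
qed

text \<open>\<open>2 powr \<alpha> = K * K\<close>, because halving the length costs one even splitting and at most one odd one.\<close>
lemma couplable_all:
  assumes b: "0 < b" "b \<le> 1 / 14" and a: "0 \<le> a" "400 * a \<le> b" and C: "C \<ge> 0" "couplable a b 1 C"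
  defines "K \<equiv> 2 * exp 4 * sqrt 2" and "\<alpha> \<equiv> 2 * log 2 (2 * exp 4 * sqrt 2)"
  shows "n \<ge> 1 \<Longrightarrow> couplable a b n (C * real n powr \<alpha>)"
proof (induction n rule: less_induct)
  case (less n)
  have "1 \<le> exp (4::real)" "1 \<le> sqrt (2::real)" by simp_all
  then have "1 * 1 \<le> exp 4 * sqrt (2::real)" by (intro mult_mono) auto
  then have K: "K > 1" by (simp add: K_def)
  then have \<alpha>: "\<alpha> \<ge> 0" by (simp add: \<alpha>_def K_def)
  have two: "2 powr \<alpha> = K * K"
  proof -
    have "2 powr \<alpha> = 2 powr (log 2 K) * 2 powr (log 2 K)"
      unfolding powr_add[symmetric] by (simp add: \<alpha>_def K_def)
    then show ?thesis using K by simp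
  qed
  consider "n = 1" | m where "n = m + m" "m \<ge> 1" | m where "n = 1 + (m + m)" "m \<ge> 1"
  proof -
    have "n = 2 * (n div 2) + n mod 2" by simp
    moreover have "n mod 2 = 0 \<or> n mod 2 = 1" by auto
    ultimately show ?thesis using that less.prems by (metis One_nat_def add.commute add_0 add_cancel_right_right le_zero_eq
      less_one linorder_not_le mult_2 nat_le_linear)
  qed
  then show ?case
  proof cases
    case 1
    then show ?thesis using C by simp
  next
    case (2 m)
    let ?C = "C * real m powr \<alpha>"
    have C0: "?C \<ge> 0" using C by simp
    have m: "couplable a b m ?C" using less.IH[of m] 2 by simp
    obtain W where "walk_splitting a b m m ?C ?C (K * ?C) W"
      using even_splitting[OF 2(2) b a C0] unfolding K_def by blast
    from couplable_glue[OF m m this 2(2) 2(2) a(1) C0 C0] have "couplable a b n (K * ?C)"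
      using 2(1) by simp
    moreover have "K * ?C \<le> C * real n powr \<alpha>"
    proof -
      have "real n powr \<alpha> = K * K * real m powr \<alpha>"
        unfolding two[symmetric] by (simp add: 2 powr_mult[symmetric])
      moreover have "1 * (K * ?C) \<le> K * (K * ?C)" using K C0 by (intro mult_right_mono) auto
      ultimately show ?thesis by (simp add: mult_ac)
    qed
    ultimately show ?thesis by (rule couplable_mono)
  next
    case (3 m)
    let ?C = "C * real m powr \<alpha>"
    have C0: "?C \<ge> 0" "K * ?C \<ge> 0" using C K by auto
    have m: "couplable a b m ?C" using less.IH[of m] 3 by simp
    obtain W where "walk_splitting a b m m ?C ?C (K * ?C) W"
      using even_splitting[OF 3(2) b a C0(1)] unfolding K_def by blast
    from couplable_glue[OF m m this 3(2) 3(2) a(1) C0(1) C0(1)] have mm: "couplable a b (m + m) (K * ?C)" .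
    \<comment> \<open>\<open>odd_splitting\<close> takes one constant for both parts, so the
      constant of the length 1 coupling has to be raised to that of length
      \<open>m + m\<close>.\<close>
    have "1 \<le> real m powr \<alpha>" using 3 \<alpha> by (simp add: ge_one_powr_ge_zero)
    then have "1 * 1 \<le> K * real m powr \<alpha>" using K by (intro mult_mono) auto
    then have "C * 1 \<le> C * (K * real m powr \<alpha>)" using C(1) by (intro mult_left_mono) auto
    then have one: "couplable a b 1 (K * ?C)" using C(2) couplable_mono by (auto simp: mult_ac)
    have mm1: "m + m \<ge> 1" using 3 by simp
    obtain W' where "walk_splitting a b 1 (m + m) (K * ?C) (K * ?C) (K * (K * ?C)) W'"
      using odd_splitting[OF mm1 b a C0(2)] unfolding K_def by blast
    from couplable_glue[OF one mm this order_refl mm1 a(1) C0(2) C0(2)]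
    have "couplable a b n (K * (K * ?C))" using 3(1) by simp
    moreover have "K * (K * ?C) \<le> C * real n powr \<alpha>"
    proof -
      have "K * (K * ?C) = C * (2 * real m) powr \<alpha>"
        by (simp add: powr_mult two)
      also have "\<dots> \<le> C * real n powr \<alpha>"
        using 3 \<alpha> C(1) by (intro mult_left_mono powr_mono2) auto
      finally show ?thesis .
    qed
    ultimately show ?thesis by (rule couplable_mono)
  qed
qed

text \<open>With a single step the interpolated walk is the line \<open>t * z\<close>, which cancels
  the drift; the discrepancy is the supremum of the bridge itself, at most
  \<open>16 * levy_radius\<close>. Hence the condition \<open>a \<le> 1 / 16\<close>.\<close>

lemma couplable_one:
  assumes "0 \<le> a" "a \<le> 1 / 16" "b \<ge> 0"
  shows "couplable a b 1 (enn2real (\<integral>\<^sup>+ \<omega>. ennreal (exp (levy_radius \<omega>)) \<partial>gauss_seq))"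
proof -
  have prob: "prob_space gauss_seq" by (intro prob_space_PiM std_normal.prob_space_axioms)
  define C where "C = enn2real (\<integral>\<^sup>+ \<omega>. ennreal (exp (levy_radius \<omega>)) \<partial>gauss_seq)"
  have C: "(\<integral>\<^sup>+ \<omega>. ennreal (exp (levy_radius \<omega>)) \<partial>gauss_seq) = ennreal C"
    using levy_radius_integral by (simp add: C_def)
  \<comment> \<open>The endpoint is \<open>z\<close> for every integer, attainable or not, because
    \<open>bridge_coupling\<close> pins the processes for all \<open>z\<close>.\<close>
  define S where "S z m \<omega> = (if m = 1 then z else 0)" for z :: int and m :: nat and \<omega> :: "nat \<Rightarrow> real"
  define D where "D z \<omega> = 16 * levy_radius \<omega>" for z :: int and \<omega>
  have ends: "levy_bridge 0 \<omega> = 0 \<and> levy_bridge 1 \<omega> = 0" for \<omega>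
    by (simp add: levy_bridge_def schauder_ends)
  have law: "rw_bridge_process gauss_seq 1 z (S z)" if z: "z \<in> L 1" for z
    unfolding rw_bridge_process_def
  proof (intro conjI allI ballI)
    show "S z m \<in> measurable gauss_seq (count_space UNIV)" for m unfolding S_def by measurable
    fix p assume p: "p \<in> walk_paths 1"
    have cnt: "walk_count 1 z = 1"
    proof -
      obtain T where "T \<le> 1" "z = 2 * int T - int 1" using z unfolding L_eq by blast
      then show ?thesis using walk_count_binomial[of 1 T] by (cases T) auto
    qed
    have "(\<forall>m\<le>1. S z m \<omega> = p m) \<longleftrightarrow> p 1 = z" for \<omega>
    proof -
      have "(\<forall>m\<le>1. S z m \<omega> = p m) \<longleftrightarrow> S z 0 \<omega> = p 0 \<and> S z 1 \<omega> = p 1"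
        by (auto simp: le_Suc_eq)
      then show ?thesis using p by (auto simp: S_def walk_paths_def)
    qed
    then show "measure gauss_seq {\<omega> \<in> space gauss_seq. \<forall>m\<le>1. S z m \<omega> = p m} = srw_cond_prob 1 z p"
      using prob_space.prob_space[OF prob] by (cases "p 1 = z") (simp_all only: srw_cond_prob_eq cnt, simp_all)
  qed
  have interp: "interp (\<lambda>m. S z m \<omega>) t = t * real_of_int z" if "t \<in> {0..1}" for z \<omega> t
  proof (cases "t = 1")
    case False
    then have "nat \<lfloor>t\<rfloor> = 0" using that by (simp add: floor_eq_iff nat_eq_iff)
    then show ?thesis by (simp add: interp_def S_def)
  qed (simp add: interp_def S_def)
  have bound: "\<bar>sqrt (real 1) * levy_bridge (t / real 1) \<omega> + t / real 1 * real_of_int z - interp (\<lambda>m. S z m \<omega>) t\<bar> \<le> D z \<omega>"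
    if "t \<in> {0..real 1}" for t z \<omega>
    using that levy_bound[of t \<omega>] by (simp add: interp D_def)
  have int: "(\<integral>\<^sup>+ \<omega>. ennreal (exp (a * D z \<omega>)) \<partial>gauss_seq) \<le> ennreal (C * exp (b * (real_of_int z)\<^sup>2 / real 1))" for z
  proof -
    have "a * D z \<omega> \<le> levy_radius \<omega>" for \<omega>
      using mult_right_mono[of "a * 16" 1 "levy_radius \<omega>"] assms(2) levy_radius_nonneg[of \<omega>] by (simp add: D_def)
    then have "(\<integral>\<^sup>+ \<omega>. ennreal (exp (a * D z \<omega>)) \<partial>gauss_seq) \<le> (\<integral>\<^sup>+ \<omega>. ennreal (exp (levy_radius \<omega>)) \<partial>gauss_seq)"
      by (intro nn_integral_mono ennreal_leI) simp
    also have "\<dots> \<le> ennreal (C * exp (b * (real_of_int z)\<^sup>2 / real 1))"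
      unfolding C using assms(3) mult_left_mono[of 1 "exp (b * (real_of_int z)\<^sup>2)" C] by (intro ennreal_leI) (simp add: C_def)
    finally show ?thesis .
  qed
  have "bridge_coupling a b 1 C gauss_seq levy_bridge S D"
    unfolding bridge_coupling_def
  proof (intro conjI allI ballI)
    show "prob_space gauss_seq" by (rule prob)
    show "brownian_bridge gauss_seq levy_bridge" by (rule levy_brownian_bridge)
    show "S z m \<in> measurable gauss_seq (count_space UNIV)" for z m unfolding S_def by measurable
    show "D z \<in> borel_measurable gauss_seq" for z unfolding D_def by measurable
    show "S z 0 \<omega> = 0" "S z 1 \<omega> = z" for z \<omega> by (simp_all add: S_def)
  qed (use ends in \<open>blast intro: law bound int\<close>)+
  then show ?thesis unfolding couplable_def C_def by blast
qed

theorem theorem2: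
  fixes b :: real
  assumes "b > 0"
  shows "\<exists>c a \<alpha> :: real. c > 0 \<and> a > 0 \<and> \<alpha> > 0 \<and>
    (\<forall>n::nat. n \<ge> 1 \<longrightarrow>
      (\<exists>(M :: (nat \<Rightarrow> real) measure) (B :: real \<Rightarrow> (nat \<Rightarrow> real) \<Rightarrow> real)
          (S :: int \<Rightarrow> nat \<Rightarrow> (nat \<Rightarrow> real) \<Rightarrow> int).
         prob_space M \<and> brownian_bridge M B \<and>
         (\<forall>z\<in>L n. rw_bridge_process M n z (S z)) \<and>
         (\<forall>z\<in>L n. (\<integral>\<^sup>+ \<omega>. ennreal (exp (a * Delta n z B (S z) \<omega>)) \<partial>M)
             \<le> ennreal (c * real n powr \<alpha> * exp (b * real_of_int z ^ 2 / real n)))))"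
proof -
  \<comment> \<open>The bound for \<open>b'\<close> implies the one for \<open>b\<close>, since the
    exponential on the right grows with \<open>b\<close>.\<close>
  define b' where "b' = min b (1 / 14)"
  have b': "0 < b'" "b' \<le> 1 / 14" "b' \<le> b" using assms by (auto simp: b'_def)
  define a where "a = b' / 400"
  have a: "0 < a" "0 \<le> a" "400 * a \<le> b'" "a \<le> 1 / 16" using b' by (auto simp: a_def)
  \<comment> \<open>The maximum with 1 serves the positivity demanded of \<open>c\<close>.\<close>
  define c where "c = max 1 (enn2real (\<integral>\<^sup>+ \<omega>. ennreal (exp (levy_radius \<omega>)) \<partial>gauss_seq))"
  have c: "c > 0" "c \<ge> 0" by (auto simp: c_def)
  have "couplable a b' 1 c"
    by (rule couplable_mono[OF couplable_one]) (use a b' in \<open>auto simp: c_def\<close>)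
  define \<alpha> where "\<alpha> = 2 * log 2 (2 * exp 4 * sqrt 2)"
  have "1 < exp (4::real)" "1 < sqrt (2::real)" by simp_all
  then have "1 * 1 < exp 4 * sqrt (2::real)" by (intro mult_strict_mono) auto
  then have \<alpha>: "\<alpha> > 0" by (simp add: \<alpha>_def)
  have "\<exists>(M :: (nat \<Rightarrow> real) measure) B S. prob_space M \<and> brownian_bridge M B \<and>
         (\<forall>z\<in>L n. rw_bridge_process M n z (S z)) \<and>
         (\<forall>z\<in>L n. (\<integral>\<^sup>+ \<omega>. ennreal (exp (a * Delta n z B (S z) \<omega>)) \<partial>M)
             \<le> ennreal (c * real n powr \<alpha> * exp (b * real_of_int z ^ 2 / real n)))" if n: "n \<ge> 1" for n
  proof -
    obtain M :: "(nat \<Rightarrow> real) measure" and B S D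
      where coupling: "bridge_coupling a b' n (c * real n powr \<alpha>) M B S D"
      using couplable_all[OF b'(1,2) a(2,3) c(2) \<open>couplable a b' 1 c\<close> n] unfolding couplable_def \<alpha>_def by blast
    note d = coupling[unfolded bridge_coupling_def]
    have "(\<integral>\<^sup>+ \<omega>. ennreal (exp (a * Delta n z B (S z) \<omega>)) \<partial>M)
             \<le> ennreal (c * real n powr \<alpha> * exp (b * real_of_int z ^ 2 / real n))" if z: "z \<in> L n" for z
    proof -
      have "Delta n z B (S z) \<omega> \<le> D z \<omega>" if "\<omega> \<in> space M" for \<omega>
        unfolding Delta_def by (rule cSUP_least) (use d z that in auto)
      then have "(\<integral>\<^sup>+ \<omega>. ennreal (exp (a * Delta n z B (S z) \<omega>)) \<partial>M) \<le> (\<integral>\<^sup>+ \<omega>. ennreal (exp (a * D z \<omega>)) \<partial>M)"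
        using a by (intro nn_integral_mono ennreal_leI) auto
      also have "\<dots> \<le> ennreal (c * real n powr \<alpha> * exp (b' * (real_of_int z)\<^sup>2 / real n))"
        using d z by blast
      also have "\<dots> \<le> ennreal (c * real n powr \<alpha> * exp (b * (real_of_int z)\<^sup>2 / real n))"
        using b' c by (intro ennreal_leI mult_left_mono) (auto intro!: divide_right_mono mult_right_mono)
      finally show ?thesis .
    qed
    then show ?thesis using d by blast
  qed
  then show ?thesis using c(1) a(1) \<alpha> by blast
qed

end
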